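(* Let $F:(M_1^{m_1},g_1,J_1)\to(M_2^{m_2},g_2)$ be a pointwise slant Riemannian submersion with vertical space of dimension $r\ge3$ and slant function $\theta$. Then, at every point: (1) If $M_1(c)$ is a real space form, then $$\rho^{\mathcal V}\le\delta_C^{\mathcal V}(r-1)+c,\qquad\rho^{\mathcal V}\le\hat\delta_C^{\mathcal V}(r-1)+c.$$ (2) If $M_1(c)$ is a complex space form, then $$\rho^{\mathcal V}\le\delta_C^{\mathcal V}(r-1)+\frac c4\Big(1+\frac{3}{r-1}\cos^2\theta\Big),\qquad\rho^{\mathcal V}\le\hat\delta_C^{\mathcal V}(r-1)+\frac c4\Big(1+\frac{3}{r-1}\cos^2\theta\Big).$$ (3) If $M_1(c)$ is a real Kähler space form (with parameters $c,\alpha$), then $$\rho^{\mathcal V}\le\delta_C^{\mathcal V}(r-1)+\frac{c+3\alpha}{4}+\frac{3(c-\alpha)}{4(r-1)}\cos^2\theta,\qquad\rho^{\mathcal V}\le\hat\delta_C^{\mathcal V}(r-1)+\frac{c+3\alpha}{4}+\frac{3(c-\alpha)}{4(r-1)}\cos^2\theta.$$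
   Context: All manifolds are smooth, connected, without boundary. A Riemannian submersion $F:(M_1^{m_1},g_1)\to(M_2^{m_2},g_2)$ has vertical distribution $\mathcal V=\ker F_*$ and horizontal distribution $\mathcal H=(\ker F_* )^\perp$; $\mathcal V,\mathcal H$ also denote the orthogonal projections. $\nabla$ is the Levi-Civita connection of $g_1$. O'Neill's tensor $T$ is $T_EG=\mathcal H\nabla_{\mathcal VE}\mathcal VG+\mathcal V\nabla_{\mathcal VE}\mathcal HG$. Generalized complex space form $M_1(c_1,c_2)$: an almost Hermitian manifold $(M_1,g_1,J_1)$ ($J_1^2=-I$, $g_1(J_1X,J_1Y)=g_1(X,Y)$) whose curvature tensor satisfies, for smooth functions $c_1,c_2$, $$R(X,Y)Z=c_1\{g_1(Y,Z)X-g_1(X,Z)Y\}+c_2\{g_1(X,J_1Z)J_1Y-g_1(Y,J_1Z)J_1X+2g_1(X,J_1Y)J_1Z\}.$$ Special cases: real space form (constant sectional curvature $c$): $c_1=c$, $c_2=0$; complex space form (Kähler, constant holomorphic sectional curvature $c$): $c_1=c_2=c/4$; real Kähler space form: $c_1=(c+3\alpha)/4$, $c_2=(c-\alpha)/4$, with $c,\alpha$ real constants. Pointwise slant: for vertical $U$ write $J_1U=P^{\mathcal V}U+Q^{\mathcal V}U$ with $P^{\mathcal V}U$ vertical and $Q^{\mathcal V}U$ horizontal. $F$ is pointwise slant with slant function $\theta:M_1\to[0,\pi/2]$ if at each $p\in M_1$ the angle between $J_1U$ and $\mathcal V_p$ equals $\theta(p)$ for every nonzero $U\in\mathcal V_p$;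 equivalently $\|P^{\mathcal V}U\|=\cos\theta(p)\,\|U\|$, i.e. $(P^{\mathcal V})^2=-\cos^2\theta\,I$. Vertical Casorati curvatures at $p$: let $\{U_1,\dots,U_r\}$, $\{U_{r+1},\dots,U_{m_1}\}$ be orthonormal bases of $\mathcal V_p$, $\mathcal H_p$, and $T_{ij}^\alpha=g_1(T_{U_i}U_j,U_\alpha)$ (here $\alpha$ is an index). Then $C^{\mathcal V}=\frac1r\sum_{\alpha}\sum_{i,j=1}^r(T_{ij}^\alpha)^2$; for a $k$-dimensional subspace $L\subset\mathcal V_p$ ($k\ge2$) with orthonormal basis $\{U_1,\dots,U_k\}$, $C(L)=\frac1k\sum_\alpha\sum_{i,j=1}^k(T_{ij}^\alpha)^2$; and, with $L$ ranging over hyperplanes ($(r-1)$-dimensional subspaces) of $\mathcal V_p$, $$\delta_C^{\mathcal V}(r-1)=\tfrac12C^{\mathcal V}+\tfrac{r+1}{2r}\inf_LC(L),\qquad \hat\delta_C^{\mathcal V}(r-1)=2C^{\mathcal V}-\tfrac{2r-1}{2r}\sup_LC(L).$$ Normalized scalar curvature of the fibers: $\rho^{\mathcal V}=\frac{2\tau^{\mathcal V}}{r(r-1)}$ with $2\tau^{\mathcal V}=\sum_{i,j=1}^r g_1(\hat R(U_i,U_j)U_j,U_i)$, where $\hat R$ is the (intrinsic) curvature tensor of the fibers. *)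

theory Defs
  imports "HOL-Analysis.Analysis"
begin

section \<open>Smooth manifolds\<close>

text \<open>
  \<open>Ck_on\<close> and \<open>smooth_on\<close> are only meant for open sets \<open>S\<close>.
\<close>

primrec Ck_on ::
  "nat \<Rightarrow> ('e::euclidean_space \<Rightarrow> 'b::real_normed_vector) \<Rightarrow> 'e set \<Rightarrow> bool" where
  "Ck_on 0 f S \<longleftrightarrow> continuous_on S f"
| "Ck_on (Suc k) f S \<longleftrightarrow>
     f differentiable_on S \<and> (\<forall>v. Ck_on k (\<lambda>x. frechet_derivative f (at x) v) S)"

definition smooth_on ::
  "('e::euclidean_space \<Rightarrow> 'b::real_normed_vector) \<Rightarrow> 'e set \<Rightarrow> bool" where
  "smooth_on f S \<longleftrightarrow> (\<forall>k. Ck_on k f S)"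

type_synonym ('a, 'e) chart = "'a set \<times> ('a \<Rightarrow> 'e)"

definition param :: "('a, 'e) chart \<Rightarrow> 'e \<Rightarrow> 'a" where
  "param c = inv_into (fst c) (snd c)"

definition is_chart :: "'a topology \<Rightarrow> ('a, 'e::euclidean_space) chart \<Rightarrow> bool" where
  "is_chart X c \<longleftrightarrow>
     openin X (fst c) \<and> open (snd c ` fst c) \<and>
     homeomorphic_map (subtopology X (fst c)) (top_of_set (snd c ` fst c)) (snd c)"

record ('a, 'e) manifold =
  mtop :: "'a topology"
  atlas :: "('a, 'e) chart set"

abbreviation points :: "('a, 'e, 'z) manifold_scheme \<Rightarrow> 'a set" where
  "points M \<equiv> topspace (mtop M)"

text \<open>Connected smooth manifolds without boundary; the dimension is \<open>DIM('e)\<close>.\<close>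

definition smooth_manifold :: "('a, 'e::euclidean_space, 'z) manifold_scheme \<Rightarrow> bool" where
  "smooth_manifold M \<longleftrightarrow>
     Hausdorff_space (mtop M) \<and> second_countable (mtop M) \<and> connected_space (mtop M) \<and>
     (\<forall>c \<in> atlas M. is_chart (mtop M) c) \<and>
     \<Union> (fst ` atlas M) = points M \<and>
     (\<forall>c \<in> atlas M. \<forall>d \<in> atlas M. smooth_on (snd d \<circ> param c) (snd c ` (fst c \<inter> fst d)))"

text \<open>
  A tangent vector at \<open>p\<close> is represented by its components in one chart around \<open>p\<close>, fixed once
  and for all: every tangent space is a copy of \<open>'e\<close>, a vector field is a function
  \<open>'a \<Rightarrow> 'e\<close>, and a tensor field is a function of the point and of vectors in \<open>'e\<close>.
  \<open>change c d p\<close> turns the components of a vector at \<open>p\<close> in the chart \<open>c\<close> into those in \<open>d\<close>.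
\<close>

definition chart_at :: "('a, 'e, 'z) manifold_scheme \<Rightarrow> 'a \<Rightarrow> ('a, 'e) chart" where
  "chart_at M p = (SOME c. c \<in> atlas M \<and> p \<in> fst c)"

definition coord_at :: "('a, 'e, 'z) manifold_scheme \<Rightarrow> 'a \<Rightarrow> 'e" where
  "coord_at M p = snd (chart_at M p) p"

definition change ::
  "('a, 'e::euclidean_space) chart \<Rightarrow> ('a, 'e) chart \<Rightarrow> 'a \<Rightarrow> 'e \<Rightarrow> 'e" where
  "change c d p = frechet_derivative (snd d \<circ> param c) (at (snd c p))"

definition smooth_map ::
  "('a, 'e::euclidean_space, 'y) manifold_scheme \<Rightarrow> ('b, 'f::euclidean_space, 'z) manifold_scheme
    \<Rightarrow> ('a \<Rightarrow> 'b) \<Rightarrow> bool" where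
  "smooth_map M N F \<longleftrightarrow>
     continuous_map (mtop M) (mtop N) F \<and>
     (\<forall>c \<in> atlas M. \<forall>d \<in> atlas N.
        smooth_on (snd d \<circ> F \<circ> param c) (snd c ` (fst c \<inter> F -` fst d)))"

definition smooth_function ::
  "('a, 'e::euclidean_space, 'z) manifold_scheme \<Rightarrow> ('a \<Rightarrow> real) \<Rightarrow> bool" where
  "smooth_function M f \<longleftrightarrow> (\<forall>c \<in> atlas M. smooth_on (f \<circ> param c) (snd c ` fst c))"

definition tangent_map ::
  "('a, 'e::euclidean_space, 'y) manifold_scheme \<Rightarrow> ('b, 'f::euclidean_space, 'z) manifold_scheme
    \<Rightarrow> ('a \<Rightarrow> 'b) \<Rightarrow> 'a \<Rightarrow> 'e \<Rightarrow> 'f" where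
  "tangent_map M N F p =
     frechet_derivative (snd (chart_at N (F p)) \<circ> F \<circ> param (chart_at M p)) (at (coord_at M p))"

text \<open>
  Local representatives, on the coordinate domain of an arbitrary chart \<open>c\<close>, of a covariant
  2-tensor field and of a field of endomorphisms of the tangent spaces.
\<close>

definition form_rep ::
  "('a, 'e::euclidean_space, 'z) manifold_scheme \<Rightarrow> ('a \<Rightarrow> 'e \<Rightarrow> 'e \<Rightarrow> real) \<Rightarrow> ('a, 'e) chart
    \<Rightarrow> 'e \<Rightarrow> 'e \<Rightarrow> 'e \<Rightarrow> real" where
  "form_rep M g c x u v =
     (let q = param c x; d = chart_at M q in g q (change c d q u) (change c d q v))"

definition endo_rep ::
  "('a, 'e::euclidean_space, 'z) manifold_scheme \<Rightarrow> ('a \<Rightarrow> 'e \<Rightarrow> 'e) \<Rightarrow> ('a, 'e) chart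
    \<Rightarrow> 'e \<Rightarrow> 'e \<Rightarrow> 'e" where
  "endo_rep M A c x u =
     (let q = param c x; d = chart_at M q in change d c q (A q (change c d q u)))"

section \<open>Linear algebra with respect to an inner product\<close>

definition inner_form :: "('e::euclidean_space \<Rightarrow> 'e \<Rightarrow> real) \<Rightarrow> bool" where
  "inner_form b \<longleftrightarrow> bilinear b \<and> (\<forall>u v. b u v = b v u) \<and> (\<forall>u. u \<noteq> 0 \<longrightarrow> 0 < b u u)"

definition norm_wrt :: "('e \<Rightarrow> 'e \<Rightarrow> real) \<Rightarrow> 'e \<Rightarrow> real" where
  "norm_wrt b u = sqrt (b u u)"

definition orth_proj :: "('e::euclidean_space \<Rightarrow> 'e \<Rightarrow> real) \<Rightarrow> 'e set \<Rightarrow> 'e \<Rightarrow> 'e" where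
  "orth_proj b W u = (THE v. v \<in> W \<and> (\<forall>w \<in> W. b (u - v) w = 0))"

definition angle_to_subspace ::
  "('e::euclidean_space \<Rightarrow> 'e \<Rightarrow> real) \<Rightarrow> 'e \<Rightarrow> 'e set \<Rightarrow> real" where
  "angle_to_subspace b u W = arccos (norm_wrt b (orth_proj b W u) / norm_wrt b u)"

definition orthonormal_basis ::
  "('e::euclidean_space \<Rightarrow> 'e \<Rightarrow> real) \<Rightarrow> 'e set \<Rightarrow> 'e set \<Rightarrow> bool" where
  "orthonormal_basis b W B \<longleftrightarrow>
     finite B \<and> span B = W \<and> (\<forall>u \<in> B. \<forall>v \<in> B. b u v = (if u = v then 1 else 0))"

definition some_onb :: "('e::euclidean_space \<Rightarrow> 'e \<Rightarrow> real) \<Rightarrow> 'e set \<Rightarrow> 'e set" where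
  "some_onb b W = (SOME B. orthonormal_basis b W B)"

section \<open>The Levi-Civita connection and its curvature\<close>

text \<open>
  Here \<open>G\<close> is a metric on an open subset of \<open>'e\<close>. The bilinear map \<open>christoffel G x\<close> collects
  the Christoffel symbols of the Levi-Civita connection: the one torsion-free (i.e. symmetric)
  choice which makes \<open>G\<close> parallel.
\<close>

definition christoffel ::
  "('e::euclidean_space \<Rightarrow> 'e \<Rightarrow> 'e \<Rightarrow> real) \<Rightarrow> 'e \<Rightarrow> 'e \<Rightarrow> 'e \<Rightarrow> 'e" where
  "christoffel G x = (THE \<Gamma>. bilinear \<Gamma> \<and> (\<forall>u v. \<Gamma> u v = \<Gamma> v u) \<and>
     (\<forall>u v w. frechet_derivative (\<lambda>y. G y v w) (at x) u = G x (\<Gamma> u v) w + G x v (\<Gamma> u w)))"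

definition nabla ::
  "('e::euclidean_space \<Rightarrow> 'e \<Rightarrow> 'e \<Rightarrow> real) \<Rightarrow> ('e \<Rightarrow> 'e) \<Rightarrow> ('e \<Rightarrow> 'e) \<Rightarrow> 'e \<Rightarrow> 'e" where
  "nabla G X Y x = frechet_derivative Y (at x) (X x) + christoffel G x (X x) (Y x)"

definition lie_bracket ::
  "('e::euclidean_space \<Rightarrow> 'e) \<Rightarrow> ('e \<Rightarrow> 'e) \<Rightarrow> 'e \<Rightarrow> 'e" where
  "lie_bracket X Y x = frechet_derivative Y (at x) (X x) - frechet_derivative X (at x) (Y x)"

definition curvature_field ::
  "('e::euclidean_space \<Rightarrow> 'e \<Rightarrow> 'e \<Rightarrow> real) \<Rightarrow> ('e \<Rightarrow> 'e) \<Rightarrow> ('e \<Rightarrow> 'e) \<Rightarrow> ('e \<Rightarrow> 'e)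
    \<Rightarrow> 'e \<Rightarrow> 'e" where
  "curvature_field G X Y Z x =
     nabla G X (nabla G Y Z) x - nabla G Y (nabla G X Z) x - nabla G (lie_bracket X Y) Z x"

section \<open>Riemannian manifolds\<close>

record ('a, 'e) riemannian = "('a, 'e) manifold" +
  metric :: "'a \<Rightarrow> 'e \<Rightarrow> 'e \<Rightarrow> real"

definition metric_rep ::
  "('a, 'e::euclidean_space) riemannian \<Rightarrow> ('a, 'e) chart \<Rightarrow> 'e \<Rightarrow> 'e \<Rightarrow> 'e \<Rightarrow> real" where
  "metric_rep M c = form_rep M (metric M) c"

definition riemannian_manifold :: "('a, 'e::euclidean_space) riemannian \<Rightarrow> bool" where
  "riemannian_manifold M \<longleftrightarrow>
     smooth_manifold M \<and> (\<forall>p \<in> points M. inner_form (metric M p)) \<and>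
     (\<forall>c \<in> atlas M. \<forall>u v. smooth_on (\<lambda>x. metric_rep M c x u v) (snd c ` fst c))"

text \<open>
  The curvature is tensorial, so vectors at \<open>p\<close> may be extended to the fields that are constant
  in the chart at \<open>p\<close>.
\<close>

definition curvature ::
  "('a, 'e::euclidean_space) riemannian \<Rightarrow> 'a \<Rightarrow> 'e \<Rightarrow> 'e \<Rightarrow> 'e \<Rightarrow> 'e" where
  "curvature M p u v w =
     curvature_field (metric_rep M (chart_at M p)) (\<lambda>_. u) (\<lambda>_. v) (\<lambda>_. w) (coord_at M p)"

definition normalized_scalar_curvature ::
  "('a, 'e::euclidean_space) riemannian \<Rightarrow> 'a \<Rightarrow> real" where
  "normalized_scalar_curvature M p =
     (let B = some_onb (metric M p) UNIV
      in (\<Sum>u\<in>B. \<Sum>v\<in>B. metric M p (curvature M p u v v) u) / (real DIM('e) * (real DIM('e) - 1)))"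

section \<open>Almost Hermitian manifolds and generalized complex space forms\<close>

definition almost_hermitian ::
  "('a, 'e::euclidean_space) riemannian \<Rightarrow> ('a \<Rightarrow> 'e \<Rightarrow> 'e) \<Rightarrow> bool" where
  "almost_hermitian M J \<longleftrightarrow>
     riemannian_manifold M \<and>
     (\<forall>p \<in> points M. linear (J p) \<and> (\<forall>u. J p (J p u) = - u) \<and>
        (\<forall>u v. metric M p (J p u) (J p v) = metric M p u v)) \<and>
     (\<forall>c \<in> atlas M. \<forall>u. smooth_on (\<lambda>x. endo_rep M J c x u) (snd c ` fst c))"

text \<open>\<open>J\<close> is parallel: \<open>\<nabla>\<^sub>u (J w) = J (\<nabla>\<^sub>u w)\<close>, tested on fields constant in the chart at \<open>p\<close>.\<close>

definition kaehler ::
  "('a, 'e::euclidean_space) riemannian \<Rightarrow> ('a \<Rightarrow> 'e \<Rightarrow> 'e) \<Rightarrow> bool" where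
  "kaehler M J \<longleftrightarrow> almost_hermitian M J \<and>
     (\<forall>p \<in> points M. \<forall>u w.
        (let c = chart_at M p; G = metric_rep M c; x = coord_at M p; Jc = endo_rep M J c
         in nabla G (\<lambda>_. u) (\<lambda>y. Jc y w) x = Jc x (nabla G (\<lambda>_. u) (\<lambda>_. w) x)))"

definition generalized_complex_space_form ::
  "('a, 'e::euclidean_space) riemannian \<Rightarrow> ('a \<Rightarrow> 'e \<Rightarrow> 'e) \<Rightarrow> ('a \<Rightarrow> real) \<Rightarrow> ('a \<Rightarrow> real)
    \<Rightarrow> bool" where
  "generalized_complex_space_form M J c1 c2 \<longleftrightarrow>
     almost_hermitian M J \<and> smooth_function M c1 \<and> smooth_function M c2 \<and>
     (\<forall>p \<in> points M. \<forall>X Y Z. let g = metric M p; j = J p in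
        curvature M p X Y Z =
          c1 p *\<^sub>R (g Y Z *\<^sub>R X - g X Z *\<^sub>R Y) +
          c2 p *\<^sub>R (g X (j Z) *\<^sub>R j Y - g Y (j Z) *\<^sub>R j X + (2 * g X (j Y)) *\<^sub>R j Z))"

definition real_space_form ::
  "('a, 'e::euclidean_space) riemannian \<Rightarrow> ('a \<Rightarrow> 'e \<Rightarrow> 'e) \<Rightarrow> real \<Rightarrow> bool" where
  "real_space_form M J c \<longleftrightarrow> generalized_complex_space_form M J (\<lambda>_. c) (\<lambda>_. 0)"

text \<open>For this curvature tensor the holomorphic sectional curvature is \<open>c/4 + 3 * c/4 = c\<close>.\<close>

definition complex_space_form ::
  "('a, 'e::euclidean_space) riemannian \<Rightarrow> ('a \<Rightarrow> 'e \<Rightarrow> 'e) \<Rightarrow> real \<Rightarrow> bool" where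
  "complex_space_form M J c \<longleftrightarrow>
     kaehler M J \<and> generalized_complex_space_form M J (\<lambda>_. c / 4) (\<lambda>_. c / 4)"

definition real_kaehler_space_form ::
  "('a, 'e::euclidean_space) riemannian \<Rightarrow> ('a \<Rightarrow> 'e \<Rightarrow> 'e) \<Rightarrow> real \<Rightarrow> real \<Rightarrow> bool" where
  "real_kaehler_space_form M J c \<alpha> \<longleftrightarrow>
     generalized_complex_space_form M J (\<lambda>_. (c + 3 * \<alpha>) / 4) (\<lambda>_. (c - \<alpha>) / 4)"

section \<open>Riemannian submersions\<close>

definition vertical ::
  "('a, 'e::euclidean_space) riemannian \<Rightarrow> ('b, 'f::euclidean_space) riemannian \<Rightarrow> ('a \<Rightarrow> 'b)
    \<Rightarrow> 'a \<Rightarrow> 'e set" where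
  "vertical M N F p = {u. tangent_map M N F p u = 0}"

definition horizontal ::
  "('a, 'e::euclidean_space) riemannian \<Rightarrow> ('b, 'f::euclidean_space) riemannian \<Rightarrow> ('a \<Rightarrow> 'b)
    \<Rightarrow> 'a \<Rightarrow> 'e set" where
  "horizontal M N F p = {u. \<forall>v \<in> vertical M N F p. metric M p u v = 0}"

definition riemannian_submersion ::
  "('a, 'e::euclidean_space) riemannian \<Rightarrow> ('b, 'f::euclidean_space) riemannian \<Rightarrow> ('a \<Rightarrow> 'b)
    \<Rightarrow> bool" where
  "riemannian_submersion M N F \<longleftrightarrow>
     riemannian_manifold M \<and> riemannian_manifold N \<and> smooth_map M N F \<and>
     (\<forall>p \<in> points M. surj (tangent_map M N F p) \<and>
        (\<forall>u \<in> horizontal M N F p. \<forall>v \<in> horizontal M N F p.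
           metric N (F p) (tangent_map M N F p u) (tangent_map M N F p v) = metric M p u v))"

definition vproj ::
  "('a, 'e::euclidean_space) riemannian \<Rightarrow> ('b, 'f::euclidean_space) riemannian \<Rightarrow> ('a \<Rightarrow> 'b)
    \<Rightarrow> 'a \<Rightarrow> 'e \<Rightarrow> 'e" where
  "vproj M N F p = orth_proj (metric M p) (vertical M N F p)"

definition hproj ::
  "('a, 'e::euclidean_space) riemannian \<Rightarrow> ('b, 'f::euclidean_space) riemannian \<Rightarrow> ('a \<Rightarrow> 'b)
    \<Rightarrow> 'a \<Rightarrow> 'e \<Rightarrow> 'e" where
  "hproj M N F p = orth_proj (metric M p) (horizontal M N F p)"

text \<open>
  O'Neill's \<open>T\<^sub>E G = \<H> \<nabla>\<^sub>\<V>\<^sub>E (\<V> G) + \<V> \<nabla>\<^sub>\<V>\<^sub>E (\<H> G)\<close>. It is a tensor, so \<open>E\<close> and \<open>G\<close> may be extended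
  to the fields that are constant in the chart at \<open>p\<close>; \<open>\<V> G\<close> and \<open>\<H> G\<close> are then the fields
  whose local representatives are \<open>\<lambda>y. V y w\<close> and \<open>\<lambda>y. H y w\<close>.
\<close>

definition oneill_T ::
  "('a, 'e::euclidean_space) riemannian \<Rightarrow> ('b, 'f::euclidean_space) riemannian \<Rightarrow> ('a \<Rightarrow> 'b)
    \<Rightarrow> 'a \<Rightarrow> 'e \<Rightarrow> 'e \<Rightarrow> 'e" where
  "oneill_T M N F p e w =
     (let c = chart_at M p; g = metric_rep M c; x = coord_at M p;
          V = endo_rep M (vproj M N F) c; H = endo_rep M (hproj M N F) c
      in H x (nabla g (\<lambda>y. V y e) (\<lambda>y. V y w) x) + V x (nabla g (\<lambda>y. V y e) (\<lambda>y. H y w) x))"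

definition pointwise_slant ::
  "('a, 'e::euclidean_space) riemannian \<Rightarrow> ('a \<Rightarrow> 'e \<Rightarrow> 'e) \<Rightarrow> ('b, 'f::euclidean_space) riemannian
    \<Rightarrow> ('a \<Rightarrow> 'b) \<Rightarrow> ('a \<Rightarrow> real) \<Rightarrow> bool" where
  "pointwise_slant M J N F \<theta> \<longleftrightarrow>
     (\<forall>p \<in> points M. 0 \<le> \<theta> p \<and> \<theta> p \<le> pi / 2 \<and>
        (\<forall>u \<in> vertical M N F p. u \<noteq> 0 \<longrightarrow>
           angle_to_subspace (metric M p) (J p u) (vertical M N F p) = \<theta> p))"

section \<open>Casorati curvatures\<close>

text \<open>
  \<open>W\<close> is a subspace of the vertical space. The sum does not depend on the orthonormal bases.
  The Casorati curvature of the vertical space is \<open>casorati M N F p (vertical M N F p)\<close>.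
\<close>

definition casorati ::
  "('a, 'e::euclidean_space) riemannian \<Rightarrow> ('b, 'f::euclidean_space) riemannian \<Rightarrow> ('a \<Rightarrow> 'b)
    \<Rightarrow> 'a \<Rightarrow> 'e set \<Rightarrow> real" where
  "casorati M N F p W =
     (let g = metric M p; B = some_onb g W; A = some_onb g (horizontal M N F p)
      in (\<Sum>a\<in>A. \<Sum>u\<in>B. \<Sum>v\<in>B. (g (oneill_T M N F p u v) a)\<^sup>2) / real (dim W))"

definition vertical_hyperplanes ::
  "('a, 'e::euclidean_space) riemannian \<Rightarrow> ('b, 'f::euclidean_space) riemannian \<Rightarrow> ('a \<Rightarrow> 'b)
    \<Rightarrow> 'a \<Rightarrow> 'e set set" where
  "vertical_hyperplanes M N F p =
     {L. subspace L \<and> L \<subseteq> vertical M N F p \<and> dim L + 1 = dim (vertical M N F p)}"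

definition delta_C ::
  "('a, 'e::euclidean_space) riemannian \<Rightarrow> ('b, 'f::euclidean_space) riemannian \<Rightarrow> ('a \<Rightarrow> 'b)
    \<Rightarrow> 'a \<Rightarrow> real" where
  "delta_C M N F p =
     (let r = real (dim (vertical M N F p))
      in 1 / 2 * casorati M N F p (vertical M N F p) +
         (r + 1) / (2 * r) * (INF L \<in> vertical_hyperplanes M N F p. casorati M N F p L))"

definition delta_hat_C ::
  "('a, 'e::euclidean_space) riemannian \<Rightarrow> ('b, 'f::euclidean_space) riemannian \<Rightarrow> ('a \<Rightarrow> 'b)
    \<Rightarrow> 'a \<Rightarrow> real" where
  "delta_hat_C M N F p =
     (let r = real (dim (vertical M N F p))
      in 2 * casorati M N F p (vertical M N F p) -
         (2 * r - 1) / (2 * r) * (SUP L \<in> vertical_hyperplanes M N F p. casorati M N F p L))"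

section \<open>The fibers as Riemannian manifolds\<close>

text \<open>
  The fiber over \<open>q\<close> carries the subspace topology and the maximal atlas of its structure of
  embedded submanifold: all charts, with values in a space \<open>'k\<close> of the dimension of the fiber,
  whose inverses are smooth immersions into \<open>M\<close>. Its metric is the pullback of the metric of \<open>M\<close>
  under the inclusion. The type \<open>'k\<close> is not determined by the arguments.
\<close>

definition submanifold ::
  "('a, 'e::euclidean_space, 'z) manifold_scheme \<Rightarrow> 'a set
    \<Rightarrow> ('a, 'k::euclidean_space) manifold" where
  "submanifold M S =
     \<lparr> mtop = subtopology (mtop M) S,
       atlas = {c. is_chart (subtopology (mtop M) S) c \<and>
         (\<forall>d \<in> atlas M. smooth_on (snd d \<circ> param c) (snd c ` (fst c \<inter> fst d))) \<and>
         (\<forall>p \<in> fst c. inj (frechet_derivative (snd (chart_at M p) \<circ> param c) (at (snd c p))))} \<rparr>"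

definition fiber ::
  "('a, 'e::euclidean_space) riemannian \<Rightarrow> ('a \<Rightarrow> 'b) \<Rightarrow> 'b
    \<Rightarrow> ('a, 'k::euclidean_space) riemannian" where
  "fiber M F q =
     (let K = submanifold M {p \<in> points M. F p = q} :: ('a, 'k) manifold
      in \<lparr> mtop = mtop K, atlas = atlas K,
           metric = (\<lambda>p u v. metric M p (tangent_map K M id p u) (tangent_map K M id p v)) \<rparr>)"

end

theory Submission
  imports Defs
begin

text \<open>
  Fix a point \<open>p\<close>, write \<open>r\<close> for the dimension of the vertical space \<open>\<V>\<close> and let \<open>II\<close> be the second
  fundamental form of the fiber through \<open>p\<close>. For vertical \<open>u\<close>, \<open>v\<close> it agrees with O'Neill's tensor: both
  \<open>II(u, v)\<close> and \<open>T\<^sub>u v\<close> are the horizontal part of the derivative of a vertical field. For a horizontal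
  vector \<open>a\<close> put \<open>h\<^sub>a(u, v) = g(II(u, v), a)\<close>. The Gauss equation, traced over the fiber, reads

  \<open>r (r - 1) \<rho> = (\<Sum> g(R(u, v) v, u)) + Q - N\<close>, with \<open>Q = \<Sum>\<^sub>a (trace h\<^sub>a)\<^sup>2\<close> and \<open>N = \<Sum>\<^sub>a |h\<^sub>a|\<^sup>2\<close>,

  where \<open>u\<close>, \<open>v\<close> run over an orthonormal basis of \<open>\<V>\<close> and \<open>a\<close> over one of the horizontal space.

  In a generalized complex space form the first sum is \<open>c\<^sub>1 r (r - 1) + 3 c\<^sub>2 \<Sum> g(u, J v)\<^sup>2\<close>, and the slant
  condition says exactly that each vertical unit vector \<open>v\<close> contributes \<open>\<Sum>\<^sub>u g(u, J v)\<^sup>2 = cos\<^sup>2 \<theta>\<close>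
  (\<open>ambient_scalar_curvature\<close>). So the claim reduces to \<open>(Q - N) / (r (r - 1)) \<le> \<delta>\<close> for both Casorati
  curvatures \<open>\<delta>\<close>, and then to one inequality for every single form \<open>h\<^sub>a\<close> and every hyperplane of \<open>\<V>\<close>. In a
  basis adapted to the hyperplane this is the Cauchy-Schwarz inequality for the diagonal entries, in which
  the entry normal to the hyperplane has a different weight from the others; the two possible weights give
  the two inequalities (\<open>trace_squared_le_hyperplane\<close>, \<open>le_delta_casorati\<close>).

  Most of the work is to obtain the Gauss equation for fibers that are given abstractly, with the atlas of all
  compatible charts. It needs a chart around every point of a fiber, which comes from the inverse function
  theorem (\<open>level_set_straightening\<close>, \<open>fiber_chart_exists\<close>). In such a chart the inclusion of the fiber is an
  isometric immersion between open sets of Euclidean spaces (\<open>isometric_incl\<close>), for which the Gauss equation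
  is a computation with Christoffel maps (\<open>gauss_equation\<close>). The identification of \<open>II\<close> with \<open>T\<close>
  (\<open>fiber_form_hessian\<close>, \<open>oneill_T_fiber_form\<close>) needs the vertical projection to be differentiable
  (\<open>differentiable_kernel_projection\<close>).
\<close>

section \<open>Smooth maps between Euclidean spaces\<close>

abbreviation fder ::
  "('e::euclidean_space \<Rightarrow> 'b::real_normed_vector) \<Rightarrow> 'e \<Rightarrow> 'e \<Rightarrow> 'b" where
  "fder f x \<equiv> frechet_derivative f (at x)"

lemma fder_eq: "(f has_derivative f') (at x) \<Longrightarrow> fder f x = f'"
  using frechet_derivative_at by metis

lemma linear_fder: "f differentiable (at x) \<Longrightarrow> linear (fder f x)"
  by (simp add: linear_frechet_derivative)

lemma fder_cong_open:
  assumes "open S" "x \<in> S" "\<And>y. y \<in> S \<Longrightarrow> f y = g y"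
  shows "fder f x = fder g x"
proof -
  have "(f has_derivative D) (at x) \<longleftrightarrow> (g has_derivative D) (at x)" for D
    using assms by (metis has_derivative_transform_within_open)
  then show ?thesis unfolding frechet_derivative_def by simp
qed

lemma Ck_on_Suc_iff:
  assumes "open S"
  shows "Ck_on (Suc k) f S \<longleftrightarrow>
    (\<forall>x\<in>S. (f has_derivative fder f x) (at x)) \<and> (\<forall>v. Ck_on k (\<lambda>x. fder f x v) S)"
  using assms
  by (auto simp: differentiable_on_eq_differentiable_at frechet_derivative_works[symmetric])

lemma Ck_on_Suc_has_derivative:
  "Ck_on (Suc k) f S \<Longrightarrow> open S \<Longrightarrow> x \<in> S \<Longrightarrow> (f has_derivative fder f x) (at x)"
  using Ck_on_Suc_iff by blast

lemma Ck_on_Suc_fder: "Ck_on (Suc k) f S \<Longrightarrow> Ck_on k (\<lambda>x. fder f x v) S"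
  by simp

lemma Ck_on_subset: "Ck_on k f S \<Longrightarrow> T \<subseteq> S \<Longrightarrow> Ck_on k f T"
proof (induction k arbitrary: f)
  case 0 then show ?case using continuous_on_subset by auto
next
  case (Suc k) then show ?case using differentiable_on_subset by auto
qed

lemma Ck_on_cong:
  assumes "open S" "\<And>x. x \<in> S \<Longrightarrow> f x = g x" "Ck_on k f S"
  shows "Ck_on k g S"
  using assms(2,3)
proof (induction k arbitrary: f g)
  case 0 then show ?case using continuous_on_cong by (metis Ck_on.simps(1))
next
  case (Suc k)
  have 1: "fder f x = fder g x" if "x \<in> S" for x
    using fder_cong_open[OF assms(1) that] Suc.prems(1) by blast
  have "(g has_derivative fder g x) (at x)" if x: "x \<in> S" for x
  proof -
    have "(f has_derivative fder f x) (at x)"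
      using Suc.prems(2) x Ck_on_Suc_iff[OF assms(1)] by blast
    then show ?thesis
      using has_derivative_transform_within_open[OF _ assms(1) x] Suc.prems(1) 1[OF x] by metis
  qed
  moreover have "Ck_on k (\<lambda>x. fder g x v) S" for v
    by (rule Suc.IH[of "\<lambda>x. fder f x v"]) (use 1 Suc.prems in auto)
  ultimately show ?case using Ck_on_Suc_iff[OF assms(1)] by blast
qed

lemma Ck_on_SucI:
  assumes "open S" "\<And>x. x \<in> S \<Longrightarrow> (f has_derivative f' x) (at x)"
    and "\<And>v. Ck_on k (\<lambda>x. f' x v) S"
  shows "Ck_on (Suc k) f S"
proof -
  have "fder f x = f' x" if "x \<in> S" for x
    using fder_eq assms(2) that by blast
  then show ?thesis unfolding Ck_on_Suc_iff[OF assms(1)]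
    using assms Ck_on_cong[OF assms(1), of "\<lambda>x. f' x _" "\<lambda>x. fder f x _"] by auto
qed

lemma Ck_on_Suc_lower: "Ck_on (Suc k) f S \<Longrightarrow> open S \<Longrightarrow> Ck_on k f S"
proof (induction k arbitrary: f)
  case 0 then show ?case by (auto intro: differentiable_imp_continuous_on)
next
  case (Suc k) then show ?case by (metis Ck_on.simps(2))
qed

lemma Ck_on_const: "open S \<Longrightarrow> Ck_on k (\<lambda>_. c) S"
proof (induction k arbitrary: c)
  case (Suc k) then show ?case by (intro Ck_on_SucI[where f'="\<lambda>_ _. 0"]) auto
qed simp

lemma Ck_on_bounded_linear:
  assumes "open S" "bounded_linear L"
  shows "Ck_on k f S \<Longrightarrow> Ck_on k (\<lambda>x. L (f x)) S"
proof (induction k arbitrary: f)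
  case 0
  then show ?case using bounded_linear.continuous_on[OF assms(2)] by auto
next
  case (Suc k)
  show ?case
  proof (rule Ck_on_SucI[OF assms(1)])
    show "((\<lambda>x. L (f x)) has_derivative (\<lambda>v. L (fder f x v))) (at x)" if "x \<in> S" for x
      using bounded_linear.has_derivative[OF assms(2)
          Ck_on_Suc_has_derivative[OF Suc.prems assms(1) that]] .
    show "Ck_on k (\<lambda>x. L (fder f x v)) S" for v
      by (rule Suc.IH[OF Ck_on_Suc_fder[OF Suc.prems]])
  qed
qed

lemma Ck_on_add:
  assumes "open S"
  shows "Ck_on k f S \<Longrightarrow> Ck_on k g S \<Longrightarrow> Ck_on k (\<lambda>x. f x + g x) S"
proof (induction k arbitrary: f g)
  case 0
  then show ?case by (auto intro: continuous_intros)
next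
  case (Suc k)
  show ?case
  proof (rule Ck_on_SucI[OF assms(1)])
    show "((\<lambda>x. f x + g x) has_derivative (\<lambda>v. fder f x v + fder g x v)) (at x)" if "x \<in> S" for x
      using has_derivative_add[OF Ck_on_Suc_has_derivative[OF Suc.prems(1) assms(1) that]
          Ck_on_Suc_has_derivative[OF Suc.prems(2) assms(1) that]] .
    show "Ck_on k (\<lambda>x. fder f x v + fder g x v) S" for v
      by (intro Suc.IH Ck_on_Suc_fder Suc.prems)
  qed
qed

lemma Ck_on_sum:
  assumes "open S"
  shows "(\<And>i. i \<in> I \<Longrightarrow> Ck_on k (f i) S) \<Longrightarrow> Ck_on k (\<lambda>x. \<Sum>i\<in>I. f i x) S"
  by (induction I rule: infinite_finite_induct) (auto intro: Ck_on_const Ck_on_add assms)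

lemma Ck_on_bounded_bilinear:
  assumes "open S" "bounded_bilinear pr"
  shows "Ck_on k f S \<Longrightarrow> Ck_on k g S \<Longrightarrow> Ck_on k (\<lambda>x. pr (f x) (g x)) S"
proof (induction k arbitrary: f g)
  case 0
  then show ?case using bounded_bilinear.continuous_on[OF assms(2)] by auto
next
  case (Suc k)
  have lower: "Ck_on k f S" "Ck_on k g S" using Suc.prems assms(1) Ck_on_Suc_lower by blast+
  have d: "\<And>x. x \<in> S \<Longrightarrow> (f has_derivative fder f x) (at x)" "\<And>v. Ck_on k (\<lambda>x. fder f x v) S"
    "\<And>x. x \<in> S \<Longrightarrow> (g has_derivative fder g x) (at x)" "\<And>v. Ck_on k (\<lambda>x. fder g x v) S"
    using Suc.prems unfolding Ck_on_Suc_iff[OF assms(1)] by blast+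
  show ?case
  proof (rule Ck_on_SucI[OF assms(1),
        where f'="\<lambda>x v. pr (f x) (fder g x v) + pr (fder f x v) (g x)"])
    show "((\<lambda>x. pr (f x) (g x)) has_derivative
        (\<lambda>v. pr (f x) (fder g x v) + pr (fder f x v) (g x))) (at x)" if "x \<in> S" for x
      using bounded_bilinear.FDERIV[OF assms(2) d(1)[OF that] d(3)[OF that]] .
    show "Ck_on k (\<lambda>x. pr (f x) (fder g x v) + pr (fder f x v) (g x)) S" for v
      by (intro Ck_on_add assms(1) Suc.IH lower d)
  qed
qed

lemma Ck_on_scaleR:
  "open S \<Longrightarrow> Ck_on k f S \<Longrightarrow> Ck_on k g S \<Longrightarrow> Ck_on k (\<lambda>x. f x *\<^sub>R g x) S"
  by (rule Ck_on_bounded_bilinear[OF _ bounded_bilinear_scaleR])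

lemma Ck_on_inner_const:
  fixes f :: "'e::euclidean_space \<Rightarrow> 'b::euclidean_space"
  shows "open S \<Longrightarrow> Ck_on k f S \<Longrightarrow> Ck_on k (\<lambda>x. f x \<bullet> i) S"
  by (rule Ck_on_bounded_linear[OF _ bounded_linear_inner_left])

text \<open>
  Read from right to left, this expresses values of linear maps by finitely many of them. In this way all
  regularity statements about families of linear maps reduce to statements about sums of products.
\<close>

lemma linear_sum_Basis:
  fixes L :: "'a::euclidean_space \<Rightarrow> 'b::real_vector"
  assumes "linear L"
  shows "L x = (\<Sum>i\<in>Basis. (x \<bullet> i) *\<^sub>R L i)"
proof -
  have "L x = L (\<Sum>i\<in>Basis. (x \<bullet> i) *\<^sub>R i)" by (simp add: euclidean_representation)
  also have "\<dots> = (\<Sum>i\<in>Basis. (x \<bullet> i) *\<^sub>R L i)"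
    using assms by (simp add: linear_sum linear_cmul)
  finally show ?thesis .
qed

lemma Ck_on_compose:
  fixes f :: "'e::euclidean_space \<Rightarrow> 'f::euclidean_space" and g :: "'f \<Rightarrow> 'b::real_normed_vector"
  assumes "open S" "open T" "f ` S \<subseteq> T"
  shows "Ck_on k g T \<Longrightarrow> Ck_on k f S \<Longrightarrow> Ck_on k (\<lambda>x. g (f x)) S"
proof (induction k arbitrary: g)
  case 0
  then show ?case using assms(3) by (auto intro: continuous_on_compose2)
next
  case (Suc k)
  have lower: "Ck_on k f S" using Suc.prems assms(1) Ck_on_Suc_lower by blast
  have d: "\<And>x. x \<in> S \<Longrightarrow> (f has_derivative fder f x) (at x)" "\<And>v. Ck_on k (\<lambda>x. fder f x v) S"
    "\<And>y. y \<in> T \<Longrightarrow> (g has_derivative fder g y) (at y)" "\<And>v. Ck_on k (\<lambda>x. fder g x v) T"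
    using Suc.prems unfolding Ck_on_Suc_iff[OF assms(1)] Ck_on_Suc_iff[OF assms(2)] by blast+
  have dg: "(g has_derivative fder g (f x)) (at (f x))" if "x \<in> S" for x
    using d(3) assms(3) that by blast
  show ?case
  proof (rule Ck_on_SucI[OF assms(1),
        where f'="\<lambda>x v. \<Sum>i\<in>Basis. (fder f x v \<bullet> i) *\<^sub>R fder g (f x) i"])
    fix x assume x: "x \<in> S"
    have "((\<lambda>x. g (f x)) has_derivative (\<lambda>v. fder g (f x) (fder f x v))) (at x)"
      using diff_chain_at[OF d(1)[OF x] dg[OF x]] by (simp add: o_def)
    moreover have lin: "linear (fder g (f x))" using dg[OF x] has_derivative_linear by blast
    ultimately show "((\<lambda>x. g (f x)) has_derivative
        (\<lambda>v. \<Sum>i\<in>Basis. (fder f x v \<bullet> i) *\<^sub>R fder g (f x) i)) (at x)"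
      unfolding linear_sum_Basis[OF lin, symmetric] by simp
  next
    fix v
    show "Ck_on k (\<lambda>x. \<Sum>i\<in>Basis. (fder f x v \<bullet> i) *\<^sub>R fder g (f x) i) S"
      by (intro Ck_on_sum Ck_on_scaleR Ck_on_inner_const Suc.IH assms(1) d lower)
  qed
qed

lemma smooth_on_subset: "smooth_on f S \<Longrightarrow> T \<subseteq> S \<Longrightarrow> smooth_on f T"
  unfolding smooth_on_def using Ck_on_subset by blast

lemma smooth_on_cong:
  "open S \<Longrightarrow> (\<And>x. x \<in> S \<Longrightarrow> f x = g x) \<Longrightarrow> smooth_on f S \<Longrightarrow> smooth_on g S"
  unfolding smooth_on_def using Ck_on_cong by metis

lemma smooth_on_has_derivative:
  "smooth_on f S \<Longrightarrow> open S \<Longrightarrow> x \<in> S \<Longrightarrow> (f has_derivative fder f x) (at x)"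
  unfolding smooth_on_def using Ck_on_Suc_iff by blast

lemma smooth_on_differentiable:
  "smooth_on f S \<Longrightarrow> open S \<Longrightarrow> x \<in> S \<Longrightarrow> f differentiable (at x)"
  using smooth_on_has_derivative differentiableI by blast

lemma smooth_on_linear_fder:
  "smooth_on f S \<Longrightarrow> open S \<Longrightarrow> x \<in> S \<Longrightarrow> linear (fder f x)"
  using linear_fder smooth_on_differentiable by blast

lemma smooth_on_imp_continuous_on: "smooth_on f S \<Longrightarrow> continuous_on S f"
  unfolding smooth_on_def using Ck_on.simps(1) by blast

lemma smooth_on_fder: "smooth_on f S \<Longrightarrow> smooth_on (\<lambda>x. fder f x v) S"
  unfolding smooth_on_def using Ck_on.simps(2) by blast

lemma smooth_on_add:
  "open S \<Longrightarrow> smooth_on f S \<Longrightarrow> smooth_on g S \<Longrightarrow> smooth_on (\<lambda>x. f x + g x) S"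
  unfolding smooth_on_def using Ck_on_add by blast

lemma smooth_on_bounded_linear:
  "open S \<Longrightarrow> bounded_linear L \<Longrightarrow> smooth_on f S \<Longrightarrow> smooth_on (\<lambda>x. L (f x)) S"
  unfolding smooth_on_def using Ck_on_bounded_linear by blast

lemma smooth_on_sum:
  "open S \<Longrightarrow> (\<And>i. i \<in> I \<Longrightarrow> smooth_on (f i) S) \<Longrightarrow> smooth_on (\<lambda>x. \<Sum>i\<in>I. f i x) S"
  unfolding smooth_on_def using Ck_on_sum[of S I] by blast

lemma smooth_on_scaleR:
  "open S \<Longrightarrow> smooth_on f S \<Longrightarrow> smooth_on g S \<Longrightarrow> smooth_on (\<lambda>x. f x *\<^sub>R g x) S"
  unfolding smooth_on_def using Ck_on_scaleR by blast

lemma smooth_on_compose: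
  fixes f :: "'e::euclidean_space \<Rightarrow> 'f::euclidean_space" and g :: "'f \<Rightarrow> 'b::real_normed_vector"
  shows "open S \<Longrightarrow> open T \<Longrightarrow> f ` S \<subseteq> T \<Longrightarrow> smooth_on g T \<Longrightarrow> smooth_on f S \<Longrightarrow>
    smooth_on (\<lambda>x. g (f x)) S"
  unfolding smooth_on_def using Ck_on_compose by blast

section \<open>Linear systems that depend on a parameter\<close>

text \<open>
  At a zero of \<open>g\<close> the product rule needs only continuity of the other factor. This breaks the circle in
  \<open>differentiable_linear_solution\<close>, where the unknown occurs on both sides of the equation.
\<close>

lemma has_derivative_vanishing_scaleR:
  fixes g :: "'a::real_normed_vector \<Rightarrow> 'b::real_normed_vector"
  assumes c: "continuous (at x) c" and g: "(g has_derivative g') (at x)" and "g x = 0"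
  shows "((\<lambda>y. c y *\<^sub>R g y) has_derivative (\<lambda>h. c x *\<^sub>R g' h)) (at x)"
proof -
  interpret g': bounded_linear g' using g has_derivative_bounded_linear by blast
  obtain K where K: "\<And>h. norm (g' h) \<le> norm h * K" using g'.bounded by blast
  let ?q = "\<lambda>y. norm (g y - g x - g' (y - x)) / norm (y - x)"
  have q: "(?q \<longlongrightarrow> 0) (at x)" using g by (simp add: has_derivative_iff_norm)
  have "((\<lambda>y. (c y - c x) *\<^sub>R g y) has_derivative (\<lambda>_. 0)) (at x)"
  proof (simp add: has_derivative_iff_norm \<open>g x = 0\<close>, rule Lim_null_comparison)
    show "((\<lambda>y. \<bar>c y - c x\<bar> * (?q y + K)) \<longlongrightarrow> 0) (at x)"
    proof -
      have "((\<lambda>y. c y - c x) \<longlongrightarrow> 0) (at x)" using c by (simp add: continuous_at LIM_zero)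
      then have "((\<lambda>y. \<bar>c y - c x\<bar>) \<longlongrightarrow> 0) (at x)" by (rule tendsto_rabs_zero)
      then have "((\<lambda>y. \<bar>c y - c x\<bar> * (?q y + K)) \<longlongrightarrow> 0 * (0 + K)) (at x)"
        using q by (intro tendsto_intros)
      then show ?thesis by simp
    qed
    have "norm (\<bar>c y - c x\<bar> * norm (g y) / norm (y - x)) \<le> \<bar>c y - c x\<bar> * (?q y + K)"
      if "y \<noteq> x" for y
    proof -
      have "norm (g y) \<le> norm (g y - g' (y - x)) + norm (g' (y - x))"
        by (metis add.commute diff_add_cancel norm_triangle_ineq)
      also have "\<dots> \<le> norm (g y - g' (y - x)) + norm (y - x) * K" using K by simp
      finally have "norm (g y) / norm (y - x) \<le> ?q y + K"
        using that \<open>g x = 0\<close> by (simp add: field_simps)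
      then have "\<bar>c y - c x\<bar> * (norm (g y) / norm (y - x)) \<le> \<bar>c y - c x\<bar> * (?q y + K)"
        by (rule mult_left_mono) simp
      then show ?thesis by simp
    qed
    then show "\<forall>\<^sub>F y in at x. norm (\<bar>c y - c x\<bar> * norm (g y) / norm (y - x))
        \<le> \<bar>c y - c x\<bar> * (?q y + K)"
      by (simp add: eventually_at_filter)
  qed
  then have "((\<lambda>y. (c y - c x) *\<^sub>R g y + c x *\<^sub>R g y) has_derivative (\<lambda>h. 0 + c x *\<^sub>R g' h)) (at x)"
    by (rule has_derivative_add) (rule has_derivative_scaleR_right[OF g])
  then show ?thesis by (simp add: algebra_simps)
qed

text \<open>
  The injective map \<open>A x\<close> is bounded below, \<open>norm z \<le> K * norm (A x z)\<close>, and \<open>A y\<close> is close to \<open>A x\<close> in operator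
  norm for \<open>y\<close> near \<open>x\<close>. So the increment of the solution is controlled by those of \<open>b\<close> and of \<open>A\<close>.
\<close>

lemma continuous_at_linear_solution:
  fixes A :: "'e::euclidean_space \<Rightarrow> 'a::euclidean_space \<Rightarrow> 'b::euclidean_space"
  assumes S: "open S" "x \<in> S"
    and lin: "\<And>y. y \<in> S \<Longrightarrow> linear (A y)" and inj: "inj (A x)"
    and A: "\<And>v. continuous (at x) (\<lambda>y. A y v)" and b: "continuous (at x) b"
    and sol: "\<And>y. y \<in> S \<Longrightarrow> A y (s y) = b y"
  shows "continuous (at x) s"
proof -
  obtain L where L: "linear L" "L \<circ> A x = id"
    using linear_injective_left_inverse lin S(2) inj by blast
  have Lx: "L (A x z) = z" for z using L(2) by (metis comp_apply id_apply)
  obtain K where K: "K > 0" "\<And>z. norm (L z) \<le> K * norm z" using linear_bounded_pos[OF L(1)] by blast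
  define \<epsilon> where "\<epsilon> y = (\<Sum>i\<in>Basis. norm (A y i - A x i))" for y
  have \<epsilon>0: "(\<epsilon> \<longlongrightarrow> 0) (at x)" unfolding \<epsilon>_def
    by (rule tendsto_null_sum) (use A in \<open>simp add: continuous_at LIM_zero tendsto_norm_zero\<close>)
  have \<epsilon>: "norm (A y z - A x z) \<le> \<epsilon> y * norm z" if "y \<in> S" for y z
  proof -
    have "linear (\<lambda>z. A y z - A x z)" using lin that S(2) linear_compose_sub by blast
    from linear_sum_Basis[OF this, of z]
    have "norm (A y z - A x z) = norm (\<Sum>i\<in>Basis. (z \<bullet> i) *\<^sub>R (A y i - A x i))" by simp
    also have "\<dots> \<le> (\<Sum>i\<in>Basis. norm ((z \<bullet> i) *\<^sub>R (A y i - A x i)))" by (rule norm_sum)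
    also have "\<dots> \<le> (\<Sum>i\<in>Basis. norm z * norm (A y i - A x i))"
      by (intro sum_mono) (simp add: Basis_le_norm mult_right_mono)
    finally show ?thesis by (simp add: \<epsilon>_def sum_distrib_left mult.commute)
  qed
  \<comment> \<open>Where \<open>K * \<epsilon> y \<le> 1/2\<close>, the term with the unknown increment of \<open>s\<close> on the right-hand side is at most half
    of the left-hand side and can be absorbed.\<close>
  let ?r = "\<lambda>y. 2 * K * (norm (b y - b x) + norm (A y (s x) - A x (s x)))"
  have "\<forall>\<^sub>F y in at x. \<epsilon> y < 1 / (2 * K)"
    using order_tendstoD(2)[OF \<epsilon>0] K(1) by simp
  moreover have "\<forall>\<^sub>F y in at x. y \<in> S" using S eventually_at_in_open' by blast
  ultimately have bound: "\<forall>\<^sub>F y in at x. norm (s y - s x) \<le> ?r y"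
  proof eventually_elim
    case (elim y)
    have "A x (s y - s x) = b y - b x - (A y (s y - s x) - A x (s y - s x)) - (A y (s x) - A x (s x))"
      using sol[OF elim(2)] sol[OF S(2)] lin[OF elim(2)] lin[OF S(2)] by (simp add: linear_diff)
    then have "norm (A x (s y - s x)) \<le>
        norm (b y - b x) + norm (A y (s y - s x) - A x (s y - s x)) + norm (A y (s x) - A x (s x))"
      by (metis norm_triangle_ineq4 order_trans add_right_mono)
    also have "\<dots> \<le> norm (b y - b x) + \<epsilon> y * norm (s y - s x) + norm (A y (s x) - A x (s x))"
      using \<epsilon>[OF elim(2)] by simp
    also have "\<dots> \<le> norm (b y - b x) + norm (s y - s x) / (2 * K) + norm (A y (s x) - A x (s x))"
      using elim(1) mult_right_mono[of "\<epsilon> y" "1 / (2 * K)" "norm (s y - s x)"] by simp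
    finally have "K * norm (A x (s y - s x)) \<le> K * (norm (b y - b x) + norm (s y - s x) / (2 * K)
        + norm (A y (s x) - A x (s x)))" using K(1) by (rule mult_left_mono[OF _ less_imp_le])
    moreover have "norm (s y - s x) \<le> K * norm (A x (s y - s x))" using K(2) Lx by metis
    moreover have "K * (norm (b y - b x) + norm (s y - s x) / (2 * K) + norm (A y (s x) - A x (s x)))
        = K * (norm (b y - b x) + norm (A y (s x) - A x (s x))) + norm (s y - s x) / 2"
      using K(1) by (simp add: field_simps)
    ultimately show ?case by simp
  qed
  have "(?r \<longlongrightarrow> 2 * K * (norm (b x - b x) + norm (A x (s x) - A x (s x)))) (at x)"
    using A b by (intro tendsto_intros) (auto simp: continuous_at)
  then have "(?r \<longlongrightarrow> 0) (at x)" by simp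
  with bound have "((\<lambda>y. s y - s x) \<longlongrightarrow> 0) (at x)" by (rule Lim_null_comparison)
  then show ?thesis using LIM_zero_iff continuous_at by blast
qed

text \<open>
  With a left inverse \<open>L\<close> of \<open>A x\<close>, the equation \<open>A y (s y) = b y\<close> becomes \<open>s y = L (b y) - L ((A y - A x) (s y))\<close>.
  The last term is a sum of products of the continuous coordinates of \<open>s y\<close> with functions that vanish at \<open>x\<close>.
\<close>

lemma differentiable_linear_solution:
  fixes A :: "'e::euclidean_space \<Rightarrow> 'a::euclidean_space \<Rightarrow> 'b::euclidean_space"
  assumes S: "open S" "x \<in> S"
    and lin: "\<And>y. y \<in> S \<Longrightarrow> linear (A y)" and inj: "inj (A x)"
    and A: "\<And>v. (\<lambda>y. A y v) differentiable (at x)" and b: "b differentiable (at x)"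
    and sol: "\<And>y. y \<in> S \<Longrightarrow> A y (s y) = b y"
  shows "s differentiable (at x)"
proof -
  have cont: "continuous (at x) s"
    by (rule continuous_at_linear_solution[where A=A and b=b and S=S])
      (use S lin inj sol A b in \<open>auto intro: differentiable_imp_continuous_within\<close>)
  obtain L where L: "linear L" "L \<circ> A x = id"
    using linear_injective_left_inverse lin S(2) inj by blast
  have bL: "bounded_linear L" using L(1) linear_conv_bounded_linear by blast
  have Lx: "L (A x z) = z" for z using L(2) by (metis comp_apply id_apply)
  define \<phi> where "\<phi> y = L (b y) - (\<Sum>i\<in>Basis. (s y \<bullet> i) *\<^sub>R L (A y i - A x i))" for y
  have eq: "s y = \<phi> y" if y: "y \<in> S" for y
  proof -
    have "linear (\<lambda>z. L (A y z - A x z))"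
      using linear_compose[OF linear_compose_sub[OF lin[OF y] lin[OF S(2)]] L(1)]
      by (simp add: o_def)
    from linear_sum_Basis[OF this, of "s y"]
    have "\<phi> y = L (b y) - L (A y (s y) - A x (s y))" by (simp add: \<phi>_def)
    also have "\<dots> = s y" using sol[OF y] L(1) Lx by (simp add: linear_diff)
    finally show ?thesis by simp
  qed
  have "(\<lambda>y. (s y \<bullet> i) *\<^sub>R L (A y i - A x i)) differentiable (at x)" for i
  proof -
    obtain A' where "((\<lambda>y. A y i) has_derivative A') (at x)" using A differentiable_def by blast
    then have "((\<lambda>y. L (A y i - A x i)) has_derivative (\<lambda>h. L (A' h - 0))) (at x)"
      by (intro bounded_linear.has_derivative[OF bL] has_derivative_diff has_derivative_const)
    moreover have "continuous (at x) (\<lambda>y. s y \<bullet> i)" using cont by (intro continuous_intros)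
    ultimately have "((\<lambda>y. (s y \<bullet> i) *\<^sub>R L (A y i - A x i)) has_derivative
        (\<lambda>h. (s x \<bullet> i) *\<^sub>R L (A' h - 0))) (at x)"
      by (intro has_derivative_vanishing_scaleR) (use L(1) linear_0 in auto)
    then show ?thesis using differentiableI by blast
  qed
  moreover have "(\<lambda>y. L (b y)) differentiable (at x)"
    using b bounded_linear.has_derivative[OF bL] unfolding differentiable_def by blast
  ultimately have "\<phi> differentiable (at x)"
    unfolding \<phi>_def by (intro differentiable_diff differentiable_sum) auto
  then show ?thesis
    using has_derivative_transform_within_open[OF _ S] eq unfolding differentiable_def by metis
qed

text \<open>
  Differentiating \<open>A y (s y) = b y\<close> shows that each directional derivative of \<open>s\<close> solves a system with the same
  family \<open>A\<close>, and with a right-hand side that is as smooth as \<open>s\<close> and the derivatives of \<open>A\<close> and \<open>b\<close> are. So the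
  order of differentiability rises by one at a time.
\<close>

lemma Ck_on_linear_solution:
  fixes A :: "'e::euclidean_space \<Rightarrow> 'a::euclidean_space \<Rightarrow> 'b::euclidean_space"
  assumes S: "open S"
    and lin: "\<And>y. y \<in> S \<Longrightarrow> linear (A y)" and inj: "\<And>y. y \<in> S \<Longrightarrow> inj (A y)"
  shows "(\<And>v. Ck_on k (\<lambda>y. A y v) S) \<Longrightarrow> Ck_on k b S \<Longrightarrow> (\<And>y. y \<in> S \<Longrightarrow> A y (s y) = b y) \<Longrightarrow>
    Ck_on k s S"
proof (induction k arbitrary: s b)
  case 0
  have "continuous (at x) s" if x: "x \<in> S" for x
  proof (rule continuous_at_linear_solution[where A=A and b=b and S=S])
    show "continuous (at x) (\<lambda>y. A y v)" for v
      using 0(1)[of v] x S by (simp add: continuous_on_eq_continuous_at)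
    show "continuous (at x) b"
      using 0(2) x S by (simp add: continuous_on_eq_continuous_at)
  qed (use S x lin inj 0(3) in auto)
  then show ?case using S by (simp add: continuous_on_eq_continuous_at)
next
  case (Suc k)
  have dA: "\<And>x v. x \<in> S \<Longrightarrow> ((\<lambda>y. A y v) has_derivative fder (\<lambda>y. A y v) x) (at x)"
    "\<And>v u. Ck_on k (\<lambda>x. fder (\<lambda>y. A y v) x u) S"
    "\<And>x. x \<in> S \<Longrightarrow> (b has_derivative fder b x) (at x)" "\<And>u. Ck_on k (\<lambda>x. fder b x u) S"
    using Suc.prems(1,2) unfolding Ck_on_Suc_iff[OF S] by blast+
  have Ak: "\<And>v. Ck_on k (\<lambda>y. A y v) S" and bk: "Ck_on k b S"
    using Suc.prems(1,2) Ck_on_Suc_lower[OF _ S] by blast+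
  have sk: "Ck_on k s S" using Suc.IH Ak bk Suc.prems(3) by blast
  have ds: "(s has_derivative fder s x) (at x)" if x: "x \<in> S" for x
  proof -
    have "s differentiable (at x)"
      by (rule differentiable_linear_solution[where A=A and b=b and S=S])
        (use S x lin inj Suc.prems(3) differentiableI[OF dA(1)[OF x]] differentiableI[OF dA(3)[OF x]]
          in auto)
    then show ?thesis using frechet_derivative_works by blast
  qed
  define c where "c u x = fder b x u + (-1) *\<^sub>R (\<Sum>i\<in>Basis. (s x \<bullet> i) *\<^sub>R fder (\<lambda>y. A y i) x u)" for u x
  have eq: "A x (fder s x u) = c u x" if x: "x \<in> S" for x u
  proof -
    let ?d = "\<lambda>h. \<Sum>i\<in>Basis. (s x \<bullet> i) *\<^sub>R fder (\<lambda>y. A y i) x h + (fder s x h \<bullet> i) *\<^sub>R A x i"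
    have 1: "((\<lambda>y. \<Sum>i\<in>Basis. (s y \<bullet> i) *\<^sub>R A y i) has_derivative ?d) (at x)"
      by (intro has_derivative_sum has_derivative_scaleR has_derivative_inner_left ds dA x)
    have 2: "(\<Sum>i\<in>Basis. (s y \<bullet> i) *\<^sub>R A y i) = b y" if "y \<in> S" for y
      using linear_sum_Basis[OF lin[OF that], of "s y"] Suc.prems(3)[OF that] by metis
    have 3: "(b has_derivative ?d) (at x)"
      using has_derivative_transform_within_open[OF 1 S x 2] .
    have "fder b x u = (\<Sum>i\<in>Basis. (s x \<bullet> i) *\<^sub>R fder (\<lambda>y. A y i) x u + (fder s x u \<bullet> i) *\<^sub>R A x i)"
      by (simp only: fder_eq[OF 3])
    moreover have "A x (fder s x u) = (\<Sum>i\<in>Basis. (fder s x u \<bullet> i) *\<^sub>R A x i)"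
      using linear_sum_Basis[OF lin[OF x]] .
    ultimately show ?thesis by (simp add: c_def sum.distrib)
  qed
  have ck: "Ck_on k (c u) S" for u
    unfolding c_def
    by (intro Ck_on_add Ck_on_bounded_linear[OF S bounded_linear_scaleR_right] Ck_on_sum
        Ck_on_scaleR Ck_on_inner_const S dA sk)
  have "Ck_on k (\<lambda>x. fder s x u) S" for u
    by (rule Suc.IH[OF Ak ck]) (use eq in auto)
  then show ?case using ds Ck_on_Suc_iff[OF S] by blast
qed

lemma smooth_on_linear_solution:
  fixes A :: "'e::euclidean_space \<Rightarrow> 'a::euclidean_space \<Rightarrow> 'b::euclidean_space"
  assumes "open S" "\<And>y. y \<in> S \<Longrightarrow> linear (A y)" "\<And>y. y \<in> S \<Longrightarrow> inj (A y)"
    and "\<And>v. smooth_on (\<lambda>y. A y v) S" "smooth_on b S" "\<And>y. y \<in> S \<Longrightarrow> A y (s y) = b y"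
  shows "smooth_on s S"
  unfolding smooth_on_def
  by (intro allI Ck_on_linear_solution[where A=A and b=b])
    (use assms in \<open>auto simp: smooth_on_def\<close>)

section \<open>Smooth local inverses\<close>

text \<open>
  The derivative of the inverse solves the linear system \<open>fder f (g y) (fder g y v) = v\<close>. If \<open>g\<close> is of class
  \<open>C\<^sup>k\<close>, then so are the coefficients of this system, hence also the derivative of \<open>g\<close>.
\<close>

lemma smooth_on_inverse:
  fixes f g :: "'e::euclidean_space \<Rightarrow> 'e"
  assumes U: "open U" and V: "open V" and f: "smooth_on f U"
    and gV: "g ` V \<subseteq> U" and fg: "\<And>y. y \<in> V \<Longrightarrow> f (g y) = y"
    and dg: "\<And>y. y \<in> V \<Longrightarrow> g differentiable (at y)" and inj: "\<And>x. x \<in> U \<Longrightarrow> inj (fder f x)"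
  shows "smooth_on g V"
  unfolding smooth_on_def
proof
  fix k
  have dgy: "(g has_derivative fder g y) (at y)" if "y \<in> V" for y
    using dg[OF that] frechet_derivative_works by blast
  have eq: "fder f (g y) (fder g y v) = v" if y: "y \<in> V" for y v
  proof -
    have "(f has_derivative fder f (g y)) (at (g y))"
      using smooth_on_has_derivative[OF f U] gV y by blast
    from diff_chain_at[OF dgy[OF y] this]
    have "((\<lambda>y. y) has_derivative (fder f (g y) \<circ> fder g y)) (at y)"
      using has_derivative_transform_within_open[OF _ V y] fg by fastforce
    then show ?thesis using has_derivative_ident has_derivative_unique by (metis comp_apply)
  qed
  show "Ck_on k g V"
  proof (induction k)
    case 0
    then show ?case using dg by (simp add: continuous_at_imp_continuous_on differentiable_imp_continuous_within)
  next
    case (Suc k)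
    have "Ck_on k (\<lambda>y. fder g y v) V" for v
    proof (rule Ck_on_linear_solution[OF V, where A="\<lambda>y. fder f (g y)" and b="\<lambda>_. v"])
      show "linear (fder f (g y))" "inj (fder f (g y))" if "y \<in> V" for y
        using smooth_on_linear_fder[OF f U] inj gV that by auto
      show "Ck_on k (\<lambda>y. fder f (g y) u) V" for u
        using Ck_on_compose[OF V U gV _ Suc] smooth_on_fder[OF f] smooth_on_def by blast
    qed (use eq Ck_on_const V in auto)
    then show ?case using dgy Ck_on_Suc_iff[OF V] by blast
  qed
qed

lemma smooth_local_inverse:
  fixes f :: "'e::euclidean_space \<Rightarrow> 'e"
  assumes S: "open S" "x0 \<in> S" and f: "smooth_on f S" and inj: "inj (fder f x0)"
  obtains U V g where "open U" "U \<subseteq> S" "x0 \<in> U" "open V" "f x0 \<in> V"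
    "homeomorphism U V f g" "smooth_on g V"
    "\<And>x. x \<in> U \<Longrightarrow> inj (fder f x)" "\<And>y. y \<in> V \<Longrightarrow> inj (fder g y)"
proof -
  define f' where "f' x = Blinfun (fder f x)" for x
  have f': "blinfun_apply (f' x) = fder f x" if "x \<in> S" for x
    unfolding f'_def
    using smooth_on_has_derivative[OF f S(1) that]
    by (simp add: bounded_linear_Blinfun_apply has_derivative_bounded_linear)
  have lin: "linear (fder f x0)" using smooth_on_linear_fder[OF f S] .
  obtain L where L: "linear L" "L \<circ> fder f x0 = id"
    using linear_injective_left_inverse[OF lin inj] by blast
  have "Blinfun L o\<^sub>L f' x0 = id_blinfun"
  proof (rule blinfun_eqI)
    fix z
    have "blinfun_apply (Blinfun L) = L"
      using L(1) bounded_linear_Blinfun_apply linear_conv_bounded_linear by blast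
    then show "blinfun_apply (Blinfun L o\<^sub>L f' x0) z = blinfun_apply id_blinfun z"
      using f'[OF S(2)] L(2) by (simp add: pointfree_idE)
  qed
  moreover have "continuous_on S f'"
  proof (rule continuous_on_blinfun_componentwise)
    fix i :: 'e
    have "continuous_on S (\<lambda>x. fder f x i)"
      using smooth_on_imp_continuous_on smooth_on_fder f by blast
    then show "continuous_on S (\<lambda>x. blinfun_apply (f' x) i)"
      by (rule continuous_on_eq) (simp add: f')
  qed
  moreover have "(f has_derivative blinfun_apply (f' x)) (at x)" if "x \<in> S" for x
    using f' smooth_on_has_derivative[OF f S(1)] that by simp
  ultimately obtain U V g g' where *: "open U" "U \<subseteq> S" "x0 \<in> U" "open V" "f x0 \<in> V"
    "homeomorphism U V f g" "\<And>y. y \<in> V \<Longrightarrow> (g has_derivative (g' y)) (at y)"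
    "\<And>y. y \<in> V \<Longrightarrow> g' y = inv (blinfun_apply (f'(g y)))"
    "\<And>y. y \<in> V \<Longrightarrow> bij (blinfun_apply (f'(g y)))"
    using inverse_function_theorem[OF S(1) _ _ S(2)] by metis
  have gV: "g ` V \<subseteq> U" "g ` V = U" using *(6) by (auto simp: homeomorphism_def)
  have gf: "g (f x) = x" "f x \<in> V" if "x \<in> U" for x using *(6) that by (auto simp: homeomorphism_def)
  have injU: "inj (fder f x)" if "x \<in> U" for x
    using *(9)[of "f x"] gf[OF that] f' that *(2) bij_is_inj by (metis subsetD)
  have "smooth_on g V"
  proof (rule smooth_on_inverse[where f=f and U=U])
    show "smooth_on f U" using smooth_on_subset f *(2) by blast
    show "f (g y) = y" if "y \<in> V" for y using *(6) that by (auto simp: homeomorphism_def)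
    show "g differentiable (at y)" if "y \<in> V" for y using *(7)[OF that] differentiableI by blast
  qed (use *(1,4) gV(1) injU in auto)
  moreover have "inj (fder g y)" if "y \<in> V" for y
    using *(7)[OF that] *(8)[OF that] *(9)[OF that] fder_eq bij_imp_bij_inv bij_is_inj by metis
  ultimately show thesis using that * injU by blast
qed

section \<open>Symmetry of the second derivative\<close>

text \<open>
  The left-hand side of the equation is symmetric in \<open>u\<close> and \<open>v\<close>. Two applications of the mean value theorem
  express it by the mixed derivative in either order, which gives Schwarz's theorem as \<open>h\<close> tends to 0.
\<close>

lemma mixed_difference_mean_value:
  fixes f :: "'e::euclidean_space \<Rightarrow> real"
  assumes S: "open S" and f: "Ck_on (Suc (Suc 0)) f S" and h: "0 < h"
    and sub: "\<And>s t. 0 \<le> s \<Longrightarrow> s \<le> h \<Longrightarrow> 0 \<le> t \<Longrightarrow> t \<le> h \<Longrightarrow> x + s *\<^sub>R u + t *\<^sub>R v \<in> S"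
  obtains s t where "0 < s" "s < h" "0 < t" "t < h"
    "f (x + h *\<^sub>R u + h *\<^sub>R v) - f (x + h *\<^sub>R u) - f (x + h *\<^sub>R v) + f x =
      h * h * fder (\<lambda>y. fder f y u) (x + s *\<^sub>R u + t *\<^sub>R v) v"
proof -
  have line: "((\<lambda>t. k (a + t *\<^sub>R w)) has_real_derivative fder k (a + t *\<^sub>R w) w) (at t)"
    if "Ck_on (Suc j) k S" "a + t *\<^sub>R w \<in> S" for k :: "'e \<Rightarrow> real" and j a w t
  proof -
    have "(k has_derivative fder k (a + t *\<^sub>R w)) (at (a + t *\<^sub>R w))"
      using Ck_on_Suc_has_derivative[OF that(1) S that(2)] .
    moreover have "((\<lambda>t. a + t *\<^sub>R w) has_derivative (\<lambda>h. h *\<^sub>R w)) (at t)"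
      by (auto intro!: derivative_eq_intros)
    ultimately have "((\<lambda>t. k (a + t *\<^sub>R w)) has_derivative (\<lambda>h. fder k (a + t *\<^sub>R w) (h *\<^sub>R w))) (at t)"
      using diff_chain_at by (force simp: o_def)
    moreover have "fder k (a + t *\<^sub>R w) (h *\<^sub>R w) = h * fder k (a + t *\<^sub>R w) w" for h
      using Ck_on_Suc_has_derivative[OF that(1) S that(2)] has_derivative_linear linear_cmul
      by (metis real_scaleR_def)
    ultimately show ?thesis by (simp add: has_field_derivative_def mult.commute[of _ "fder k (a + t *\<^sub>R w) w"])
  qed
  let ?g = "\<lambda>s. f (x + h *\<^sub>R v + s *\<^sub>R u) - f (x + s *\<^sub>R u)"
  let ?g' = "\<lambda>s. fder f (x + h *\<^sub>R v + s *\<^sub>R u) u - fder f (x + s *\<^sub>R u) u"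
  have "\<exists>s>0. s < h \<and> ?g h - ?g 0 = (h - 0) * ?g' s"
  proof (rule MVT2[OF h])
    fix s assume s: "0 \<le> s" "s \<le> h"
    have "x + h *\<^sub>R v + s *\<^sub>R u \<in> S" "x + s *\<^sub>R u \<in> S"
      using sub[of s h] sub[of s 0] s h by (auto simp: algebra_simps)
    then show "(?g has_real_derivative ?g' s) (at s)"
      by (intro DERIV_diff line[OF f])
  qed
  then obtain s where s: "0 < s" "s < h" "?g h - ?g 0 = h * ?g' s" by auto
  have "\<exists>t>0. t < h \<and> fder f (x + s *\<^sub>R u + h *\<^sub>R v) u - fder f (x + s *\<^sub>R u + 0 *\<^sub>R v) u =
      (h - 0) * fder (\<lambda>y. fder f y u) (x + s *\<^sub>R u + t *\<^sub>R v) v"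
  proof (rule MVT2[OF h])
    fix t assume "0 \<le> t" "t \<le> h"
    then have "x + s *\<^sub>R u + t *\<^sub>R v \<in> S" using sub s by simp
    then show "((\<lambda>t. fder f (x + s *\<^sub>R u + t *\<^sub>R v) u) has_real_derivative
        fder (\<lambda>y. fder f y u) (x + s *\<^sub>R u + t *\<^sub>R v) v) (at t)"
      by (rule line[OF Ck_on_Suc_fder[OF f]])
  qed
  then obtain t where t: "0 < t" "t < h" "fder f (x + s *\<^sub>R u + h *\<^sub>R v) u - fder f (x + s *\<^sub>R u) u =
      h * fder (\<lambda>y. fder f y u) (x + s *\<^sub>R u + t *\<^sub>R v) v" by auto
  have swap: "x + h *\<^sub>R v + s *\<^sub>R u = x + s *\<^sub>R u + h *\<^sub>R v"
    "x + h *\<^sub>R v + h *\<^sub>R u = x + h *\<^sub>R u + h *\<^sub>R v"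
    by simp_all
  have "f (x + h *\<^sub>R u + h *\<^sub>R v) - f (x + h *\<^sub>R u) - (f (x + h *\<^sub>R v) - f x) =
      h * (h * fder (\<lambda>y. fder f y u) (x + s *\<^sub>R u + t *\<^sub>R v) v)"
    using s(3) unfolding swap t(3)[symmetric] by simp
  then have "f (x + h *\<^sub>R u + h *\<^sub>R v) - f (x + h *\<^sub>R u) - f (x + h *\<^sub>R v) + f x =
      h * h * fder (\<lambda>y. fder f y u) (x + s *\<^sub>R u + t *\<^sub>R v) v"
    by (simp add: mult.assoc)
  then show thesis using that s t by blast
qed

lemma second_derivative_symmetric_real:
  fixes f :: "'e::euclidean_space \<Rightarrow> real"
  assumes S: "open S" and x: "x \<in> S" and f: "Ck_on (Suc (Suc 0)) f S"
  shows "fder (\<lambda>y. fder f y u) x v = fder (\<lambda>y. fder f y v) x u"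
proof -
  let ?D = "\<lambda>u v y. fder (\<lambda>y. fder f y u) y v"
  have near: "\<exists>d>0. \<forall>h. 0 < h \<and> h < d \<longrightarrow> (\<forall>s t. 0 \<le> s \<and> s \<le> h \<and> 0 \<le> t \<and> t \<le> h \<longrightarrow>
      x + s *\<^sub>R u + t *\<^sub>R v \<in> T)" if T: "open T" "x \<in> T" for T u v
  proof -
    obtain e where e: "e > 0" "ball x e \<subseteq> T" using T open_contains_ball by blast
    let ?n = "norm u + norm v + 1"
    have n: "?n > 0" by (smt (verit) norm_ge_zero)
    show ?thesis
    proof (intro exI[of _ "e / ?n"] conjI allI impI)
      show "0 < e / ?n" using e n by simp
      fix h s t assume h: "0 < h \<and> h < e / ?n" and st: "0 \<le> s \<and> s \<le> h \<and> 0 \<le> t \<and> t \<le> h"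
      have "norm (s *\<^sub>R u + t *\<^sub>R v) \<le> s * norm u + t * norm v"
        using norm_triangle_ineq[of "s *\<^sub>R u" "t *\<^sub>R v"] st by simp
      also have "\<dots> \<le> h * norm u + h * norm v" using st by (intro add_mono mult_right_mono) auto
      also have "\<dots> \<le> h * ?n" using h by (simp add: algebra_simps)
      also have "\<dots> < e" using h n by (simp add: pos_less_divide_eq)
      finally have "dist (x + (s *\<^sub>R u + t *\<^sub>R v)) x < e" by (simp add: dist_norm)
      then have "x + (s *\<^sub>R u + t *\<^sub>R v) \<in> ball x e" by (simp add: dist_commute)
      then show "x + s *\<^sub>R u + t *\<^sub>R v \<in> T" using e(2) by (auto simp: add.assoc)
    qed
  qed
  have cont: "continuous_on S (?D u v)" for u v
    using f by simp
  have close: "\<bar>?D u v x - ?D v u x\<bar> \<le> \<epsilon>" if "0 < \<epsilon>" for \<epsilon>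
  proof -
    define T where "T u v = S \<inter> {y \<in> S. ?D u v y \<in> ball (?D u v x) (\<epsilon>/2)}" for u v
    have T: "open (T u v)" "x \<in> T u v" for u v
    proof -
      have "{y \<in> S. ?D u v y \<in> ball (?D u v x) (\<epsilon>/2)} = ?D u v -` ball (?D u v x) (\<epsilon>/2) \<inter> S" by auto
      then show "open (T u v)"
        unfolding T_def using continuous_open_preimage[OF cont S open_ball] S
        by (simp add: Int_commute open_Int)
      show "x \<in> T u v" unfolding T_def using x that by simp
    qed
    obtain d1 where d1: "d1 > 0" "\<forall>h. 0 < h \<and> h < d1 \<longrightarrow> (\<forall>s t. 0 \<le> s \<and> s \<le> h \<and> 0 \<le> t \<and> t \<le> h \<longrightarrow>
      x + s *\<^sub>R u + t *\<^sub>R v \<in> T u v)" using near[OF T] by blast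
    obtain d2 where d2: "d2 > 0" "\<forall>h. 0 < h \<and> h < d2 \<longrightarrow> (\<forall>s t. 0 \<le> s \<and> s \<le> h \<and> 0 \<le> t \<and> t \<le> h \<longrightarrow>
      x + s *\<^sub>R v + t *\<^sub>R u \<in> T v u)" using near[OF T] by blast
    define h where "h = min d1 d2 / 2"
    have h: "0 < h" "h < d1" "h < d2" using d1(1) d2(1) by (auto simp: h_def)
    have in1: "x + s *\<^sub>R u + t *\<^sub>R v \<in> T u v" "x + s *\<^sub>R v + t *\<^sub>R u \<in> T v u"
      if "0 \<le> s" "s \<le> h" "0 \<le> t" "t \<le> h" for s t using d1(2) d2(2) h that by blast+
    then have in2: "x + s *\<^sub>R u + t *\<^sub>R v \<in> S" "x + s *\<^sub>R v + t *\<^sub>R u \<in> S"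
      if "0 \<le> s" "s \<le> h" "0 \<le> t" "t \<le> h" for s t using that by (auto simp: T_def)
    obtain s t where st: "0 < s" "s < h" "0 < t" "t < h"
      "f (x + h *\<^sub>R u + h *\<^sub>R v) - f (x + h *\<^sub>R u) - f (x + h *\<^sub>R v) + f x =
        h * h * ?D u v (x + s *\<^sub>R u + t *\<^sub>R v)"
      using mixed_difference_mean_value[OF S f h(1), of x u v] in2 by blast
    obtain s' t' where st': "0 < s'" "s' < h" "0 < t'" "t' < h"
      "f (x + h *\<^sub>R v + h *\<^sub>R u) - f (x + h *\<^sub>R v) - f (x + h *\<^sub>R u) + f x =
        h * h * ?D v u (x + s' *\<^sub>R v + t' *\<^sub>R u)"
      using mixed_difference_mean_value[OF S f h(1), of x v u] in2 by blast
    have swap: "x + h *\<^sub>R u + h *\<^sub>R v = x + h *\<^sub>R v + h *\<^sub>R u" by simp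
    have "h * h * ?D u v (x + s *\<^sub>R u + t *\<^sub>R v) = h * h * ?D v u (x + s' *\<^sub>R v + t' *\<^sub>R u)"
      using st(5)[unfolded swap] st'(5) by linarith
    then have "?D u v (x + s *\<^sub>R u + t *\<^sub>R v) = ?D v u (x + s' *\<^sub>R v + t' *\<^sub>R u)" using h(1) by simp
    moreover have "dist (?D u v x) (?D u v (x + s *\<^sub>R u + t *\<^sub>R v)) < \<epsilon>/2"
      using in1(1)[of s t] st by (simp add: T_def)
    moreover have "dist (?D v u x) (?D v u (x + s' *\<^sub>R v + t' *\<^sub>R u)) < \<epsilon>/2"
      using in1(2)[of s' t'] st' by (simp add: T_def)
    ultimately show ?thesis unfolding dist_real_def by linarith
  qed
  have "\<bar>?D u v x - ?D v u x\<bar> \<le> 0" by (rule field_le_epsilon) (use close in simp)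
  then show ?thesis by simp
qed

lemma second_derivative_symmetric:
  fixes f :: "'e::euclidean_space \<Rightarrow> 'b::euclidean_space"
  assumes S: "open S" and x: "x \<in> S" and f: "smooth_on f S"
  shows "fder (\<lambda>y. fder f y u) x v = fder (\<lambda>y. fder f y v) x u"
proof (rule euclidean_eqI)
  fix i :: 'b
  let ?f = "\<lambda>y. f y \<bullet> i"
  have inner: "fder (\<lambda>y. k y \<bullet> i) y w = fder k y w \<bullet> i" if "smooth_on k S" "y \<in> S"
    for k :: "'e \<Rightarrow> 'b" and y w
    by (simp only: fder_eq[OF has_derivative_inner_left[OF smooth_on_has_derivative[OF that(1) S that(2)]]])
  have "fder (\<lambda>y. fder f y w) x z \<bullet> i = fder (\<lambda>y. fder ?f y w) x z" for w z
  proof -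
    have "fder (\<lambda>y. fder ?f y w) x = fder (\<lambda>y. fder f y w \<bullet> i) x"
      by (rule fder_cong_open[OF S x]) (rule inner[OF f])
    then show ?thesis by (simp only: inner[OF smooth_on_fder[OF f] x])
  qed
  moreover have "smooth_on ?f S" using smooth_on_bounded_linear[OF S bounded_linear_inner_left f] .
  then have "fder (\<lambda>y. fder ?f y u) x v = fder (\<lambda>y. fder ?f y v) x u"
    unfolding smooth_on_def by (intro second_derivative_symmetric_real[OF S x]) (erule spec)
  ultimately show "fder (\<lambda>y. fder f y u) x v \<bullet> i = fder (\<lambda>y. fder f y v) x u \<bullet> i" by simp
qed

section \<open>Orthonormal bases and orthogonal projections\<close>

lemma inner_form_bilinear:
  assumes "inner_form b"
  shows "linear (b u)" "linear (\<lambda>u. b u v)"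
  using assms unfolding inner_form_def bilinear_def by auto

lemma inner_form_sym: "inner_form b \<Longrightarrow> b u v = b v u"
  unfolding inner_form_def by blast

lemma inner_form_pos: "inner_form b \<Longrightarrow> u \<noteq> 0 \<Longrightarrow> 0 < b u u"
  unfolding inner_form_def by blast

lemma inner_form_simps:
  assumes "inner_form b"
  shows "b (u + v) w = b u w + b v w" "b u (v + w) = b u v + b u w"
    "b (u - v) w = b u w - b v w" "b u (v - w) = b u v - b u w"
    "b (- u) w = - b u w" "b u (- w) = - b u w"
    "b (c *\<^sub>R u) w = c * b u w" "b u (c *\<^sub>R w) = c * b u w"
    "b 0 w = 0" "b u 0 = 0"
    "b (sum f I) w = (\<Sum>i\<in>I. b (f i) w)" "b u (sum f I) = (\<Sum>i\<in>I. b u (f i))"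
proof -
  note l = inner_form_bilinear[OF assms]
  show "b (u + v) w = b u w + b v w" "b u (v + w) = b u v + b u w"
    "b (u - v) w = b u w - b v w" "b u (v - w) = b u v - b u w"
    "b (- u) w = - b u w" "b u (- w) = - b u w"
    "b (c *\<^sub>R u) w = c * b u w" "b u (c *\<^sub>R w) = c * b u w"
    "b 0 w = 0" "b u 0 = 0"
    "b (sum f I) w = (\<Sum>i\<in>I. b (f i) w)" "b u (sum f I) = (\<Sum>i\<in>I. b u (f i))"
    using linear_add[OF l(1)] linear_add[OF l(2)] linear_diff[OF l(1)] linear_diff[OF l(2)]
      linear_neg[OF l(1)] linear_neg[OF l(2)] linear_cmul[OF l(1)] linear_cmul[OF l(2)]
      linear_0[OF l(1)] linear_0[OF l(2)] linear_sum[OF l(1)] linear_sum[OF l(2)]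
    by auto
qed

lemma inner_form_eq_0:
  assumes "inner_form b" "b u u = 0" shows "u = 0"
  using inner_form_pos[OF assms(1)] assms(2) by fastforce

lemma inner_form_nonneg: "inner_form b \<Longrightarrow> 0 \<le> b u u"
  using inner_form_pos inner_form_simps(9) by (metis less_eq_real_def)

lemma orthonormal_basis_subset: "orthonormal_basis b W B \<Longrightarrow> u \<in> B \<Longrightarrow> u \<in> W"
  unfolding orthonormal_basis_def using span_base by blast

lemma orthonormal_basis_expansion:
  assumes b: "inner_form b" and B: "orthonormal_basis b W B" and w: "w \<in> W"
  shows "w = (\<Sum>u\<in>B. b w u *\<^sub>R u)"
proof -
  have fin: "finite B" and on: "\<And>u v. u \<in> B \<Longrightarrow> v \<in> B \<Longrightarrow> b u v = (if u = v then 1 else 0)"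
    using B unfolding orthonormal_basis_def by auto
  have "w \<in> span B" using B w unfolding orthonormal_basis_def by blast
  then obtain c where c: "w = (\<Sum>v\<in>B. c v *\<^sub>R v)" unfolding span_finite[OF fin] by blast
  have "b w u = c u" if u: "u \<in> B" for u
  proof -
    have "b w u = (\<Sum>v\<in>B. c v * b v u)" unfolding c by (simp add: inner_form_simps[OF b])
    also have "\<dots> = (\<Sum>v\<in>B. if v = u then c v else 0)" using on u by (intro sum.cong) auto
    finally show ?thesis using u fin by simp
  qed
  then show ?thesis using c by simp
qed

lemma orthonormal_basis_parseval:
  assumes b: "inner_form b" and B: "orthonormal_basis b W B" and w: "v \<in> W"
  shows "b v w = (\<Sum>u\<in>B. b v u * b u w)"
proof -
  have "b v w = b (\<Sum>u\<in>B. b v u *\<^sub>R u) w" using orthonormal_basis_expansion[OF assms] by simp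
  then show ?thesis by (simp add: inner_form_simps[OF b])
qed

lemma orthonormal_basis_independent:
  assumes b: "inner_form b" and B: "orthonormal_basis b W B"
  shows "independent B" "card B = dim W"
proof -
  have on: "\<And>u v. u \<in> B \<Longrightarrow> v \<in> B \<Longrightarrow> b u v = (if u = v then 1 else 0)"
    using B unfolding orthonormal_basis_def by auto
  show ind: "independent B"
    unfolding dependent_def
  proof
    assume "\<exists>u\<in>B. u \<in> span (B - {u})"
    then obtain u where u: "u \<in> B" "u \<in> span (B - {u})" by blast
    have "subspace {v. b v u = 0}"
      by (auto simp: subspace_def inner_form_simps[OF b])
    moreover have "B - {u} \<subseteq> {v. b v u = 0}" using on u(1) by auto
    ultimately have "u \<in> {v. b v u = 0}" using span_minimal u(2) by blast
    then show False using on[OF u(1) u(1)] by simp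
  qed
  show "card B = dim W"
    using dim_span_eq_card_independent[OF ind] B unfolding orthonormal_basis_def by simp
qed

lemma orthonormal_basis_extend:
  assumes b: "inner_form b" and W: "subspace W" and B: "orthonormal_basis b {w \<in> W. b w e = 0} B"
    and e: "e \<in> W" "b e e = 1"
  shows "orthonormal_basis b W (insert e B)"
proof -
  have fin: "finite B" and sp: "span B = {w \<in> W. b w e = 0}"
    and on: "\<And>u v. u \<in> B \<Longrightarrow> v \<in> B \<Longrightarrow> b u v = (if u = v then 1 else 0)"
    using B unfolding orthonormal_basis_def by auto
  have Be: "u \<in> W" "b u e = 0" if "u \<in> B" for u using sp span_base[OF that] by auto
  have "span (insert e B) \<subseteq> W" using Be(1) e(1) W by (intro span_minimal) auto
  moreover have "W \<subseteq> span (insert e B)"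
  proof
    fix w assume w: "w \<in> W"
    have "w - b w e *\<^sub>R e \<in> W" using w e(1) W by (simp add: subspace_diff subspace_scale)
    then have "w - b w e *\<^sub>R e \<in> span B" unfolding sp using e(2) by (simp add: inner_form_simps[OF b])
    then show "w \<in> span (insert e B)" using span_insert by blast
  qed
  moreover have "b u v = (if u = v then 1 else 0)" if "u \<in> insert e B" "v \<in> insert e B" for u v
    using that Be on e(2) inner_form_sym[OF b] by (metis insertE zero_neq_one)
  ultimately show ?thesis unfolding orthonormal_basis_def using fin by auto
qed

lemma exists_unit_vector:
  assumes b: "inner_form b" and W: "subspace W" "u \<in> W" "u \<noteq> 0"
  obtains e where "e \<in> W" "b e e = 1" "e = (1 / sqrt (b u u)) *\<^sub>R u"
proof -
  have "b u u > 0" using inner_form_pos b W(3) by blast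
  then have "b ((1 / sqrt (b u u)) *\<^sub>R u) ((1 / sqrt (b u u)) *\<^sub>R u) = 1"
    by (simp add: inner_form_simps[OF b])
  then show thesis using that W(1,2) subspace_scale by blast
qed

text \<open>
  Gram-Schmidt: split off a unit vector and continue in its orthogonal complement.
\<close>

lemma exists_orthonormal_basis:
  assumes b: "inner_form b"
  shows "subspace W \<Longrightarrow> \<exists>B. orthonormal_basis b W B"
proof (induction "dim W" arbitrary: W rule: less_induct)
  case less
  show ?case
  proof (cases "W \<subseteq> {0}")
    case True
    then have "orthonormal_basis b W {}"
      using less.prems subspace_0 unfolding orthonormal_basis_def by auto
    then show ?thesis by blast
  next
    case False
    then obtain u where u: "u \<in> W" "u \<noteq> 0" by blast
    obtain e where e: "e \<in> W" "b e e = 1" using exists_unit_vector[OF b less.prems u] by blast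
    let ?W = "{w \<in> W. b w e = 0}"
    have sub: "subspace ?W"
      using less.prems by (auto simp: subspace_def inner_form_simps[OF b])
    have "e \<notin> ?W" using e(2) by simp
    then have "?W \<subset> W" using e(1) by blast
    then have "dim ?W < dim W"
      using dim_psubset[of ?W W] sub less.prems by (metis span_eq_iff)
    then obtain B where "orthonormal_basis b ?W B" using less.hyps sub by blast
    then show ?thesis using orthonormal_basis_extend[OF b less.prems _ e] by blast
  qed
qed

lemma some_onb:
  assumes "inner_form b" "subspace W"
  shows "orthonormal_basis b W (some_onb b W)"
  unfolding some_onb_def using exists_orthonormal_basis[OF assms] by (rule someI_ex)

lemma orth_proj_eq:
  assumes b: "inner_form b" and W: "subspace W"
    and v: "v \<in> W" "\<And>w. w \<in> W \<Longrightarrow> b (u - v) w = 0"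
  shows "orth_proj b W u = v"
  unfolding orth_proj_def
proof (rule the_equality)
  fix v' assume v': "v' \<in> W \<and> (\<forall>w\<in>W. b (u - v') w = 0)"
  then have d: "v - v' \<in> W" using v(1) W subspace_diff by blast
  have "b (v - v') (v - v') = b (u - v') (v - v') - b (u - v) (v - v')"
    by (simp add: inner_form_simps[OF b])
  then have "b (v - v') (v - v') = 0" using d v v' by simp
  then show "v' = v" using inner_form_eq_0[OF b] by fastforce
qed (use v in blast)

lemma orthonormal_basis_residual:
  assumes b: "inner_form b" and B: "orthonormal_basis b W B" and w: "w \<in> W"
  shows "b (u - (\<Sum>e\<in>B. b u e *\<^sub>R e)) w = 0"
proof -
  have "(\<Sum>e\<in>B. b u e * b e w) = (\<Sum>e\<in>B. b w e * b e u)"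
    by (intro sum.cong refl) (metis inner_form_sym[OF b] mult.commute)
  also have "\<dots> = b u w"
    using orthonormal_basis_parseval[OF b B w, of u] inner_form_sym[OF b, of w u] by simp
  finally show ?thesis by (simp add: inner_form_simps[OF b])
qed

lemma orth_proj_sum:
  assumes b: "inner_form b" and W: "subspace W" and B: "orthonormal_basis b W B"
  shows "orth_proj b W u = (\<Sum>e\<in>B. b u e *\<^sub>R e)"
proof (rule orth_proj_eq[OF b W])
  show "(\<Sum>e\<in>B. b u e *\<^sub>R e) \<in> W"
    by (intro subspace_sum W subspace_scale orthonormal_basis_subset[OF B])
qed (use orthonormal_basis_residual[OF b B] in blast)

lemma orth_proj:
  assumes b: "inner_form b" and W: "subspace W"
  shows "orth_proj b W u \<in> W" "w \<in> W \<Longrightarrow> b (u - orth_proj b W u) w = 0"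
    "linear (orth_proj b W)"
    "u \<in> W \<Longrightarrow> orth_proj b W u = u"
proof -
  obtain B where B: "orthonormal_basis b W B" using exists_orthonormal_basis[OF b W] by blast
  note eq = orth_proj_sum[OF b W B]
  show 1: "orth_proj b W u \<in> W" unfolding eq
    by (intro subspace_sum W subspace_scale orthonormal_basis_subset[OF B])
  show "b (u - orth_proj b W u) w = 0" if "w \<in> W"
    unfolding eq using orthonormal_basis_residual[OF b B that] .
  show "linear (orth_proj b W)"
    unfolding eq[abs_def]
    by (rule linearI) (simp_all add: inner_form_simps[OF b] scaleR_add_left sum.distrib scaleR_sum_right)
  show "u \<in> W \<Longrightarrow> orth_proj b W u = u"
    by (rule orth_proj_eq[OF b W]) (auto simp: inner_form_simps[OF b])
qed

section \<open>Traces, norms and hyperplanes\<close>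

text \<open>
  Casorati curvatures refer to orthonormal bases that were chosen independently for every subspace. Independence
  of the basis is what makes a hyperplane comparable with the whole space in one adapted basis.
\<close>

lemma trace_orthonormal_basis:
  fixes \<phi> :: "'e::euclidean_space \<Rightarrow> 'e \<Rightarrow> real"
  assumes b: "inner_form b" and \<phi>: "bilinear \<phi>"
    and B: "orthonormal_basis b W B" and C: "orthonormal_basis b W C"
  shows "(\<Sum>u\<in>B. \<phi> u u) = (\<Sum>v\<in>C. \<phi> v v)"
proof -
  have l: "linear (\<phi> u)" "linear (\<lambda>u. \<phi> u v)" for u v using \<phi> unfolding bilinear_def by auto
  have "\<phi> u u = (\<Sum>v\<in>C. \<Sum>w\<in>C. b v u * b u w * \<phi> v w)" if u: "u \<in> B" for u
  proof -
    have ue: "u = (\<Sum>v\<in>C. b u v *\<^sub>R v)"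
      using orthonormal_basis_expansion[OF b C orthonormal_basis_subset[OF B u]] .
    have "\<phi> u u = \<phi> (\<Sum>v\<in>C. b u v *\<^sub>R v) (\<Sum>w\<in>C. b u w *\<^sub>R w)" using ue by simp
    also have "\<dots> = (\<Sum>v\<in>C. b u v * \<phi> v (\<Sum>w\<in>C. b u w *\<^sub>R w))"
      unfolding linear_sum[OF l(2)] linear_cmul[OF l(2)] by simp
    also have "\<dots> = (\<Sum>v\<in>C. b u v * (\<Sum>w\<in>C. b u w * \<phi> v w))"
      unfolding linear_sum[OF l(1)] linear_cmul[OF l(1)] by simp
    finally show ?thesis
      unfolding inner_form_sym[OF b, of u] by (simp add: sum_distrib_left mult.assoc)
  qed
  then have "(\<Sum>u\<in>B. \<phi> u u) = (\<Sum>u\<in>B. \<Sum>v\<in>C. \<Sum>w\<in>C. b v u * b u w * \<phi> v w)" by simp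
  also have "\<dots> = (\<Sum>v\<in>C. \<Sum>w\<in>C. (\<Sum>u\<in>B. b v u * b u w) * \<phi> v w)"
    by (subst sum.swap, rule sum.cong[OF refl], subst sum.swap) (simp add: sum_distrib_right)
  also have "\<dots> = (\<Sum>v\<in>C. \<Sum>w\<in>C. b v w * \<phi> v w)"
    using orthonormal_basis_parseval[OF b B] orthonormal_basis_subset[OF C] by simp
  also have "\<dots> = (\<Sum>v\<in>C. \<Sum>w\<in>C. if v = w then \<phi> v w else 0)"
    using C unfolding orthonormal_basis_def by (intro sum.cong refl) auto
  also have "\<dots> = (\<Sum>v\<in>C. \<phi> v v)"
    using C unfolding orthonormal_basis_def by (simp add: sum.delta)
  finally show ?thesis .
qed

lemma square_norm_orthonormal_basis:
  fixes h :: "'e::euclidean_space \<Rightarrow> 'e \<Rightarrow> real"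
  assumes b: "inner_form b" and h: "bilinear h"
    and B: "orthonormal_basis b W B" and C: "orthonormal_basis b W C"
  shows "(\<Sum>u\<in>B. \<Sum>v\<in>B. (h u v)\<^sup>2) = (\<Sum>u\<in>C. \<Sum>v\<in>C. (h u v)\<^sup>2)"
proof -
  have l: "linear (h u)" "linear (\<lambda>u. h u v)" for u v using h unfolding bilinear_def by auto
  have sq: "(\<Sum>u\<in>B. (f u)\<^sup>2) = (\<Sum>u\<in>C. (f u)\<^sup>2)" if "linear f" for f :: "'e \<Rightarrow> real"
  proof -
    have "bilinear (\<lambda>u v. f u * f v)"
      using that unfolding bilinear_def
      by (auto intro!: linearI simp: linear_add linear_cmul algebra_simps real_scaleR_def)
    then show ?thesis using trace_orthonormal_basis[OF b _ B C] by (simp add: power2_eq_square)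
  qed
  have "(\<Sum>u\<in>B. \<Sum>v\<in>B. (h u v)\<^sup>2) = (\<Sum>u\<in>B. \<Sum>v\<in>C. (h u v)\<^sup>2)" using sq[OF l(1)] by simp
  also have "\<dots> = (\<Sum>v\<in>C. \<Sum>u\<in>B. (h u v)\<^sup>2)" by (rule sum.swap)
  also have "\<dots> = (\<Sum>v\<in>C. \<Sum>u\<in>C. (h u v)\<^sup>2)" using sq[OF l(2)] by simp
  also have "\<dots> = (\<Sum>u\<in>C. \<Sum>v\<in>C. (h u v)\<^sup>2)" by (rule sum.swap)
  finally show ?thesis .
qed

text \<open>
  Both are the Cauchy-Schwarz inequality for \<open>m\<close> numbers with sum \<open>s\<close> and one more number \<open>y\<close>. The factor is the
  sum of the inverse weights: \<open>m * 1 + 2\<close> in the first case, \<open>m * 2 + 1\<close> in the second.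
\<close>

lemma weighted_cauchy_schwarz:
  fixes m s y q :: real
  assumes "0 < m" "s\<^sup>2 \<le> m * q"
  shows "(s + y)\<^sup>2 \<le> (m + 2) * (q + y\<^sup>2 / 2)" "(s + y)\<^sup>2 \<le> (2 * m + 1) * (q / 2 + y\<^sup>2)"
proof -
  have q: "s\<^sup>2 / m \<le> q" using assms by (simp add: pos_divide_le_eq mult.commute)
  \<comment> \<open>The difference of the two sides, with \<open>s\<^sup>2 / m\<close> in place of \<open>q\<close>, is a square divided by \<open>2 * m\<close>.\<close>
  have "0 \<le> (2 * s - m * y)\<^sup>2 / (2 * m)" using assms(1) by simp
  also have "\<dots> = (m + 2) * (s\<^sup>2 / m + y\<^sup>2 / 2) - (s + y)\<^sup>2"
    using assms(1) by (simp add: field_simps power2_eq_square)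
  also have "\<dots> \<le> (m + 2) * (q + y\<^sup>2 / 2) - (s + y)\<^sup>2"
    using q assms(1) by (simp add: mult_left_mono)
  finally show "(s + y)\<^sup>2 \<le> (m + 2) * (q + y\<^sup>2 / 2)" by simp
  have "0 \<le> (s - 2 * m * y)\<^sup>2 / (2 * m)" using assms(1) by simp
  also have "\<dots> = (2 * m + 1) * ((s\<^sup>2 / m) / 2 + y\<^sup>2) - (s + y)\<^sup>2"
    using assms(1) by (simp add: field_simps power2_eq_square)
  also have "\<dots> \<le> (2 * m + 1) * (q / 2 + y\<^sup>2) - (s + y)\<^sup>2"
    using q assms(1) by (simp add: mult_left_mono)
  finally show "(s + y)\<^sup>2 \<le> (2 * m + 1) * (q / 2 + y\<^sup>2)" by simp
qed

lemma hyperplane_onb_extend: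
  assumes b: "inner_form b" and V: "subspace V" and L: "subspace L" "L \<subseteq> V" "dim L + 1 = dim V"
    and B: "orthonormal_basis b L B"
  obtains n where "n \<notin> B" "orthonormal_basis b V (insert n B)"
proof -
  have "L \<noteq> V" using L(3) by auto
  then obtain v where v: "v \<in> V" "v \<notin> L" using L(2) by blast
  define u where "u = v - orth_proj b L v"
  have u: "u \<in> V" "u \<noteq> 0"
    unfolding u_def using v L V orth_proj(1)[OF b L(1), of v] by (auto intro: subspace_diff)
  have uL: "b u w = 0" if "w \<in> L" for w unfolding u_def using orth_proj(2)[OF b L(1) that] .
  obtain e where e: "e \<in> V" "b e e = 1" "e = (1 / sqrt (b u u)) *\<^sub>R u"
    using exists_unit_vector[OF b V u] by blast
  have eL: "b w e = 0" if "w \<in> L" for w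
    using uL[OF that] by (simp add: e(3) inner_form_simps[OF b] inner_form_sym[OF b, of w])
  let ?W = "{w \<in> V. b w e = 0}"
  have subW: "subspace ?W" using V by (auto simp: subspace_def inner_form_simps[OF b])
  have "e \<notin> ?W" using e(2) by simp
  then have "?W \<subset> V" using e(1) by blast
  then have "dim ?W < dim V" using dim_psubset[of ?W V] subW V by (metis span_eq_iff)
  moreover have "L \<subseteq> ?W" using L(2) eL by blast
  ultimately have "L = ?W"
    using subspace_dim_equal[OF L(1) subW] L(3) by linarith
  then have "orthonormal_basis b V (insert e B)" using orthonormal_basis_extend[OF b V _ e(1,2)] B by simp
  moreover have "e \<notin> B" using eL orthonormal_basis_subset[OF B] e(2) by fastforce
  ultimately show thesis using that by blast
qed

lemma sum_squares_ge_diagonal: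
  fixes h :: "'a \<Rightarrow> 'a \<Rightarrow> real"
  assumes "finite B"
  shows "(\<Sum>u\<in>B. (h u u)\<^sup>2) \<le> (\<Sum>u\<in>B. \<Sum>v\<in>B. (h u v)\<^sup>2)"
  by (rule sum_mono, rule member_le_sum[where f="\<lambda>v. (h _ v)\<^sup>2"]) (use assms in auto)

text \<open>
  Extend an orthonormal basis of the hyperplane \<open>L\<close> by a unit normal \<open>n\<close>. In \<open>NV + NL\<close> the diagonal entries
  along \<open>L\<close> are counted twice and the entry at \<open>n\<close> once, whereas in \<open>NV - NL / 2\<close> those along \<open>L\<close> have weight
  one half and the one at \<open>n\<close> weight one; the off-diagonal entries only increase both expressions. The claims
  are then the two cases of \<open>weighted_cauchy_schwarz\<close>.
\<close>

lemma trace_squared_le_hyperplane: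
  fixes h :: "'e::euclidean_space \<Rightarrow> 'e \<Rightarrow> real"
  assumes b: "inner_form b" and h: "bilinear h" and V: "subspace V"
    and L: "subspace L" "L \<subseteq> V" "dim L + 1 = dim V" and r: "2 \<le> dim V"
    and BV: "orthonormal_basis b V BV" and BL: "orthonormal_basis b L BL"
  defines "t \<equiv> \<Sum>u\<in>BV. h u u"
    and "NV \<equiv> \<Sum>u\<in>BV. \<Sum>v\<in>BV. (h u v)\<^sup>2" and "NL \<equiv> \<Sum>u\<in>BL. \<Sum>v\<in>BL. (h u v)\<^sup>2"
  shows "t\<^sup>2 \<le> (real (dim V) + 1) / 2 * (NV + NL)" "t\<^sup>2 \<le> (2 * real (dim V) - 1) * (NV - NL / 2)"
proof -
  obtain n where n: "n \<notin> BL" "orthonormal_basis b V (insert n BL)"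
    using hyperplane_onb_extend[OF b V L BL] by blast
  have fin: "finite BL" using BL unfolding orthonormal_basis_def by blast
  define s where "s = (\<Sum>u\<in>BL. h u u)"
  define y where "y = h n n"
  define q where "q = (\<Sum>u\<in>BL. (h u u)\<^sup>2)"
  define m where "m = real (dim L)"
  have m: "0 < m" "real (dim V) = m + 1" using L(3) r by (auto simp: m_def)
  have t: "t = s + y"
    unfolding t_def trace_orthonormal_basis[OF b h BV n(2)] s_def y_def using n(1) fin by simp
  have NV: "NV = (h n n)\<^sup>2 + (\<Sum>v\<in>BL. (h n v)\<^sup>2) + (\<Sum>u\<in>BL. (h u n)\<^sup>2) + NL"
    unfolding NV_def square_norm_orthonormal_basis[OF b h BV n(2)] NL_def
    using n(1) fin by (simp add: sum.distrib)
  have NVge: "NV \<ge> y\<^sup>2 + NL"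
  proof -
    have "0 \<le> (\<Sum>v\<in>BL. (h n v)\<^sup>2)" "0 \<le> (\<Sum>u\<in>BL. (h u n)\<^sup>2)" by (auto intro: sum_nonneg)
    then show ?thesis unfolding NV y_def by linarith
  qed
  have NLge: "NL \<ge> q" unfolding q_def NL_def by (rule sum_squares_ge_diagonal[OF fin])
  have "s\<^sup>2 \<le> (\<Sum>u\<in>BL. 1\<^sup>2) * q"
    unfolding s_def q_def using Cauchy_Schwarz_ineq_sum[of "\<lambda>_. 1" "\<lambda>u. h u u" BL] by simp
  then have sq: "s\<^sup>2 \<le> m * q"
    using orthonormal_basis_independent(2)[OF b BL] by (simp add: m_def)
  have "t\<^sup>2 \<le> (m + 2) * (q + y\<^sup>2 / 2)" unfolding t using weighted_cauchy_schwarz(1)[OF m(1) sq] .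
  also have "\<dots> \<le> (m + 2) * ((NV + NL) / 2)" using NVge NLge m(1) by (intro mult_left_mono) auto
  finally show "t\<^sup>2 \<le> (real (dim V) + 1) / 2 * (NV + NL)" unfolding m(2) by (simp add: algebra_simps)
  have "t\<^sup>2 \<le> (2 * m + 1) * (q / 2 + y\<^sup>2)" unfolding t using weighted_cauchy_schwarz(2)[OF m(1) sq] .
  also have "\<dots> \<le> (2 * m + 1) * (NV - NL / 2)" using NVge NLge m(1) by (intro mult_left_mono) auto
  finally show "t\<^sup>2 \<le> (2 * real (dim V) - 1) * (NV - NL / 2)" unfolding m(2) by (simp add: algebra_simps)
qed

lemma exists_hyperplane:
  fixes V :: "'e::euclidean_space set"
  assumes "subspace V" "1 \<le> dim V"
  obtains L where "subspace L" "L \<subseteq> V" "dim L + 1 = dim V"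
proof -
  obtain L where "subspace L" "L \<subseteq> span V" "dim L = dim V - 1"
    using choose_subspace_of_subspace[of "dim V - 1" V] by auto
  then show thesis using that assms by (metis le_add_diff_inverse2 span_eq_iff)
qed

section \<open>Metrics on open sets and their Christoffel maps\<close>

lemma inner_form_unique:
  assumes b: "inner_form b" and "\<And>w. b z w = b z' w"
  shows "z = z'"
proof -
  have "b (z - z') (z - z') = 0" using assms(2) by (simp add: inner_form_simps[OF b])
  then show ?thesis using inner_form_eq_0[OF b] by fastforce
qed

lemma inner_form_representation:
  fixes \<phi> :: "'e::euclidean_space \<Rightarrow> real"
  assumes b: "inner_form b" and \<phi>: "linear \<phi>"
  obtains z where "\<And>w. b z w = \<phi> w"
proof -
  obtain B where B: "orthonormal_basis b UNIV B" using exists_orthonormal_basis[OF b subspace_UNIV] by blast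
  have "b (\<Sum>e\<in>B. \<phi> e *\<^sub>R e) w = \<phi> w" for w
  proof -
    have "\<phi> w = \<phi> (\<Sum>e\<in>B. b w e *\<^sub>R e)" using orthonormal_basis_expansion[OF b B UNIV_I, of w] by simp
    also have "\<dots> = (\<Sum>e\<in>B. b w e * \<phi> e)" by (simp add: linear_sum[OF \<phi>] linear_cmul[OF \<phi>])
    finally show ?thesis
      unfolding inner_form_sym[OF b, of w] by (simp add: inner_form_simps[OF b] mult.commute)
  qed
  then show thesis using that by blast
qed

lemma bilinear_sum_Basis:
  fixes B :: "'a::euclidean_space \<Rightarrow> 'b::euclidean_space \<Rightarrow> 'c::real_vector"
  assumes "bilinear B"
  shows "B u v = (\<Sum>i\<in>Basis. (u \<bullet> i) *\<^sub>R (\<Sum>j\<in>Basis. (v \<bullet> j) *\<^sub>R B i j))"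
proof -
  have l: "linear (B u)" "linear (\<lambda>u. B u v)" for u v using assms unfolding bilinear_def by auto
  have "B u v = (\<Sum>i\<in>Basis. (u \<bullet> i) *\<^sub>R B i v)" by (rule linear_sum_Basis[OF l(2)])
  also have "\<dots> = (\<Sum>i\<in>Basis. (u \<bullet> i) *\<^sub>R (\<Sum>j\<in>Basis. (v \<bullet> j) *\<^sub>R B i j))"
    using linear_sum_Basis[OF l(1), of _ v] by (metis (lifting))
  finally show ?thesis .
qed

text \<open>
  The derivative of a field of bilinear forms is again bilinear in its arguments, because addition and scaling
  commute with differentiation.
\<close>

lemma bilinear_fder:
  fixes G :: "'e::euclidean_space \<Rightarrow> 'a::euclidean_space \<Rightarrow> 'b::euclidean_space \<Rightarrow> 'c::real_normed_vector"
  assumes O: "open O'" "x \<in> O'" and bil: "\<And>z. z \<in> O' \<Longrightarrow> bilinear (G z)"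
    and d: "\<And>u v. (\<lambda>z. G z u v) differentiable (at x)"
  shows "bilinear (\<lambda>u v. fder (\<lambda>z. G z u v) x h)"
proof -
  have l: "linear (G z u)" "linear (\<lambda>u. G z u v)" if "z \<in> O'" for z u v
    using bil[OF that] unfolding bilinear_def by auto
  have d': "((\<lambda>z. G z u v) has_derivative fder (\<lambda>z. G z u v) x) (at x)" for u v
    using d frechet_derivative_works by blast
  have add: "fder (\<lambda>z. f z + g z) x h = fder f x h + fder g x h"
    if "(f has_derivative fder f x) (at x)" "(g has_derivative fder g x) (at x)" for f g :: "'e \<Rightarrow> 'c"
    by (simp only: fder_eq[OF has_derivative_add[OF that]])
  have scale: "fder (\<lambda>z. c *\<^sub>R f z) x h = c *\<^sub>R fder f x h"
    if "(f has_derivative fder f x) (at x)" for f :: "'e \<Rightarrow> 'c" and c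
    by (simp only: fder_eq[OF has_derivative_scaleR_right[OF that]])
  show ?thesis unfolding bilinear_def
  proof (intro conjI allI linearI)
    fix u v v' c
    have "fder (\<lambda>z. G z u (v + v')) x = fder (\<lambda>z. G z u v + G z u v') x"
      by (rule fder_cong_open[OF O]) (simp add: linear_add[OF l(1)])
    then show "fder (\<lambda>z. G z u (v + v')) x h = fder (\<lambda>z. G z u v) x h + fder (\<lambda>z. G z u v') x h"
      using add[OF d' d'] by simp
    have "fder (\<lambda>z. G z u (c *\<^sub>R v)) x = fder (\<lambda>z. c *\<^sub>R G z u v) x"
      by (rule fder_cong_open[OF O]) (simp add: linear_cmul[OF l(1)])
    then show "fder (\<lambda>z. G z u (c *\<^sub>R v)) x h = c *\<^sub>R fder (\<lambda>z. G z u v) x h"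
      using scale[OF d'] by simp
  next
    fix v u u' c
    have "fder (\<lambda>z. G z (u + u') v) x = fder (\<lambda>z. G z u v + G z u' v) x"
      by (rule fder_cong_open[OF O]) (simp add: linear_add[OF l(2)])
    then show "fder (\<lambda>z. G z (u + u') v) x h = fder (\<lambda>z. G z u v) x h + fder (\<lambda>z. G z u' v) x h"
      using add[OF d' d'] by simp
    have "fder (\<lambda>z. G z (c *\<^sub>R u) v) x = fder (\<lambda>z. c *\<^sub>R G z u v) x"
      by (rule fder_cong_open[OF O]) (simp add: linear_cmul[OF l(2)])
    then show "fder (\<lambda>z. G z (c *\<^sub>R u) v) x h = c *\<^sub>R fder (\<lambda>z. G z u v) x h"
      using scale[OF d'] by simp
  qed
qed

text \<open>
  The product rule for a field of bilinear maps that is evaluated along a map \<open>\<phi>\<close>, on two fields along \<open>\<phi>\<close>. It is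
  applied to metrics, to Christoffel maps and, with a dummy scalar argument, to fields of linear maps.
\<close>

lemma has_derivative_bilinear_field:
  fixes G :: "'e::euclidean_space \<Rightarrow> 'a::euclidean_space \<Rightarrow> 'b::euclidean_space \<Rightarrow> 'c::real_normed_vector"
    and \<phi> :: "'k::euclidean_space \<Rightarrow> 'e"
  assumes S: "open S" "x \<in> S" and O: "open O'" "\<phi> ` S \<subseteq> O'"
    and bil: "\<And>z. z \<in> O' \<Longrightarrow> bilinear (G z)"
    and d: "\<And>u v. (\<lambda>z. G z u v) differentiable (at (\<phi> x))"
    and \<phi>: "(\<phi> has_derivative \<phi>') (at x)"
    and X: "(X has_derivative X') (at x)" and Y: "(Y has_derivative Y') (at x)"
  shows "((\<lambda>y. G (\<phi> y) (X y) (Y y)) has_derivative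
    (\<lambda>h. fder (\<lambda>z. G z (X x) (Y x)) (\<phi> x) (\<phi>' h) + G (\<phi> x) (X' h) (Y x) + G (\<phi> x) (X x) (Y' h))) (at x)"
proof -
  let ?D = "\<lambda>u v h. fder (\<lambda>z. G z u v) (\<phi> x) (\<phi>' h)"
  have x: "\<phi> x \<in> O'" using S O by blast
  have dG: "((\<lambda>y. G (\<phi> y) u v) has_derivative ?D u v) (at x)" for u v
    using diff_chain_at[OF \<phi> d[unfolded frechet_derivative_works]] by (simp add: o_def)
  let ?F = "\<lambda>y. \<Sum>i\<in>Basis. (X y \<bullet> i) *\<^sub>R (\<Sum>j\<in>Basis. (Y y \<bullet> j) *\<^sub>R G (\<phi> y) i j)"
  let ?F' = "\<lambda>h. \<Sum>i\<in>Basis. (X x \<bullet> i) *\<^sub>R (\<Sum>j\<in>Basis. (Y x \<bullet> j) *\<^sub>R ?D i j h + (Y' h \<bullet> j) *\<^sub>R G (\<phi> x) i j)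
      + (X' h \<bullet> i) *\<^sub>R (\<Sum>j\<in>Basis. (Y x \<bullet> j) *\<^sub>R G (\<phi> x) i j)"
  have F: "(?F has_derivative ?F') (at x)"
    by (intro has_derivative_sum has_derivative_scaleR has_derivative_inner_left X Y dG)
  have FG: "?F y = G (\<phi> y) (X y) (Y y)" if "y \<in> S" for y
  proof -
    have "\<phi> y \<in> O'" using O(2) that by blast
    then show ?thesis using bilinear_sum_Basis[OF bil, of "\<phi> y" "X y" "Y y"] by simp
  qed
  have F': "?F' h = ?D (X x) (Y x) h + G (\<phi> x) (X' h) (Y x) + G (\<phi> x) (X x) (Y' h)" for h
    using bilinear_sum_Basis[OF bilinear_fder[OF O(1) x bil d, where h="\<phi>' h"], of "X x" "Y x"]
    unfolding bilinear_sum_Basis[OF bil[OF x], of "X' h"] bilinear_sum_Basis[OF bil[OF x], of "X x"]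
    by (simp add: sum.distrib scaleR_add_right)
  show ?thesis
    using has_derivative_transform_within_open[OF F S FG] unfolding F' .
qed

definition local_metric :: "('e::euclidean_space \<Rightarrow> 'e \<Rightarrow> 'e \<Rightarrow> real) \<Rightarrow> 'e set \<Rightarrow> bool" where
  "local_metric G U \<longleftrightarrow>
     open U \<and> (\<forall>x\<in>U. inner_form (G x)) \<and> (\<forall>u v. smooth_on (\<lambda>x. G x u v) U)"

lemma local_metricD:
  assumes "local_metric G U"
  shows "open U" "x \<in> U \<Longrightarrow> inner_form (G x)" "smooth_on (\<lambda>x. G x u v) U"
    "x \<in> U \<Longrightarrow> bilinear (G x)" "x \<in> U \<Longrightarrow> (\<lambda>x. G x u v) differentiable (at x)"
  using assms smooth_on_differentiable unfolding local_metric_def inner_form_def by blast+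

text \<open>
  The right-hand side of the Koszul formula for coordinate fields: the Christoffel symbols of the first kind.
\<close>

definition koszul ::
  "('e::euclidean_space \<Rightarrow> 'e \<Rightarrow> 'e \<Rightarrow> real) \<Rightarrow> 'e \<Rightarrow> 'e \<Rightarrow> 'e \<Rightarrow> 'e \<Rightarrow> real" where
  "koszul G x u v w =
     (fder (\<lambda>y. G y v w) x u + fder (\<lambda>y. G y u w) x v - fder (\<lambda>y. G y u v) x w) / 2"

text \<open>
  The condition inside the definite description that defines \<open>christoffel\<close>.
\<close>

definition is_christoffel where
  "is_christoffel G x \<Gamma> \<longleftrightarrow> bilinear \<Gamma> \<and> (\<forall>u v. \<Gamma> u v = \<Gamma> v u) \<and>
     (\<forall>u v w. fder (\<lambda>y. G y v w) x u = G x (\<Gamma> u v) w + G x v (\<Gamma> u w))"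

lemma fder_metric_sym:
  assumes "local_metric G U" "x \<in> U"
  shows "fder (\<lambda>y. G y u v) x = fder (\<lambda>y. G y v u) x"
  by (rule fder_cong_open[OF local_metricD(1)[OF assms(1)] assms(2)])
    (use inner_form_sym local_metricD(2)[OF assms(1)] in blast)

text \<open>
  In the sum of the three permuted compatibility equations, symmetry cancels all but one term. So the connection
  is determined by the metric.
\<close>

lemma is_christoffel_koszul:
  assumes "local_metric G U" "x \<in> U" "is_christoffel G x \<Gamma>"
  shows "G x (\<Gamma> u v) w = koszul G x u v w"
proof -
  have b: "inner_form (G x)" using local_metricD(2) assms by blast
  have c: "fder (\<lambda>y. G y v w) x u = G x (\<Gamma> u v) w + G x v (\<Gamma> u w)" and s: "\<Gamma> u v = \<Gamma> v u" for u v w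
    using assms(3) unfolding is_christoffel_def by blast+
  have "fder (\<lambda>y. G y v w) x u + fder (\<lambda>y. G y u w) x v - fder (\<lambda>y. G y u v) x w =
      G x (\<Gamma> u v) w + G x v (\<Gamma> u w) + (G x (\<Gamma> v u) w + G x u (\<Gamma> v w))
        - (G x (\<Gamma> w u) v + G x u (\<Gamma> w v))"
    unfolding c ..
  also have "\<dots> = 2 * G x (\<Gamma> u v) w"
    using s[of v u] s[of w u] s[of w v] inner_form_sym[OF b, of v "\<Gamma> u w"] by simp
  finally show ?thesis unfolding koszul_def by simp
qed

lemma exists_christoffel:
  assumes G: "local_metric G U" and x: "x \<in> U"
  shows "\<exists>\<Gamma>. is_christoffel G x \<Gamma>"
proof -
  have b: "inner_form (G x)" using local_metricD(2) assms by blast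
  have lin3: "linear (\<lambda>h. fder (\<lambda>y. G y u v) x h)" for u v
    using linear_fder[OF local_metricD(5)[OF G x]] .
  have bil: "bilinear (\<lambda>u v. fder (\<lambda>y. G y u v) x h)" for h
    by (rule bilinear_fder[OF local_metricD(1)[OF G] x]) (use local_metricD(4,5)[OF G] x in auto)
  have lin1: "linear (\<lambda>u. fder (\<lambda>y. G y u v) x h)" and lin2: "linear (\<lambda>v. fder (\<lambda>y. G y u v) x h)" for u v h
    using bil unfolding bilinear_def by auto
  note adds = linear_add[OF lin1] linear_add[OF lin2] linear_add[OF lin3]
    linear_cmul[OF lin1] linear_cmul[OF lin2] linear_cmul[OF lin3]
  have klin: "linear (\<lambda>u. koszul G x u v w)" "linear (\<lambda>v. koszul G x u v w)" "linear (koszul G x u v)" for u v w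
    unfolding koszul_def by (auto intro!: linearI simp: adds field_simps)
  have "\<forall>u v. \<exists>z. \<forall>w. G x z w = koszul G x u v w"
    using inner_form_representation[OF b klin(3)] by blast
  then obtain \<Gamma> where \<Gamma>: "\<And>u v w. G x (\<Gamma> u v) w = koszul G x u v w" by metis
  have "bilinear \<Gamma>"
    unfolding bilinear_def
    by (intro conjI allI linearI; rule inner_form_unique[OF b])
      (simp_all add: inner_form_simps[OF b] \<Gamma> linear_add[OF klin(1)] linear_add[OF klin(2)]
        linear_cmul[OF klin(1)] linear_cmul[OF klin(2)])
  moreover have "\<Gamma> u v = \<Gamma> v u" for u v
    by (rule inner_form_unique[OF b]) (simp add: \<Gamma> koszul_def fder_metric_sym[OF G x, of u v])
  moreover have "fder (\<lambda>y. G y v w) x u = G x (\<Gamma> u v) w + G x v (\<Gamma> u w)" for u v w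
  proof -
    have "G x (\<Gamma> u v) w + G x (\<Gamma> u w) v = fder (\<lambda>y. G y v w) x u"
      unfolding \<Gamma> koszul_def fder_metric_sym[OF G x, of w v] by (simp add: field_simps)
    then show ?thesis using inner_form_sym[OF b] by metis
  qed
  ultimately show ?thesis unfolding is_christoffel_def by blast
qed

lemma is_christoffel_christoffel:
  assumes G: "local_metric G U" and x: "x \<in> U"
  shows "is_christoffel G x (christoffel G x)"
proof -
  obtain \<Gamma> where \<Gamma>: "is_christoffel G x \<Gamma>" using exists_christoffel[OF assms] by blast
  have "\<Gamma>' = \<Gamma>" if "is_christoffel G x \<Gamma>'" for \<Gamma>'
    using inner_form_unique[OF local_metricD(2)[OF G x]]
      is_christoffel_koszul[OF G x \<Gamma>] is_christoffel_koszul[OF G x that] by (intro ext) metis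
  with \<Gamma> have "is_christoffel G x (THE \<Gamma>. is_christoffel G x \<Gamma>)" by (rule theI)
  then show ?thesis unfolding christoffel_def is_christoffel_def .
qed

lemma christoffel_metric:
  assumes G: "local_metric G U" and x: "x \<in> U"
  shows "bilinear (christoffel G x)" "christoffel G x u v = christoffel G x v u"
    "fder (\<lambda>y. G y v w) x u = G x (christoffel G x u v) w + G x v (christoffel G x u w)"
    "G x (christoffel G x u v) w = koszul G x u v w"
  using is_christoffel_christoffel[OF assms] is_christoffel_koszul[OF assms] 
  unfolding is_christoffel_def by blast+

lemma smooth_on_koszul:
  assumes G: "local_metric G U"
  shows "smooth_on (\<lambda>x. koszul G x u v w) U"
proof -
  have s: "smooth_on (\<lambda>x. fder (\<lambda>y. G y a b) x c) U" for a b c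
    using smooth_on_fder local_metricD(3)[OF G] by blast
  note U = local_metricD(1)[OF G]
  have "smooth_on (\<lambda>x. (1/2) *\<^sub>R (fder (\<lambda>y. G y v w) x u + fder (\<lambda>y. G y u w) x v
      + (-1) *\<^sub>R fder (\<lambda>y. G y u v) x w)) U"
    by (intro smooth_on_bounded_linear[OF U bounded_linear_scaleR_right] smooth_on_add[OF U] s)
  then show ?thesis unfolding koszul_def by simp
qed

text \<open>
  The Koszul formula is a linear system for \<open>christoffel G x u v\<close> whose coefficients are those of the metric.
\<close>

lemma smooth_on_christoffel:
  assumes G: "local_metric G U"
  shows "smooth_on (\<lambda>x. christoffel G x u v) U"
proof (rule smooth_on_linear_solution[where A="\<lambda>x z. \<Sum>i\<in>Basis. G x z i *\<^sub>R i"
      and b="\<lambda>x. \<Sum>i\<in>Basis. koszul G x u v i *\<^sub>R i"])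
  note U = local_metricD(1)[OF G]
  show "open U" by (rule U)
  show "smooth_on (\<lambda>x. \<Sum>i\<in>Basis. G x z i *\<^sub>R i) U" for z
    by (intro smooth_on_sum U smooth_on_bounded_linear[OF U bounded_linear_scaleR_left] local_metricD(3)[OF G])
  show "smooth_on (\<lambda>x. \<Sum>i\<in>Basis. koszul G x u v i *\<^sub>R i) U"
    by (intro smooth_on_sum U smooth_on_bounded_linear[OF U bounded_linear_scaleR_left] smooth_on_koszul[OF G])
  fix x assume x: "x \<in> U"
  note b = local_metricD(2)[OF G x]
  show lin: "linear (\<lambda>z. \<Sum>i\<in>Basis. G x z i *\<^sub>R i)"
    by (rule linearI) (simp_all add: inner_form_simps[OF b] scaleR_add_left sum.distrib scaleR_sum_right)
  show "inj (\<lambda>z. \<Sum>i\<in>Basis. G x z i *\<^sub>R i)"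
    unfolding linear_injective_0[OF lin]
  proof (intro allI impI)
    fix z assume z: "(\<Sum>i\<in>Basis. G x z i *\<^sub>R i) = 0"
    have "G x z j = 0" if "j \<in> Basis" for j
      using arg_cong[OF z, of "\<lambda>y. y \<bullet> j"] that by simp
    then have "G x z z = 0"
      using linear_sum_Basis[OF inner_form_bilinear(1)[OF b], of z z] by simp
    then show "z = 0" using inner_form_eq_0[OF b] by blast
  qed
  show "(\<Sum>i\<in>Basis. G x (christoffel G x u v) i *\<^sub>R i) = (\<Sum>i\<in>Basis. koszul G x u v i *\<^sub>R i)"
    unfolding christoffel_metric(4)[OF G x] ..
qed

lemma curvature_field_constant:
  assumes G: "local_metric G U" and x: "x \<in> U"
  shows "curvature_field G (\<lambda>_. u) (\<lambda>_. v) (\<lambda>_. w) x =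
    fder (\<lambda>y. christoffel G y v w) x u + christoffel G x u (christoffel G x v w)
    - (fder (\<lambda>y. christoffel G y u w) x v + christoffel G x v (christoffel G x u w))"
proof -
  have "linear (\<lambda>a. christoffel G x a w)" using christoffel_metric(1)[OF G x] by (simp add: bilinear_def)
  then have "christoffel G x 0 w = 0" by (rule linear_0)
  then show ?thesis
    by (simp add: curvature_field_def nabla_def[abs_def] lie_bracket_def frechet_derivative_const)
qed

section \<open>The Gauss equation\<close>

text \<open>
  The covariant derivative, along \<open>\<phi>\<close> and in the direction \<open>h\<close>, of a vector field \<open>X\<close> along \<open>\<phi>\<close>.
\<close>

definition cov_along ::
  "('e::euclidean_space \<Rightarrow> 'e \<Rightarrow> 'e \<Rightarrow> real) \<Rightarrow> ('k::euclidean_space \<Rightarrow> 'e) \<Rightarrow> ('k \<Rightarrow> 'e) \<Rightarrow> 'k \<Rightarrow> 'k \<Rightarrow> 'e" where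
  "cov_along G \<phi> X x h = fder X x h + christoffel G (\<phi> x) (fder \<phi> x h) (X x)"

text \<open>
  The covariant derivative in the direction \<open>v\<close> of the image of the constant field \<open>w\<close>. Its part normal to the image
  of \<open>\<phi>\<close> is the second fundamental form; its tangential part is the Christoffel map of the pulled back metric.
\<close>

abbreviation hessian_along where
  "hessian_along G \<phi> v w x \<equiv> cov_along G \<phi> (\<lambda>y. fder \<phi> y w) x v"

locale map_into_metric =
  fixes G :: "'e::euclidean_space \<Rightarrow> 'e \<Rightarrow> 'e \<Rightarrow> real" and U :: "'e set"
    and \<phi> :: "'k::euclidean_space \<Rightarrow> 'e" and S :: "'k set"
  assumes G: "local_metric G U" and S: "open S" and \<phi>: "smooth_on \<phi> S" and \<phi>S: "\<phi> ` S \<subseteq> U"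
begin

lemma \<phi>U: "y \<in> S \<Longrightarrow> \<phi> y \<in> U"
  using \<phi>S by blast

lemma deriv_\<phi>: "y \<in> S \<Longrightarrow> (\<phi> has_derivative fder \<phi> y) (at y)"
  using smooth_on_has_derivative[OF \<phi> S] .

text \<open>
The connection of \<open>G\<close> is metric, also for vector fields along a map.
\<close>

lemma metric_along:
  assumes x: "x \<in> S" and X: "(X has_derivative fder X x) (at x)" and Y: "(Y has_derivative fder Y x) (at x)"
  shows "((\<lambda>y. G (\<phi> y) (X y) (Y y)) has_derivative
    (\<lambda>h. G (\<phi> x) (cov_along G \<phi> X x h) (Y x) + G (\<phi> x) (X x) (cov_along G \<phi> Y x h))) (at x)"
proof -
  note b = local_metricD(2)[OF G \<phi>U[OF x]]
  have "((\<lambda>y. G (\<phi> y) (X y) (Y y)) has_derivative (\<lambda>h. fder (\<lambda>z. G z (X x) (Y x)) (\<phi> x) (fder \<phi> x h)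
      + G (\<phi> x) (fder X x h) (Y x) + G (\<phi> x) (X x) (fder Y x h))) (at x)"
    by (rule has_derivative_bilinear_field[OF S x local_metricD(1)[OF G] \<phi>S])
      (use local_metricD(4,5)[OF G] \<phi>U deriv_\<phi> x X Y in auto)
  then show ?thesis
    unfolding christoffel_metric(3)[OF G \<phi>U[OF x]] cov_along_def
    by (simp add: inner_form_simps[OF b] algebra_simps)
qed

lemma smooth_christoffel_along:
  "smooth_on (\<lambda>y. christoffel G (\<phi> y) (fder \<phi> y v) (fder \<phi> y w)) S"
proof -
  have eq: "christoffel G (\<phi> y) (fder \<phi> y v) (fder \<phi> y w) =
      (\<Sum>i\<in>Basis. (fder \<phi> y v \<bullet> i) *\<^sub>R (\<Sum>j\<in>Basis. (fder \<phi> y w \<bullet> j) *\<^sub>R christoffel G (\<phi> y) i j))"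
    if "y \<in> S" for y
    using bilinear_sum_Basis[OF christoffel_metric(1)[OF G \<phi>U[OF that]]] .
  have sum: "smooth_on (\<lambda>y. (\<Sum>i\<in>Basis. (fder \<phi> y v \<bullet> i) *\<^sub>R
      (\<Sum>j\<in>Basis. (fder \<phi> y w \<bullet> j) *\<^sub>R christoffel G (\<phi> y) i j))) S"
    by (intro smooth_on_sum smooth_on_scaleR smooth_on_bounded_linear[OF S bounded_linear_inner_left]
        smooth_on_fder \<phi> S smooth_on_compose[OF S local_metricD(1)[OF G] \<phi>S smooth_on_christoffel[OF G]])
  show ?thesis by (rule smooth_on_cong[OF S _ sum]) (rule eq[symmetric])
qed

lemma smooth_hessian: "smooth_on (hessian_along G \<phi> v w) S"
  unfolding cov_along_def by (intro smooth_on_add S smooth_on_fder \<phi> smooth_christoffel_along)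

lemma deriv_hessian: "y \<in> S \<Longrightarrow> (hessian_along G \<phi> v w has_derivative fder (hessian_along G \<phi> v w) y) (at y)"
  using smooth_on_has_derivative[OF smooth_hessian S] .

lemma hessian_sym:
  assumes "x \<in> S"
  shows "hessian_along G \<phi> v w x = hessian_along G \<phi> w v x"
  unfolding cov_along_def
  using second_derivative_symmetric[OF S assms \<phi>] christoffel_metric(2)[OF G \<phi>U[OF assms]] by metis

text \<open>
  Covariant derivatives along a map commute up to the curvature of the target. In coordinates the second and
  third derivatives of \<open>\<phi>\<close> cancel by Schwarz's theorem, and the remaining terms are the curvature of constant fields.
\<close>

lemma hessian_commutator:
  assumes x: "x \<in> S"
  shows "cov_along G \<phi> (hessian_along G \<phi> v w) x u - cov_along G \<phi> (hessian_along G \<phi> u w) x v =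
    curvature_field G (\<lambda>_. fder \<phi> x u) (\<lambda>_. fder \<phi> x v) (\<lambda>_. fder \<phi> x w) (\<phi> x)"
proof -
  let ?\<Gamma> = "christoffel G"
  let ?e = "\<lambda>u. fder \<phi> x u" and ?H = "\<lambda>v w. fder (\<lambda>y. fder \<phi> y w) x v"
  have lin: "linear (?\<Gamma> (\<phi> x) a)" "linear (\<lambda>a. ?\<Gamma> (\<phi> x) a b)" for a b
    using christoffel_metric(1)[OF G \<phi>U[OF x]] by (auto simp: bilinear_def)
  have d\<phi>: "((\<lambda>y. fder \<phi> y w) has_derivative fder (\<lambda>y. fder \<phi> y w) x) (at x)" for w
    using smooth_on_has_derivative[OF smooth_on_fder[OF \<phi>] S x] .
  have d\<Gamma>: "((\<lambda>y. ?\<Gamma> (\<phi> y) (fder \<phi> y v) (fder \<phi> y w)) has_derivative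
      (\<lambda>h. fder (\<lambda>z. ?\<Gamma> z (?e v) (?e w)) (\<phi> x) (?e h) + ?\<Gamma> (\<phi> x) (?H h v) (?e w) + ?\<Gamma> (\<phi> x) (?e v) (?H h w)))
      (at x)" for v w
    by (rule has_derivative_bilinear_field[OF S x local_metricD(1)[OF G] \<phi>S])
      (use christoffel_metric(1)[OF G] smooth_on_differentiable[OF smooth_on_christoffel[OF G] local_metricD(1)[OF G]]
        \<phi>U deriv_\<phi> x d\<phi> in auto)
  have dd\<phi>: "((\<lambda>y. fder (\<lambda>y. fder \<phi> y w) y v) has_derivative fder (\<lambda>y. fder (\<lambda>y. fder \<phi> y w) y v) x) (at x)" for v w
    using smooth_on_has_derivative[OF smooth_on_fder[OF smooth_on_fder[OF \<phi>]] S x] .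
  have third: "fder (\<lambda>y. fder (\<lambda>y. fder \<phi> y w) y v) x u = fder (\<lambda>y. fder (\<lambda>y. fder \<phi> y w) y u) x v"
    using second_derivative_symmetric[OF S x smooth_on_fder[OF \<phi>]] .
  have Hsym: "?H a b = ?H b a" for a b using second_derivative_symmetric[OF S x \<phi>] by metis
  have B: "cov_along G \<phi> (hessian_along G \<phi> v w) x u =
      fder (\<lambda>y. fder (\<lambda>y. fder \<phi> y w) y v) x u
      + (fder (\<lambda>z. ?\<Gamma> z (?e v) (?e w)) (\<phi> x) (?e u) + ?\<Gamma> (\<phi> x) (?H u v) (?e w) + ?\<Gamma> (\<phi> x) (?e v) (?H u w))
      + (?\<Gamma> (\<phi> x) (?e u) (?H v w) + ?\<Gamma> (\<phi> x) (?e u) (?\<Gamma> (\<phi> x) (?e v) (?e w)))" for u v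
  proof -
    have 1: "fder (hessian_along G \<phi> v w) x u = fder (\<lambda>y. fder (\<lambda>y. fder \<phi> y w) y v) x u
      + (fder (\<lambda>z. ?\<Gamma> z (?e v) (?e w)) (\<phi> x) (?e u) + ?\<Gamma> (\<phi> x) (?H u v) (?e w) + ?\<Gamma> (\<phi> x) (?e v) (?H u w))"
      unfolding cov_along_def by (simp only: fder_eq[OF has_derivative_add[OF dd\<phi> d\<Gamma>]])
    have 2: "?\<Gamma> (\<phi> x) (?e u) (hessian_along G \<phi> v w x) =
        ?\<Gamma> (\<phi> x) (?e u) (?H v w) + ?\<Gamma> (\<phi> x) (?e u) (?\<Gamma> (\<phi> x) (?e v) (?e w))"
      unfolding cov_along_def linear_add[OF lin(1)] ..
    show ?thesis unfolding cov_along_def[of G \<phi> "hessian_along G \<phi> v w"] 1 2 ..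
  qed
  show ?thesis
    unfolding B curvature_field_constant[OF G \<phi>U[OF x]]
    using third Hsym[of u v] by (simp add: algebra_simps)
qed

end

locale isometric_map = map_into_metric G U \<phi> S
  for G :: "'e::euclidean_space \<Rightarrow> 'e \<Rightarrow> 'e \<Rightarrow> real" and U :: "'e set"
    and \<phi> :: "'k::euclidean_space \<Rightarrow> 'e" and S :: "'k set" +
  fixes G' :: "'k \<Rightarrow> 'k \<Rightarrow> 'k \<Rightarrow> real"
  assumes G': "local_metric G' S"
    and pullback: "y \<in> S \<Longrightarrow> G' y u v = G (\<phi> y) (fder \<phi> y u) (fder \<phi> y v)"
begin

lemma deriv_pullback:
  assumes x: "x \<in> S"
  shows "fder (\<lambda>y. G' y v w) x u =
    G (\<phi> x) (hessian_along G \<phi> u v x) (fder \<phi> x w) + G (\<phi> x) (fder \<phi> x v) (hessian_along G \<phi> u w x)"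
proof -
  have d\<phi>: "((\<lambda>y. fder \<phi> y w) has_derivative fder (\<lambda>y. fder \<phi> y w) x) (at x)" for w
    using smooth_on_has_derivative[OF smooth_on_fder[OF \<phi>] S x] .
  have "fder (\<lambda>y. G' y v w) x = fder (\<lambda>y. G (\<phi> y) (fder \<phi> y v) (fder \<phi> y w)) x"
    by (rule fder_cong_open[OF S x pullback])
  then show ?thesis by (simp only: fder_eq[OF metric_along[OF x d\<phi> d\<phi>]])
qed

text \<open>
  The Hessian pairs with tangent vectors as the Koszul expression of the pulled back metric does: by
  \<open>deriv_pullback\<close>, derivatives of the pulled back metric are pairings with Hessians.
\<close>

lemma hessian_tangential:
  assumes x: "x \<in> S"
  shows "G (\<phi> x) (hessian_along G \<phi> u v x) (fder \<phi> x w) = G' x (christoffel G' x u v) w"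
proof -
  note b = local_metricD(2)[OF G \<phi>U[OF x]]
  have "2 * koszul G' x u v w = 2 * G (\<phi> x) (hessian_along G \<phi> u v x) (fder \<phi> x w)"
    unfolding koszul_def deriv_pullback[OF x]
    using hessian_sym[OF x, of u v] hessian_sym[OF x, of u w] hessian_sym[OF x, of v w]
      inner_form_sym[OF b, of "fder \<phi> x v" "hessian_along G \<phi> w u x"]
    by (simp add: field_simps)
  then show ?thesis unfolding christoffel_metric(4)[OF G' x] by simp
qed

definition second_form where
  "second_form x u v = hessian_along G \<phi> u v x - fder \<phi> x (christoffel G' x u v)"

lemma second_form_normal:
  assumes x: "x \<in> S"
  shows "G (\<phi> x) (second_form x u v) (fder \<phi> x w) = 0"
  unfolding second_form_def
  by (simp add: inner_form_simps[OF local_metricD(2)[OF G \<phi>U[OF x]]] hessian_tangential[OF x] pullback[OF x])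

lemma second_form_sym:
  assumes x: "x \<in> S"
  shows "second_form x u v = second_form x v u"
  unfolding second_form_def hessian_sym[OF x, of u v] christoffel_metric(2)[OF G' x, of u v] ..

lemma inner_hessian:
  assumes x: "x \<in> S"
  shows "G (\<phi> x) (hessian_along G \<phi> a b x) (hessian_along G \<phi> c d x) =
    G (\<phi> x) (second_form x a b) (second_form x c d) + G' x (christoffel G' x a b) (christoffel G' x c d)"
proof -
  note b = local_metricD(2)[OF G \<phi>U[OF x]]
  have h: "hessian_along G \<phi> a b x = second_form x a b + fder \<phi> x (christoffel G' x a b)" for a b
    by (simp add: second_form_def)
  show ?thesis
    unfolding h inner_form_simps(1,2)[OF b] pullback[OF x]
    using second_form_normal[OF x] inner_form_sym[OF b, of "fder \<phi> x _" "second_form x c d"] by simp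
qed

text \<open>
  Both sides are the derivative, in the direction \<open>u\<close>, of the Christoffel symbol of the first kind of \<open>G'\<close> with
  arguments \<open>v\<close>, \<open>w\<close>, \<open>z\<close>. The left-hand side computes it intrinsically; the right-hand side uses \<open>hessian_tangential\<close>
  and computes it in the ambient space.
\<close>

lemma deriv_first_kind:
  assumes x: "x \<in> S"
  shows "G' x (fder (\<lambda>y. christoffel G' y v w) x u + christoffel G' x u (christoffel G' x v w)) z
      + G' x (christoffel G' x v w) (christoffel G' x u z) =
    G (\<phi> x) (cov_along G \<phi> (hessian_along G \<phi> v w) x u) (fder \<phi> x z)
      + G (\<phi> x) (hessian_along G \<phi> v w x) (hessian_along G \<phi> u z x)"
proof -
  have d\<phi>: "((\<lambda>y. fder \<phi> y z) has_derivative fder (\<lambda>y. fder \<phi> y z) x) (at x)"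
    using smooth_on_has_derivative[OF smooth_on_fder[OF \<phi>] S x] .
  have d\<Gamma>: "((\<lambda>y. christoffel G' y v w) has_derivative fder (\<lambda>y. christoffel G' y v w) x) (at x)"
    using smooth_on_has_derivative[OF smooth_on_christoffel[OF G'] S x] .
  have id: "smooth_on (\<lambda>y::'k. y) S"
    unfolding smooth_on_def
  proof
    show "Ck_on k (\<lambda>y::'k. y) S" for k
      by (cases k) (auto intro!: Ck_on_SucI[OF S, where f'="\<lambda>_ h. h"] Ck_on_const S simp del: Ck_on.simps(2))
  qed
  \<comment> \<open>The intrinsic computation is the one along the identity map.\<close>
  interpret self: map_into_metric G' S "\<lambda>y. y" S
    by unfold_locales (use G' S id in auto)
  have id': "fder (\<lambda>y::'k. y) x = (\<lambda>h. h)" by (rule fder_eq) auto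
  have const: "fder (\<lambda>_. z) x = (\<lambda>_. 0)" by (rule fder_eq) auto
  have "fder (\<lambda>y. G' y (christoffel G' y v w) z) x u =
      G' x (cov_along G' (\<lambda>y. y) (\<lambda>y. christoffel G' y v w) x u) z
      + G' x (christoffel G' x v w) (cov_along G' (\<lambda>y. y) (\<lambda>_. z) x u)"
    by (rule fun_cong[OF fder_eq], rule self.metric_along[OF x d\<Gamma>]) (simp add: const)
  moreover have "fder (\<lambda>y. G' y (christoffel G' y v w) z) x =
      fder (\<lambda>y. G (\<phi> y) (hessian_along G \<phi> v w y) (fder \<phi> y z)) x"
    by (rule fder_cong_open[OF S x hessian_tangential[symmetric]])
  moreover have "fder (\<lambda>y. G (\<phi> y) (hessian_along G \<phi> v w y) (fder \<phi> y z)) x u =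
      G (\<phi> x) (cov_along G \<phi> (hessian_along G \<phi> v w) x u) (fder \<phi> x z)
      + G (\<phi> x) (hessian_along G \<phi> v w x) (hessian_along G \<phi> u z x)"
    by (rule fun_cong[OF fder_eq], rule metric_along[OF x deriv_hessian[OF x] d\<phi>])
  ultimately show ?thesis by (simp add: cov_along_def[of G'] id' const)
qed

text \<open>
  Antisymmetrize \<open>deriv_first_kind\<close> in \<open>u\<close> and \<open>v\<close>: the second covariant derivatives give the ambient curvature, and by
  orthogonality the products of Hessians exceed those of the intrinsic Christoffel maps by the products of second
  fundamental forms.
\<close>

lemma gauss_equation:
  assumes x: "x \<in> S"
  shows "G' x (curvature_field G' (\<lambda>_. u) (\<lambda>_. v) (\<lambda>_. w) x) z =
    G (\<phi> x) (curvature_field G (\<lambda>_. fder \<phi> x u) (\<lambda>_. fder \<phi> x v) (\<lambda>_. fder \<phi> x w) (\<phi> x)) (fder \<phi> x z)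
    + G (\<phi> x) (second_form x v w) (second_form x u z) - G (\<phi> x) (second_form x u w) (second_form x v z)"
  unfolding curvature_field_constant[OF G' x] hessian_commutator[OF x, symmetric]
    inner_form_simps(3)[OF local_metricD(2)[OF G \<phi>U[OF x]]] inner_form_simps(3)[OF local_metricD(2)[OF G' x]]
  using deriv_first_kind[OF x, of v w u z] deriv_first_kind[OF x, of u w v z]
    inner_hessian[OF x, where a=v and b=w and c=u and d=z]
    inner_hessian[OF x, where a=u and b=w and c=v and d=z]
  by linarith

end

section \<open>Charts\<close>

lemma is_chart_facts:
  assumes "is_chart X c"
  shows "openin X (fst c)" "fst c \<subseteq> topspace X" "open (snd c ` fst c)" "inj_on (snd c) (fst c)"
proof -
  show 1: "openin X (fst c)" and "open (snd c ` fst c)" using assms unfolding is_chart_def by auto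
  show 2: "fst c \<subseteq> topspace X" using openin_subset[OF 1] .
  have "inj_on (snd c) (topspace (subtopology X (fst c)))"
    using assms unfolding is_chart_def homeomorphic_eq_everything_map by blast
  then show "inj_on (snd c) (fst c)" using 2 by (simp add: Int_absorb1)
qed

lemma param_coord: "is_chart X c \<Longrightarrow> q \<in> fst c \<Longrightarrow> param c (snd c q) = q"
  unfolding param_def using is_chart_facts(4) inv_into_f_f by metis

lemma param_in: "x \<in> snd c ` fst c \<Longrightarrow> param c x \<in> fst c"
  unfolding param_def by (rule inv_into_into)

lemma coord_param: "x \<in> snd c ` fst c \<Longrightarrow> snd c (param c x) = x"
  unfolding param_def by (rule f_inv_into_f)

lemma param_in_image:
  assumes "is_chart X c" "x \<in> snd c ` (fst c \<inter> T)"
  shows "param c x \<in> fst c" "param c x \<in> T" "snd c (param c x) = x"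
  using assms param_coord by fastforce+

lemma open_chart_image:
  assumes c: "is_chart X c" and T: "openin X T"
  shows "open (snd c ` (fst c \<inter> T))"
proof -
  have "homeomorphic_map (subtopology X (fst c)) (top_of_set (snd c ` fst c)) (snd c)"
    using c unfolding is_chart_def by blast
  then have "open_map (subtopology X (fst c)) (top_of_set (snd c ` fst c)) (snd c)"
    unfolding homeomorphic_eq_everything_map by blast
  moreover have "openin (subtopology X (fst c)) (fst c \<inter> T)"
    using T openin_subtopology_Int2 by blast
  ultimately have "openin (top_of_set (snd c ` fst c)) (snd c ` (fst c \<inter> T))"
    unfolding open_map_def by blast
  then show ?thesis using is_chart_facts(3)[OF c] openin_open_trans by blast
qed

lemma openin_chart_preimage:
  assumes c: "is_chart X c" and W: "open W"
  shows "openin X {q \<in> fst c. snd c q \<in> W}"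
proof -
  have "homeomorphic_map (subtopology X (fst c)) (top_of_set (snd c ` fst c)) (snd c)"
    using c unfolding is_chart_def by blast
  then have cont: "continuous_map (subtopology X (fst c)) (top_of_set (snd c ` fst c)) (snd c)"
    unfolding homeomorphic_eq_everything_map by blast
  have "openin (subtopology X (fst c))
      {q \<in> topspace (subtopology X (fst c)). snd c q \<in> snd c ` fst c \<inter> W}"
    by (rule openin_continuous_map_preimage[OF cont]) (use W in auto)
  moreover have "{q \<in> topspace (subtopology X (fst c)). snd c q \<in> snd c ` fst c \<inter> W} = {q \<in> fst c. snd c q \<in> W}"
    using is_chart_facts(2)[OF c] by auto
  ultimately show ?thesis using is_chart_facts(1)[OF c] openin_trans_full by metis
qed

lemma inner_form_pullback:
  assumes b: "inner_form b" and L: "linear L" "inj L"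
  shows "inner_form (\<lambda>u v. b (L u) (L v))"
proof -
  note s = inner_form_simps[OF b] linear_add[OF L(1)] linear_cmul[OF L(1)]
  have "bilinear (\<lambda>u v. b (L u) (L v))"
    unfolding bilinear_def by (auto intro!: linearI simp: s)
  moreover have "0 < b (L u) (L u)" if "u \<noteq> 0" for u
  proof -
    have "L u \<noteq> 0" using that L linear_injective_0 by blast
    then show ?thesis using inner_form_pos[OF b] by blast
  qed
  ultimately show ?thesis unfolding inner_form_def using inner_form_sym[OF b] by blast
qed

locale manifold =
  fixes M :: "('a, 'e::euclidean_space, 'z) manifold_scheme"
  assumes M: "smooth_manifold M"
begin

lemma chart: "c \<in> atlas M \<Longrightarrow> is_chart (mtop M) c"
  using M unfolding smooth_manifold_def by blast

lemma chart_at: "p \<in> points M \<Longrightarrow> chart_at M p \<in> atlas M" "p \<in> points M \<Longrightarrow> p \<in> fst (chart_at M p)"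
proof -
  assume "p \<in> points M"
  then have "\<exists>c. c \<in> atlas M \<and> p \<in> fst c" using M unfolding smooth_manifold_def by blast
  from someI_ex[OF this] show "chart_at M p \<in> atlas M" "p \<in> fst (chart_at M p)"
    unfolding chart_at_def by auto
qed

lemma chart_points: "c \<in> atlas M \<Longrightarrow> q \<in> fst c \<Longrightarrow> q \<in> points M"
  using is_chart_facts(2) chart by blast

lemma open_overlap:
  assumes "c \<in> atlas M" "d \<in> atlas M"
  shows "open (snd c ` (fst c \<inter> fst d))"
  using open_chart_image[OF chart is_chart_facts(1)[OF chart]] assms by blast

lemma smooth_transition:
  assumes "c \<in> atlas M" "d \<in> atlas M"
  shows "smooth_on (snd d \<circ> param c) (snd c ` (fst c \<inter> fst d))"
  using M assms unfolding smooth_manifold_def by blast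

lemma change_has_derivative:
  assumes "c \<in> atlas M" "d \<in> atlas M" "q \<in> fst c" "q \<in> fst d"
  shows "((snd d \<circ> param c) has_derivative change c d q) (at (snd c q))"
  unfolding change_def
  using smooth_on_has_derivative[OF smooth_transition open_overlap] assms by blast

lemma linear_change:
  assumes "c \<in> atlas M" "d \<in> atlas M" "q \<in> fst c" "q \<in> fst d"
  shows "linear (change c d q)"
  using change_has_derivative[OF assms] has_derivative_linear by blast

text \<open>
  The chain rule for a change of charts in the domain, for maps into a Euclidean space that are defined on the
  manifold.
\<close>

lemma has_derivative_change_chart:
  assumes c: "c \<in> atlas M" "q \<in> fst c" and d: "d \<in> atlas M" "q \<in> fst d"
    and H: "((H \<circ> param d) has_derivative D) (at (snd d q))"
  shows "((H \<circ> param c) has_derivative (D \<circ> change c d q)) (at (snd c q))"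
proof -
  have q: "param c (snd c q) = q" using param_coord[OF chart[OF c(1)] c(2)] .
  have "((H \<circ> param d) has_derivative D) (at ((snd d \<circ> param c) (snd c q)))" using H by (simp add: q)
  from diff_chain_at[OF change_has_derivative[OF c(1) d(1) c(2) d(2)] this]
  have 1: "(H \<circ> param d \<circ> (snd d \<circ> param c) has_derivative D \<circ> change c d q) (at (snd c q))" .
  show ?thesis
  proof (rule has_derivative_transform_within_open[OF 1 open_overlap[OF c(1) d(1)]])
    show "snd c q \<in> snd c ` (fst c \<inter> fst d)" using c d by blast
    fix x assume x: "x \<in> snd c ` (fst c \<inter> fst d)"
    show "(H \<circ> param d \<circ> (snd d \<circ> param c)) x = (H \<circ> param c) x"
      using param_coord[OF chart[OF d(1)] param_in_image(2)[OF chart[OF c(1)] x]] by simp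
  qed
qed

lemma change_self:
  assumes c: "c \<in> atlas M" "q \<in> fst c"
  shows "change c c q u = u"
proof -
  have x: "snd c q \<in> snd c ` fst c" using c by blast
  have "((\<lambda>x. x) has_derivative (\<lambda>h. h)) (at (snd c q))" by simp
  then have "((snd c \<circ> param c) has_derivative (\<lambda>h. h)) (at (snd c q))"
    by (rule has_derivative_transform_within_open[OF _ is_chart_facts(3)[OF chart[OF c(1)]] x])
      (simp add: coord_param)
  then show ?thesis unfolding change_def by (simp only: fder_eq)
qed

lemma change_comp:
  assumes "c \<in> atlas M" "q \<in> fst c" "d \<in> atlas M" "q \<in> fst d" "e \<in> atlas M" "q \<in> fst e"
  shows "change d e q (change c d q u) = change c e q u"
proof -
  have 1: "((snd e \<circ> param c) has_derivative (change d e q \<circ> change c d q)) (at (snd c q))"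
    by (rule has_derivative_change_chart) (use assms change_has_derivative in auto)
  show ?thesis unfolding change_def[of c e] fder_eq[OF 1] by simp
qed

lemma change_inverse:
  assumes "c \<in> atlas M" "q \<in> fst c" "d \<in> atlas M" "q \<in> fst d"
  shows "change d c q (change c d q u) = u"
  using change_comp[of c q d c] change_self assms by metis

lemma inj_change:
  assumes "c \<in> atlas M" "q \<in> fst c" "d \<in> atlas M" "q \<in> fst d"
  shows "inj (change c d q)"
  using change_inverse[OF assms] by (rule inj_on_inverseI)

lemma coord_at_in: "p \<in> points M \<Longrightarrow> coord_at M p \<in> snd (chart_at M p) ` fst (chart_at M p)"
  unfolding coord_at_def by (rule imageI[OF chart_at(2)])

lemma param_coord_at: "p \<in> points M \<Longrightarrow> param (chart_at M p) (coord_at M p) = p"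
  unfolding coord_at_def by (rule param_coord[OF chart[OF chart_at(1)] chart_at(2)])

end

locale riemannian_mfd =
  fixes M :: "('a, 'e::euclidean_space) riemannian"
  assumes RM: "riemannian_manifold M"
begin

sublocale manifold M
  using RM unfolding riemannian_manifold_def by unfold_locales blast

lemma metric_form: "p \<in> points M \<Longrightarrow> inner_form (metric M p)"
  using RM unfolding riemannian_manifold_def by blast

lemma metric_rep_eq:
  "metric_rep M c x u v = metric M (param c x) (change c (chart_at M (param c x)) (param c x) u)
     (change c (chart_at M (param c x)) (param c x) v)"
  unfolding metric_rep_def form_rep_def Let_def ..

lemma local_metric_rep:
  assumes c: "c \<in> atlas M"
  shows "local_metric (metric_rep M c) (snd c ` fst c)"
  unfolding local_metric_def
proof (intro conjI ballI allI)
  show "open (snd c ` fst c)" using is_chart_facts(3) chart c by blast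
  show "smooth_on (\<lambda>x. metric_rep M c x u v) (snd c ` fst c)" for u v
    using RM c unfolding riemannian_manifold_def by blast
  fix x assume x: "x \<in> snd c ` fst c"
  let ?q = "param c x"
  have q: "?q \<in> fst c" using param_in[OF x] .
  then have p: "?q \<in> points M" using chart_points c by blast
  show "inner_form (metric_rep M c x)"
    unfolding metric_rep_eq[abs_def]
    by (rule inner_form_pullback[OF metric_form[OF p]]) (use linear_change inj_change chart_at p q c in auto)
qed

lemma metric_rep_at:
  assumes p: "p \<in> points M"
  shows "metric_rep M (chart_at M p) (coord_at M p) u v = metric M p u v"
  unfolding metric_rep_eq param_coord_at[OF p] using change_self chart_at[OF p] by simp

lemma metric_rep_change:
  assumes "c \<in> atlas M" "q \<in> fst c"
  shows "metric_rep M c (snd c q) u v = metric M q (change c (chart_at M q) q u) (change c (chart_at M q) q v)"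
  unfolding metric_rep_eq using param_coord[OF chart[OF assms(1)] assms(2)] by simp

end

section \<open>Differentiability of the projection onto a kernel\<close>

lemma local_metric_subset:
  assumes "local_metric G U" "open V" "V \<subseteq> U"
  shows "local_metric G V"
  unfolding local_metric_def
proof (intro conjI ballI allI)
  show "smooth_on (\<lambda>x. G x u v) V" for u v
    by (rule smooth_on_subset[OF local_metricD(3)[OF assms(1)] assms(3)])
  show "inner_form (G x)" if "x \<in> V" for x
    using local_metricD(2)[OF assms(1)] assms(3) that by blast
qed (rule assms(2))

text \<open>
  The projection \<open>P y\<close> of \<open>w\<close> onto the kernel of \<open>fder f y\<close> is characterized with a Lagrange multiplier \<open>l\<close>, by
  \<open>G y (P y) z + l \<bullet> fder f y z = G y w z\<close> for all \<open>z\<close> and \<open>fder f y (P y) = 0\<close>. This is a linear system for the pair of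
  \<open>P y\<close> and \<open>l\<close>, and it is injective because \<open>G y\<close> is definite and \<open>fder f y\<close> is onto.
\<close>

lemma differentiable_kernel_projection:
  fixes G :: "'e::euclidean_space \<Rightarrow> 'e \<Rightarrow> 'e \<Rightarrow> real" and f :: "'e \<Rightarrow> 'f::euclidean_space"
  assumes G: "local_metric G U" and f: "smooth_on f U" and surj: "\<And>y. y \<in> U \<Longrightarrow> surj (fder f y)"
    and P: "\<And>y. y \<in> U \<Longrightarrow> fder f y (P y) = 0"
    and orth: "\<And>y z. y \<in> U \<Longrightarrow> fder f y z = 0 \<Longrightarrow> G y (w - P y) z = 0"
    and x: "x \<in> U"
  shows "P differentiable (at x)"
proof -
  note U = local_metricD(1)[OF G]
  have lin: "linear (fder f y)" if "y \<in> U" for y using smooth_on_linear_fder[OF f U that] .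
  have "\<exists>l. \<forall>z. G y (w - P y) z = l \<bullet> fder f y z" if y: "y \<in> U" for y
  proof -
    \<comment> \<open>A functional that vanishes on the kernel factors through \<open>fder f y\<close>.\<close>
    obtain R where R: "linear R" "fder f y \<circ> R = id"
      using linear_surjective_right_inverse[OF lin[OF y] surj[OF y]] by blast
    note b = local_metricD(2)[OF G y]
    let ?a = "G y (w - P y)"
    have a: "?a z = ?a (R (fder f y z))" for z
    proof -
      have "fder f y (z - R (fder f y z)) = 0"
        using R(2) linear_diff[OF lin[OF y]] by (simp add: pointfree_idE)
      from orth[OF y this] show ?thesis by (simp add: inner_form_simps(4)[OF b])
    qed
    have aR_lin: "linear (\<lambda>t. ?a (R t))" using linear_compose[OF R(1) inner_form_bilinear(1)[OF b]] by (simp add: o_def)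
    have aR: "?a (R t) = (\<Sum>j\<in>Basis. ?a (R j) *\<^sub>R j) \<bullet> t" for t
    proof -
      have "?a (R t) = (\<Sum>j\<in>Basis. (t \<bullet> j) *\<^sub>R ?a (R j))" by (rule linear_sum_Basis[OF aR_lin])
      also have "\<dots> = (\<Sum>j\<in>Basis. ?a (R j) *\<^sub>R j) \<bullet> t"
        unfolding inner_sum_left inner_scaleR_left by (simp add: inner_commute mult.commute)
      finally show ?thesis .
    qed
    have "?a z = (\<Sum>j\<in>Basis. ?a (R j) *\<^sub>R j) \<bullet> fder f y z" for z
      using a[of z] aR[of "fder f y z"] by simp
    then show ?thesis by blast
  qed
  then obtain l where l: "\<And>y z. y \<in> U \<Longrightarrow> G y (w - P y) z = l y \<bullet> fder f y z" by metis
  let ?A = "\<lambda>y s. (\<Sum>i\<in>Basis. (G y (fst s) i + snd s \<bullet> fder f y i) *\<^sub>R i, fder f y (fst s))"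
  let ?b = "\<lambda>y. (\<Sum>i\<in>Basis. G y w i *\<^sub>R i, 0::'f)"
  have "(\<lambda>y. (P y, l y)) differentiable (at x)"
  proof (rule differentiable_linear_solution[OF U x, where A="?A" and b="?b"])
    show lA: "linear (?A y)" if y: "y \<in> U" for y
      using lin[OF y]
      by (intro linearI) (simp_all add: inner_form_simps[OF local_metricD(2)[OF G y]] linear_add linear_cmul
          inner_add_left algebra_simps sum.distrib scaleR_sum_right)
    show "inj (?A x)"
      unfolding linear_injective_0[OF lA[OF x]]
    proof (intro allI impI)
      fix s :: "'e \<times> 'f" assume s: "?A x s = 0"
      note b = local_metricD(2)[OF G x]
      have eq: "(\<Sum>i\<in>Basis. (G x (fst s) i + snd s \<bullet> fder f x i) *\<^sub>R i) = 0" "fder f x (fst s) = 0"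
        using s by (simp_all add: zero_prod_def)
      have i: "G x (fst s) i + snd s \<bullet> fder f x i = 0" if "i \<in> Basis" for i
        using arg_cong[OF eq(1), of "\<lambda>y. y \<bullet> i"] that by simp
      have "linear (\<lambda>z. G x (fst s) z + snd s \<bullet> fder f x z)"
        using lin[OF x] by (intro linearI) (simp_all add: inner_form_simps[OF b] linear_add linear_cmul inner_add_right algebra_simps)
      from linear_sum_Basis[OF this] have z: "G x (fst s) z + snd s \<bullet> fder f x z = 0" for z
        using i by simp
      have s1: "fst s = 0" using z[of "fst s"] eq(2) inner_form_eq_0[OF b] by simp
      obtain z where "fder f x z = snd s" using surj[OF x] by (metis surjD)
      then have "snd s \<bullet> snd s = 0" using z[of z] s1 by (simp add: inner_form_simps[OF b])
      then show "s = 0" using s1 by (simp add: prod_eq_iff)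
    qed
    show "(\<lambda>y. ?A y s) differentiable (at x)" for s
    proof -
      have "(\<lambda>y. fder f y v) differentiable (at x)" for v
        using smooth_on_differentiable[OF smooth_on_fder[OF f] U x] .
      then obtain D where D: "\<And>v. ((\<lambda>y. fder f y v) has_derivative D v) (at x)"
        unfolding differentiable_def by metis
      obtain E where E: "\<And>u v. ((\<lambda>y. G y u v) has_derivative E u v) (at x)"
        using local_metricD(5)[OF G x] unfolding differentiable_def by metis
      have "((\<lambda>y. ?A y s) has_derivative
          (\<lambda>h. (\<Sum>i\<in>Basis. (E (fst s) i h + snd s \<bullet> D i h) *\<^sub>R i, D (fst s) h))) (at x)"
        by (intro has_derivative_Pair has_derivative_sum has_derivative_scaleR_left
            has_derivative_add has_derivative_inner_right D E)
      then show ?thesis by (rule differentiableI)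
    qed
    show "?b differentiable (at x)"
    proof -
      obtain E where E: "\<And>u v. ((\<lambda>y. G y u v) has_derivative E u v) (at x)"
        using local_metricD(5)[OF G x] unfolding differentiable_def by metis
      have "(?b has_derivative (\<lambda>h. (\<Sum>i\<in>Basis. E w i h *\<^sub>R i, 0))) (at x)"
        by (intro has_derivative_Pair has_derivative_sum has_derivative_scaleR_left
            has_derivative_const E)
      then show ?thesis by (rule differentiableI)
    qed
    show "?A y (P y, l y) = ?b y" if y: "y \<in> U" for y
      using P[OF y] l[OF y, symmetric] by (simp add: inner_form_simps[OF local_metricD(2)[OF G y]])
  qed
  then obtain D where "((\<lambda>y. (P y, l y)) has_derivative D) (at x)" unfolding differentiable_def by blast
  from has_derivative_fst[OF this] show ?thesis unfolding differentiable_def by auto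
qed

section \<open>Riemannian submersions\<close>

locale submersion =
  fixes M :: "('a, 'e::euclidean_space) riemannian" and N :: "('b, 'f::euclidean_space) riemannian"
    and F :: "'a \<Rightarrow> 'b"
  assumes submersion: "riemannian_submersion M N F"
begin

sublocale M: riemannian_mfd M
  using submersion unfolding riemannian_submersion_def by unfold_locales blast

sublocale N: riemannian_mfd N
  using submersion unfolding riemannian_submersion_def by unfold_locales blast

abbreviation "F_rep c d \<equiv> snd d \<circ> F \<circ> param c"

abbreviation "F_dom c d \<equiv> snd c ` (fst c \<inter> F -` fst d)"

lemma F_points: "p \<in> points M \<Longrightarrow> F p \<in> points N"
  using submersion unfolding riemannian_submersion_def smooth_map_def continuous_map_def by blast

lemma openin_F_preimage:
  assumes c: "c \<in> atlas M" and d: "d \<in> atlas N"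
  shows "openin (mtop M) (fst c \<inter> F -` fst d)"
proof -
  have "continuous_map (mtop M) (mtop N) F"
    using submersion unfolding riemannian_submersion_def smooth_map_def by blast
  then have "openin (mtop M) {p \<in> points M. F p \<in> fst d}"
    using openin_continuous_map_preimage is_chart_facts(1) N.chart[OF d] by blast
  moreover have "fst c \<inter> F -` fst d = fst c \<inter> {p \<in> points M. F p \<in> fst d}"
    using M.chart_points[OF c] by auto
  ultimately show ?thesis using openin_Int[OF is_chart_facts(1)[OF M.chart[OF c]]] by metis
qed

lemma open_F_dom:
  assumes c: "c \<in> atlas M" and d: "d \<in> atlas N"
  shows "open (F_dom c d)"
  using open_chart_image[OF M.chart[OF c] openin_F_preimage[OF c d]] by (simp add: Int_absorb1 Int_assoc[symmetric])

lemma smooth_F_rep: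
  assumes "c \<in> atlas M" "d \<in> atlas N"
  shows "smooth_on (F_rep c d) (F_dom c d)"
  using submersion assms unfolding riemannian_submersion_def smooth_map_def by blast

lemma F_rep_has_derivative:
  assumes "c \<in> atlas M" "p \<in> fst c" "d \<in> atlas N" "F p \<in> fst d"
  shows "(F_rep c d has_derivative fder (F_rep c d) (snd c p)) (at (snd c p))"
  using smooth_on_has_derivative[OF smooth_F_rep open_F_dom] assms by blast

lemma tangent_map_eq:
  "tangent_map M N F p = fder (F_rep (chart_at M p) (chart_at N (F p))) (snd (chart_at M p) p)"
  unfolding tangent_map_def coord_at_def by (simp add: o_assoc)

lemma linear_tangent_map: "p \<in> points M \<Longrightarrow> linear (tangent_map M N F p)"
  unfolding tangent_map_eq
  using F_rep_has_derivative[OF M.chart_at N.chart_at[OF F_points]] has_derivative_linear by blast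

lemma surj_tangent_map: "p \<in> points M \<Longrightarrow> surj (tangent_map M N F p)"
  using submersion unfolding riemannian_submersion_def by blast

text \<open>
  The tangent map is defined with the distinguished charts at \<open>p\<close> and \<open>F p\<close>; this relates it to arbitrary charts.
\<close>

lemma fder_F_rep:
  assumes c: "c \<in> atlas M" "p \<in> fst c" and d: "d \<in> atlas N" "F p \<in> fst d"
  shows "fder (F_rep c d) (snd c p) u =
    change (chart_at N (F p)) d (F p) (tangent_map M N F p (change c (chart_at M p) p u))"
proof -
  have p: "p \<in> points M" using M.chart_points c by blast
  note m = M.chart_at[OF p] and n = N.chart_at[OF F_points[OF p]]
  let ?n = "chart_at N (F p)" and ?m = "chart_at M p"
  have 1: "(((snd ?n \<circ> F) \<circ> param ?m) has_derivative tangent_map M N F p) (at (snd ?m p))"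
    using F_rep_has_derivative[OF m n] unfolding tangent_map_eq .
  have 2: "(F_rep c ?n has_derivative (tangent_map M N F p \<circ> change c ?m p)) (at (snd c p))"
    using M.has_derivative_change_chart[OF c m 1] .
  have pc: "param c (snd c p) = p" using param_coord[OF M.chart[OF c(1)] c(2)] .
  have "((snd d \<circ> param ?n) has_derivative change ?n d (F p)) (at (F_rep c ?n (snd c p)))"
    using N.change_has_derivative[OF n(1) d(1) n(2) d(2)] by (simp add: pc)
  from diff_chain_at[OF 2 this]
  have 3: "((snd d \<circ> param ?n) \<circ> F_rep c ?n has_derivative
      change ?n d (F p) \<circ> (tangent_map M N F p \<circ> change c ?m p)) (at (snd c p))" .
  have "(F_rep c d has_derivative
      change ?n d (F p) \<circ> (tangent_map M N F p \<circ> change c ?m p)) (at (snd c p))"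
  proof (rule has_derivative_transform_within_open[OF 3 open_F_dom[OF c(1) n(1)]])
    show "snd c p \<in> F_dom c ?n" using c n by blast
    fix x assume x: "x \<in> F_dom c ?n"
    have "F (param c x) \<in> fst ?n" using param_in_image(2)[OF M.chart[OF c(1)] x] by simp
    then show "((snd d \<circ> param ?n) \<circ> F_rep c ?n) x = F_rep c d x"
      using param_coord[OF N.chart[OF n(1)]] by simp
  qed
  from fder_eq[OF this] show ?thesis by simp
qed

lemma vertical_iff_fder:
  assumes c: "c \<in> atlas M" "p \<in> fst c" and d: "d \<in> atlas N" "F p \<in> fst d"
  shows "change c (chart_at M p) p u \<in> vertical M N F p \<longleftrightarrow> fder (F_rep c d) (snd c p) u = 0"
proof -
  have p: "p \<in> points M" using M.chart_points c by blast
  note n = N.chart_at[OF F_points[OF p]]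
  show ?thesis
    unfolding vertical_def mem_Collect_eq fder_F_rep[OF assms]
    using N.linear_change[OF n(1) d(1) n(2) d(2)] N.inj_change[OF n d] linear_injective_0 linear_0 by metis
qed

lemma surj_fder_F_rep:
  assumes c: "c \<in> atlas M" "p \<in> fst c" and d: "d \<in> atlas N" "F p \<in> fst d"
  shows "surj (fder (F_rep c d) (snd c p))"
proof -
  have p: "p \<in> points M" using M.chart_points c by blast
  note m = M.chart_at[OF p] and n = N.chart_at[OF F_points[OF p]]
  show ?thesis
    unfolding surj_def
  proof
    fix y
    obtain z where z: "tangent_map M N F p z = change d (chart_at N (F p)) (F p) y"
      using surj_tangent_map[OF p] by (metis surjD)
    show "\<exists>x. y = fder (F_rep c d) (snd c p) x"
      by (rule exI[of _ "change (chart_at M p) c p z"])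
        (simp add: fder_F_rep[OF assms] M.change_inverse[OF m c] z N.change_inverse[OF d n])
  qed
qed

lemma subspace_vertical: "p \<in> points M \<Longrightarrow> subspace (vertical M N F p)"
  unfolding vertical_def using linear_subspace_kernel[OF linear_tangent_map] .

lemma subspace_horizontal: "p \<in> points M \<Longrightarrow> subspace (horizontal M N F p)"
  unfolding horizontal_def by (auto simp: subspace_def inner_form_simps[OF M.metric_form])

lemma vproj:
  assumes p: "p \<in> points M"
  shows "vproj M N F p u \<in> vertical M N F p" "v \<in> vertical M N F p \<Longrightarrow> metric M p (u - vproj M N F p u) v = 0"
    "linear (vproj M N F p)" "u \<in> vertical M N F p \<Longrightarrow> vproj M N F p u = u"
  unfolding vproj_def using orth_proj[OF M.metric_form[OF p] subspace_vertical[OF p]] by blast+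

lemma hproj_inner:
  assumes p: "p \<in> points M" and a: "a \<in> horizontal M N F p"
  shows "metric M p (hproj M N F p u) a = metric M p u a"
  using orth_proj(2)[OF M.metric_form[OF p] subspace_horizontal[OF p] a, of u]
  unfolding hproj_def by (simp add: inner_form_simps[OF M.metric_form[OF p]])

lemma vertical_horizontal:
  assumes "p \<in> points M" "v \<in> vertical M N F p" "a \<in> horizontal M N F p"
  shows "metric M p v a = 0"
  using assms inner_form_sym[OF M.metric_form[OF assms(1)]] unfolding horizontal_def by fastforce

abbreviation "V_rep c \<equiv> endo_rep M (vproj M N F) c"

lemma V_rep_eq:
  assumes c: "c \<in> atlas M" "q \<in> fst c"
  shows "V_rep c (snd c q) u = change (chart_at M q) c q (vproj M N F q (change c (chart_at M q) q u))"
  unfolding endo_rep_def Let_def param_coord[OF M.chart[OF c(1)] c(2)] ..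

lemma linear_V_rep:
  assumes c: "c \<in> atlas M" "q \<in> fst c"
  shows "linear (V_rep c (snd c q))"
proof -
  have q: "q \<in> points M" using M.chart_points c by blast
  note m = M.chart_at[OF q]
  note l = M.linear_change[OF m(1) c(1) m(2) c(2)] M.linear_change[OF c(1) m(1) c(2) m(2)] vproj(3)[OF q]
  show ?thesis
    by (rule linearI) (simp_all add: V_rep_eq[OF c] linear_add[OF l(1)] linear_add[OF l(2)] linear_add[OF l(3)]
        linear_cmul[OF l(1)] linear_cmul[OF l(2)] linear_cmul[OF l(3)])
qed

text \<open>
  In every chart, the vertical projection is the orthogonal projection onto the kernel of the derivative of the
  representative of \<open>F\<close>.
\<close>

lemma V_rep_fder:
  assumes c: "c \<in> atlas M" "q \<in> fst c" and d: "d \<in> atlas N" "F q \<in> fst d"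
  shows "fder (F_rep c d) (snd c q) (V_rep c (snd c q) u) = 0"
    "fder (F_rep c d) (snd c q) z = 0 \<Longrightarrow> metric_rep M c (snd c q) (u - V_rep c (snd c q) u) z = 0"
    "fder (F_rep c d) (snd c q) z = 0 \<Longrightarrow> V_rep c (snd c q) z = z"
proof -
  have q: "q \<in> points M" using M.chart_points c by blast
  note m = M.chart_at[OF q]
  have 1: "change c (chart_at M q) q (V_rep c (snd c q) u) = vproj M N F q (change c (chart_at M q) q u)" for u
    unfolding V_rep_eq[OF c] using M.change_inverse[OF m c] .
  show "fder (F_rep c d) (snd c q) (V_rep c (snd c q) u) = 0"
    unfolding vertical_iff_fder[OF assms, symmetric] 1 using vproj(1)[OF q] .
  assume "fder (F_rep c d) (snd c q) z = 0"
  then have z: "change c (chart_at M q) q z \<in> vertical M N F q" using vertical_iff_fder[OF assms] by blast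
  show "metric_rep M c (snd c q) (u - V_rep c (snd c q) u) z = 0"
    unfolding M.metric_rep_change[OF c] linear_diff[OF M.linear_change[OF c(1) m(1) c(2) m(2)]] 1
    using vproj(2)[OF q z] .
  show "V_rep c (snd c q) z = z"
    unfolding V_rep_eq[OF c] vproj(4)[OF q z] using M.change_inverse[OF c m] .
qed

lemma V_rep_differentiable:
  assumes p: "p \<in> points M"
  shows "(\<lambda>y. V_rep (chart_at M p) y w) differentiable (at (coord_at M p))"
proof -
  let ?c = "chart_at M p" and ?d = "chart_at N (F p)"
  note c = M.chart_at[OF p] and d = N.chart_at[OF F_points[OF p]]
  have U: "F_dom ?c ?d \<subseteq> snd ?c ` fst ?c" by blast
  have in_dom: thesis if "y \<in> F_dom ?c ?d" "\<And>q. q \<in> fst ?c \<Longrightarrow> F q \<in> fst ?d \<Longrightarrow> y = snd ?c q \<Longrightarrow> thesis"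
    for y thesis using that by blast
  show ?thesis
  proof (rule differentiable_kernel_projection[where U="F_dom ?c ?d" and f="F_rep ?c ?d"
        and G="metric_rep M ?c" and w=w])
    show "local_metric (metric_rep M ?c) (F_dom ?c ?d)"
      by (rule local_metric_subset[OF M.local_metric_rep[OF c(1)] open_F_dom[OF c(1) d(1)] U])
    show "smooth_on (F_rep ?c ?d) (F_dom ?c ?d)" using smooth_F_rep[OF c(1) d(1)] .
    show "coord_at M p \<in> F_dom ?c ?d" unfolding coord_at_def using c d by blast
    show "surj (fder (F_rep ?c ?d) y)" if "y \<in> F_dom ?c ?d" for y
      by (rule in_dom[OF that]) (simp add: surj_fder_F_rep[OF c(1) _ d(1)])
    show "fder (F_rep ?c ?d) y (V_rep ?c y w) = 0" if "y \<in> F_dom ?c ?d" for y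
      by (rule in_dom[OF that]) (simp add: V_rep_fder(1)[OF c(1) _ d(1)])
    show "metric_rep M ?c y (w - V_rep ?c y w) z = 0"
      if "y \<in> F_dom ?c ?d" "fder (F_rep ?c ?d) y z = 0" for y z
      by (rule in_dom[OF that(1)]) (use V_rep_fder(2)[OF c(1) _ d(1)] that(2) in simp)
  qed
qed

lemma V_rep_at:
  assumes p: "p \<in> points M"
  shows "V_rep (chart_at M p) (coord_at M p) u = vproj M N F p u"
  unfolding coord_at_def V_rep_eq[OF M.chart_at[OF p]] M.change_self[OF M.chart_at[OF p]] ..

text \<open>
  The normal component \<open>g (\<nabla>\<^sub>u (\<V> v)) a\<close> of the derivative of the vertical part of the constant field \<open>v\<close>. For vertical
  vectors it is the second fundamental form of the fiber. As it is bilinear on the whole tangent space, the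
  lemmas on traces apply to it directly.
\<close>

definition fiber_form :: "'a \<Rightarrow> 'e \<Rightarrow> 'e \<Rightarrow> 'e \<Rightarrow> real" where
  "fiber_form p a u v = metric M p (fder (\<lambda>y. V_rep (chart_at M p) y v) (coord_at M p) u
     + christoffel (metric_rep M (chart_at M p)) (coord_at M p) u v) a"

text \<open>
  Of the two summands of \<open>T\<close>, the second is vertical, hence invisible to \<open>a\<close>; the first is the horizontal part of the
  derivative in \<open>fiber_form\<close>.
\<close>

lemma oneill_T_fiber_form:
  assumes p: "p \<in> points M" and u: "u \<in> vertical M N F p" and v: "v \<in> vertical M N F p"
    and a: "a \<in> horizontal M N F p"
  shows "metric M p (oneill_T M N F p u v) a = fiber_form p a u v"
proof -
  note c = M.chart_at[OF p]
  have H: "endo_rep M (hproj M N F) (chart_at M p) (coord_at M p) z = hproj M N F p z" for z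
    unfolding endo_rep_def Let_def M.param_coord_at[OF p] M.change_self[OF c] ..
  show ?thesis
    unfolding oneill_T_def Let_def H V_rep_at[OF p] fiber_form_def
      inner_form_simps(1)[OF M.metric_form[OF p]] hproj_inner[OF p a] nabla_def vproj(4)[OF p u] vproj(4)[OF p v]
    using vertical_horizontal[OF p vproj(1)[OF p] a] by simp
qed

lemma bilinear_fiber_form:
  assumes p: "p \<in> points M"
  shows "bilinear (fiber_form p a)"
proof -
  let ?c = "chart_at M p" and ?x = "coord_at M p"
  note c = M.chart_at[OF p]
  note b = M.metric_form[OF p]
  have \<Gamma>: "bilinear (christoffel (metric_rep M ?c) ?x)"
    using christoffel_metric(1)[OF M.local_metric_rep[OF c(1)] M.coord_at_in[OF p]] .
  have "bilinear (\<lambda>v (t::real). fder (\<lambda>y. t *\<^sub>R V_rep ?c y v) ?x u)" for u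
  proof (rule bilinear_fder[OF is_chart_facts(3)[OF M.chart[OF c(1)]] M.coord_at_in[OF p]])
    fix y assume "y \<in> snd ?c ` fst ?c"
    then have "linear (V_rep ?c y)" using linear_V_rep[OF c(1)] by blast
    then show "bilinear (\<lambda>v (t::real). t *\<^sub>R V_rep ?c y v)"
      unfolding bilinear_def
      by (auto intro!: linearI simp: linear_add linear_cmul scaleR_add_left scaleR_add_right)
  next
    show "(\<lambda>y. t *\<^sub>R V_rep ?c y v) differentiable (at ?x)" for v and t :: real
      using V_rep_differentiable[OF p] differentiable_scaleR differentiable_const by blast
  qed
  then have "linear (\<lambda>v. fder (\<lambda>y. 1 *\<^sub>R V_rep ?c y v) ?x u)" for u
    unfolding bilinear_def by blast
  then have l1: "linear (\<lambda>v. fder (\<lambda>y. V_rep ?c y v) ?x u)" for u by simp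
  have l2: "linear (fder (\<lambda>y. V_rep ?c y v) ?x)" for v
    using linear_fder[OF V_rep_differentiable[OF p]] .
  have l3: "linear (\<lambda>v. christoffel (metric_rep M ?c) ?x u v)" "linear (\<lambda>u. christoffel (metric_rep M ?c) ?x u v)" for u v
    using \<Gamma> unfolding bilinear_def by auto
  show ?thesis
    unfolding bilinear_def fiber_form_def[abs_def]
    by (auto intro!: linearI simp: inner_form_simps[OF b] linear_add[OF l1] linear_cmul[OF l1] linear_add[OF l2]
        linear_cmul[OF l2] linear_add[OF l3(1)] linear_cmul[OF l3(1)] linear_add[OF l3(2)] linear_cmul[OF l3(2)] algebra_simps)
qed

end

section \<open>The fibers\<close>

lemma homeomorphic_maps_chart:
  assumes c: "is_chart X c"
  shows "homeomorphic_maps (subtopology X (fst c)) (top_of_set (snd c ` fst c)) (snd c) (param c)"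
proof -
  let ?X = "subtopology X (fst c)" and ?Y = "top_of_set (snd c ` fst c)"
  have "homeomorphic_map ?X ?Y (snd c)" using c unfolding is_chart_def by blast
  then obtain g where g: "homeomorphic_maps ?X ?Y (snd c) g"
    unfolding homeomorphic_map_maps by blast
  have top: "topspace ?X = fst c" using is_chart_facts(2)[OF c] by (simp add: Int_absorb1)
  have "continuous_map ?Y ?X (param c)"
  proof (rule continuous_map_eq)
    show "continuous_map ?Y ?X g" using g unfolding homeomorphic_maps_def by blast
    show "g x = param c x" if "x \<in> topspace ?Y" for x
    proof -
      have "g x \<in> fst c" "snd c (g x) = x"
        using g that top unfolding homeomorphic_maps_def continuous_map_def by auto
      then show ?thesis using param_coord[OF c] by metis
    qed
  qed
  then show ?thesis
    using g param_coord[OF c] coord_param[of _ c] top unfolding homeomorphic_maps_def by auto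
qed

text \<open>
  Implicit function theorem: \<open>\<beta>\<close> is a smooth immersive parametrization, with continuous inverse \<open>\<alpha>\<close>, of the part in \<open>U\<close> of
  a regular level set of \<open>f\<close>. Let \<open>D\<close> be the derivative of \<open>f\<close> at \<open>x0\<close> and \<open>R\<close> a right inverse of it. The map
  \<open>\<Phi> y = y - R (D y) + R (f y)\<close> has the identity as derivative at \<open>x0\<close> and satisfies \<open>D (\<Phi> y) = f y\<close>, so its local inverse
  straightens the level set to an affine subspace parallel to the kernel of \<open>D\<close>.
\<close>

lemma level_set_straightening:
  fixes f :: "'e::euclidean_space \<Rightarrow> 'f::euclidean_space"
  assumes O: "open O'" "x0 \<in> O'" and f: "smooth_on f O'" and surj: "surj (fder f x0)"
    and dim: "dim {u. fder f x0 u = 0} = DIM('k::euclidean_space)"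
  obtains U and T :: "'k::euclidean_space set" and \<alpha> :: "'e \<Rightarrow> 'k::euclidean_space"
    and \<beta> :: "'k::euclidean_space \<Rightarrow> 'e" where
    "open U" "x0 \<in> U" "U \<subseteq> O'" "open T" "continuous_on U \<alpha>" "smooth_on \<beta> T"
    "\<And>t. t \<in> T \<Longrightarrow> \<beta> t \<in> U" "\<And>t. t \<in> T \<Longrightarrow> f (\<beta> t) = f x0" "\<And>t. t \<in> T \<Longrightarrow> \<alpha> (\<beta> t) = t"
    "\<And>y. y \<in> U \<Longrightarrow> f y = f x0 \<Longrightarrow> \<alpha> y \<in> T" "\<And>y. y \<in> U \<Longrightarrow> f y = f x0 \<Longrightarrow> \<beta> (\<alpha> y) = y"
    "\<And>t. t \<in> T \<Longrightarrow> inj (fder \<beta> t)"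
proof -
  let ?D = "fder f x0"
  have lin: "linear ?D" using smooth_on_linear_fder[OF f O] .
  obtain R where R: "linear R" "?D \<circ> R = id"
    using linear_surjective_right_inverse[OF lin surj] by blast
  have DR: "?D (R t) = t" for t using R(2) by (simp add: pointfree_idE)
  have bl: "bounded_linear ?D" "bounded_linear R" using lin R(1) linear_conv_bounded_linear by blast+
  define \<Phi> where "\<Phi> y = (y - R (?D y)) + R (f y)" for y
  have bl': "bounded_linear (\<lambda>y. y - R (?D y))"
    using bl by (intro bounded_linear_sub bounded_linear_ident bounded_linear_compose[OF bl(2) bl(1), unfolded o_def])
  have id: "smooth_on (\<lambda>y. y - R (?D y)) O'"
    unfolding smooth_on_def
  proof
    show "Ck_on k (\<lambda>y. y - R (?D y)) O'" for k
    proof (cases k)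
      case 0 then show ?thesis using linear_continuous_on[OF bl'] by simp
    next
      case (Suc j)
      show ?thesis unfolding Suc
        by (rule Ck_on_SucI[OF O(1) bounded_linear_imp_has_derivative[OF bl']]) (rule Ck_on_const[OF O(1)])
    qed
  qed
  have \<Phi>: "smooth_on \<Phi> O'"
    unfolding \<Phi>_def by (rule smooth_on_add[OF O(1) id smooth_on_bounded_linear[OF O(1) bl(2) f]])
  have "(\<Phi> has_derivative (\<lambda>h. (h - R (?D h)) + R (?D h))) (at x0)"
    unfolding \<Phi>_def
    by (intro has_derivative_add bounded_linear_imp_has_derivative bl' bounded_linear.has_derivative[OF bl(2)]
        smooth_on_has_derivative[OF f O])
  then have "(\<Phi> has_derivative (\<lambda>h. h)) (at x0)" by simp
  from fder_eq[OF this] have inj0: "inj (fder \<Phi> x0)" by simp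
  obtain U V \<Psi> where UV:
    "open U" "U \<subseteq> O'" "x0 \<in> U" "open V" "\<Phi> x0 \<in> V" "homeomorphism U V \<Phi> \<Psi>" "smooth_on \<Psi> V"
    "\<And>x. x \<in> U \<Longrightarrow> inj (fder \<Phi> x)" "\<And>y. y \<in> V \<Longrightarrow> inj (fder \<Psi> y)"
    by (rule smooth_local_inverse[OF O \<Phi> inj0]) (rule that; assumption | blast)
  have \<Psi>: "\<Psi> z \<in> U" "\<Phi> (\<Psi> z) = z" if "z \<in> V" for z using UV(6) that by (auto simp: homeomorphism_def)
  have \<Psi>': "\<Phi> y \<in> V" "\<Psi> (\<Phi> y) = y" if "y \<in> U" for y using UV(6) that by (auto simp: homeomorphism_def)
  have D\<Phi>: "?D (\<Phi> y) = f y" for y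
    unfolding \<Phi>_def by (simp add: linear_add[OF lin] linear_diff[OF lin] DR)
  let ?W = "{u. ?D u = 0}"
  have W: "subspace ?W" using linear_subspace_kernel[OF lin] .
  obtain I :: "'k \<Rightarrow> 'e" and L where I: "linear I" "linear L" "I ` UNIV = ?W" "\<And>t. L (I t) = t" "\<And>w. w \<in> ?W \<Longrightarrow> I (L w) = w"
    using isometries_subspaces[OF subspace_UNIV W, where ?'a='k] dim by (metis (no_types, lifting) UNIV_I dim_UNIV)
  have blI: "bounded_linear I" "bounded_linear L" using I linear_conv_bounded_linear by blast+
  define \<alpha> where "\<alpha> y = L (\<Phi> y - \<Phi> x0)" for y
  define \<beta> where "\<beta> t = \<Psi> (\<Phi> x0 + I t)" for t
  define T where "T = {t. \<Phi> x0 + I t \<in> V}"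
  have affine: "continuous_on UNIV (\<lambda>t. \<Phi> x0 + I t)"
    by (intro continuous_intros linear_continuous_on blI)
  have T: "open T"
  proof -
    have "T = (\<lambda>t. \<Phi> x0 + I t) -` V" unfolding T_def by auto
    then show ?thesis using open_vimage[OF UV(4) affine] by simp
  qed
  have DI: "?D (I t) = 0" for t using I(3) by blast
  have kernel: "\<Phi> y - \<Phi> x0 \<in> ?W" if "f y = f x0" for y
    using that by (simp add: linear_diff[OF lin] D\<Phi>)
  have smooth_affine: "smooth_on (\<lambda>t. \<Phi> x0 + I t) T"
    unfolding smooth_on_def
  proof
    show "Ck_on k (\<lambda>t. \<Phi> x0 + I t) T" for k
    proof (cases k)
      case 0 then show ?thesis using affine continuous_on_subset by auto
    next
      case (Suc j)
      have d: "((\<lambda>t. \<Phi> x0 + I t) has_derivative I) (at t)" for t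
        using has_derivative_add[OF has_derivative_const bounded_linear_imp_has_derivative[OF blI(1)]] by simp
      show ?thesis unfolding Suc
        by (rule Ck_on_SucI[OF T d]) (rule Ck_on_const[OF T])
    qed
  qed
  have \<beta>: "smooth_on \<beta> T"
    unfolding \<beta>_def by (rule smooth_on_compose[OF T UV(4) _ UV(7) smooth_affine]) (auto simp: T_def)
  have \<alpha>: "continuous_on U \<alpha>"
    unfolding \<alpha>_def
    using smooth_on_imp_continuous_on[OF smooth_on_subset[OF \<Phi> UV(2)]] bounded_linear.continuous_on[OF blI(2)]
    by (intro bounded_linear.continuous_on[OF blI(2)] continuous_intros)
  have inj: "inj (fder \<beta> t)" if t: "t \<in> T" for t
  proof -
    have V: "\<Phi> x0 + I t \<in> V" using t by (simp add: T_def)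
    have 1: "((\<lambda>t. \<Phi> x0 + I t) has_derivative I) (at t)"
      using has_derivative_add[OF has_derivative_const bounded_linear_imp_has_derivative[OF blI(1)]] by simp
    have "fder \<beta> t = fder \<Psi> (\<Phi> x0 + I t) \<circ> I"
      using fder_eq[OF diff_chain_at[OF 1 smooth_on_has_derivative[OF UV(7,4) V]]] unfolding \<beta>_def o_def .
    moreover have "inj I" using I(4) by (rule inj_on_inverseI)
    ultimately show ?thesis using inj_compose[OF UV(9)[OF V]] by simp
  qed
  show thesis
  proof (rule that[OF UV(1,3,2) T \<alpha> \<beta>])
    fix t assume "t \<in> T"
    then have V: "\<Phi> x0 + I t \<in> V" by (simp add: T_def)
    show "\<beta> t \<in> U" unfolding \<beta>_def using \<Psi>(1)[OF V] .
    show "f (\<beta> t) = f x0"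
      using D\<Phi>[of "\<beta> t"] unfolding \<beta>_def \<Psi>(2)[OF V] by (simp add: linear_add[OF lin] DI D\<Phi>)
    show "\<alpha> (\<beta> t) = t" unfolding \<alpha>_def \<beta>_def \<Psi>(2)[OF V] using I(4) by simp
    show "inj (fder \<beta> t)" using inj[OF \<open>t \<in> T\<close>] .
  next
    fix y assume y: "y \<in> U" "f y = f x0"
    have "\<Phi> x0 + I (\<alpha> y) = \<Phi> y" unfolding \<alpha>_def I(5)[OF kernel[OF y(2)]] by simp
    then show "\<alpha> y \<in> T" "\<beta> (\<alpha> y) = y" unfolding T_def \<beta>_def using \<Psi>'[OF y(1)] by simp_all
  qed
qed

locale submersion_fiber = submersion M N F
  for M :: "('a, 'e::euclidean_space) riemannian" and N :: "('b, 'f::euclidean_space) riemannian"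
    and F :: "'a \<Rightarrow> 'b" +
  fixes K :: "('a, 'k::euclidean_space) riemannian" and q0 :: 'b
  assumes K: "K = fiber M F q0"
    and dim_vertical: "\<And>p. p \<in> points M \<Longrightarrow> dim (vertical M N F p) = DIM('k)"
begin

lemma mtop_K: "mtop K = subtopology (mtop M) {p \<in> points M. F p = q0}"
  unfolding K fiber_def submanifold_def by (simp add: Let_def)

lemma points_K: "points K = {p \<in> points M. F p = q0}"
  unfolding mtop_K by auto

lemma points_KD: "p \<in> points K \<Longrightarrow> p \<in> points M" "p \<in> points K \<Longrightarrow> F p = q0"
  unfolding points_K by auto

lemma atlas_K:
  "c \<in> atlas K \<longleftrightarrow> is_chart (mtop K) c \<and>
     (\<forall>d \<in> atlas M. smooth_on (snd d \<circ> param c) (snd c ` (fst c \<inter> fst d))) \<and>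
     (\<forall>p \<in> fst c. inj (fder (snd (chart_at M p) \<circ> param c) (snd c p)))"
  unfolding mtop_K unfolding K fiber_def submanifold_def by (simp add: Let_def)

lemma metric_K:
  "metric K p u v = metric M p (fder (snd (chart_at M p) \<circ> param (chart_at K p)) (coord_at K p) u)
     (fder (snd (chart_at M p) \<circ> param (chart_at K p)) (coord_at K p) v)"
proof -
  let ?S = "submanifold M {p \<in> points M. F p = q0} :: ('a, 'k) manifold"
  have ch: "chart_at ?S p = chart_at K p" for p
    unfolding chart_at_def K fiber_def by (simp add: Let_def)
  have "tangent_map ?S M id p = fder (snd (chart_at M p) \<circ> param (chart_at K p)) (coord_at K p)"
    unfolding tangent_map_def coord_at_def ch by (simp add: comp_def)
  then show ?thesis by (simp add: K fiber_def Let_def)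
qed

lemma chart_K: "c \<in> atlas K \<Longrightarrow> is_chart (mtop K) c"
  unfolding atlas_K by blast

lemma chart_points_K: "c \<in> atlas K \<Longrightarrow> q \<in> fst c \<Longrightarrow> q \<in> points K"
  using is_chart_facts(2)[OF chart_K] by blast

lemma open_chart_image_K:
  assumes c: "is_chart (mtop K) c" and T: "openin (mtop M) T"
  shows "open (snd c ` (fst c \<inter> T))"
proof -
  have "openin (mtop K) (T \<inter> {p \<in> points M. F p = q0})"
    unfolding mtop_K openin_subtopology using T by blast
  moreover have "fst c \<inter> (T \<inter> {p \<in> points M. F p = q0}) = fst c \<inter> T"
    using is_chart_facts(2)[OF c] unfolding points_K by blast
  ultimately show ?thesis using open_chart_image[OF c] by metis
qed

text \<open>
  The atlas of the fiber is a set of charts singled out by a property, and tensors at \<open>p\<close> are read off in a chosen member around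
  \<open>p\<close>. Hence such a member has to be produced: the parametrization of the level set, carried to the manifold.
\<close>

lemma fiber_chart_exists:
  assumes p: "p \<in> points K"
  shows "\<exists>c \<in> atlas K. p \<in> fst c"
proof -
  note pM = points_KD(1)[OF p]
  let ?m = "chart_at M p" and ?n = "chart_at N (F p)"
  let ?f = "F_rep ?m ?n"
  note m = M.chart_at[OF pM] and n = N.chart_at[OF F_points[OF pM]]
  have pm: "param ?m (snd ?m p) = p" using param_coord[OF M.chart[OF m(1)] m(2)] .
  have x0: "snd ?m p \<in> F_dom ?m ?n" using m n by blast
  have kernel: "{u. fder ?f (snd ?m p) u = 0} = vertical M N F p"
    unfolding vertical_def tangent_map_eq ..
  have "dim {u. fder ?f (snd ?m p) u = 0} = DIM('k)"
    unfolding kernel using dim_vertical[OF pM] .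
  note straightening = level_set_straightening[OF open_F_dom[OF m(1) n(1)] x0 smooth_F_rep[OF m(1) n(1)]
      surj_fder_F_rep[OF m n] this]
  obtain U T and \<alpha> :: "'e \<Rightarrow> 'k" and \<beta> where s:
    "open U" "snd ?m p \<in> U" "U \<subseteq> F_dom ?m ?n" "open T" "continuous_on U \<alpha>" "smooth_on \<beta> T"
    "\<And>t. t \<in> T \<Longrightarrow> \<beta> t \<in> U" "\<And>t. t \<in> T \<Longrightarrow> ?f (\<beta> t) = ?f (snd ?m p)" "\<And>t. t \<in> T \<Longrightarrow> \<alpha> (\<beta> t) = t"
    "\<And>y. y \<in> U \<Longrightarrow> ?f y = ?f (snd ?m p) \<Longrightarrow> \<alpha> y \<in> T"
    "\<And>y. y \<in> U \<Longrightarrow> ?f y = ?f (snd ?m p) \<Longrightarrow> \<beta> (\<alpha> y) = y"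
    "\<And>t. t \<in> T \<Longrightarrow> inj (fder \<beta> t)" by (rule straightening) (rule that; assumption | blast)
  define C where "C = {q \<in> fst ?m. F q = q0 \<and> snd ?m q \<in> U}"
  define c where "c = (C, \<alpha> \<circ> snd ?m)"
  define \<omega> where "\<omega> = param ?m \<circ> \<beta>"
  have Fp: "F p = q0" using points_KD(2)[OF p] .
  have f_p: "?f (snd ?m p) = snd ?n q0" by (simp add: pm Fp)
  have \<omega>: "\<omega> t \<in> C" "snd ?m (\<omega> t) = \<beta> t" "\<alpha> (snd ?m (\<omega> t)) = t" if t: "t \<in> T" for t
  proof -
    have dom: "\<beta> t \<in> F_dom ?m ?n" using s(3,7) t by blast
    note q = param_in_image[OF M.chart[OF m(1)] dom]
    have "snd ?n (F (param ?m (\<beta> t))) = snd ?n q0" using s(8)[OF t] f_p by simp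
    then have "F (param ?m (\<beta> t)) = q0"
      using is_chart_facts(4)[OF N.chart[OF n(1)]] q(2) n(2) Fp by (auto dest: inj_onD)
    then show "\<omega> t \<in> C" unfolding C_def \<omega>_def using q s(7)[OF t] by simp
    show "snd ?m (\<omega> t) = \<beta> t" unfolding \<omega>_def using q(3) by simp
    then show "\<alpha> (snd ?m (\<omega> t)) = t" using s(9)[OF t] by simp
  qed
  have \<psi>: "\<alpha> (snd ?m q) \<in> T" "\<omega> (\<alpha> (snd ?m q)) = q" if q: "q \<in> C" for q
  proof -
    have pq: "param ?m (snd ?m q) = q" using q param_coord[OF M.chart[OF m(1)]] unfolding C_def by blast
    have "?f (snd ?m q) = ?f (snd ?m p)" unfolding f_p using q by (simp add: pq C_def)
    then show "\<alpha> (snd ?m q) \<in> T" "\<omega> (\<alpha> (snd ?m q)) = q"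
      using s(10,11)[of "snd ?m q"] q pq unfolding \<omega>_def C_def by auto
  qed
  have image: "snd c ` fst c = T"
  proof
    show "snd c ` fst c \<subseteq> T" using \<psi>(1) by (auto simp: c_def)
    show "T \<subseteq> snd c ` fst c"
    proof
      fix t assume "t \<in> T"
      then have "t = snd c (\<omega> t)" "\<omega> t \<in> fst c" using \<omega> by (auto simp: c_def)
      then show "t \<in> snd c ` fst c" by blast
    qed
  qed
  have openC: "openin (mtop K) C"
  proof -
    have "C = {q \<in> fst ?m. snd ?m q \<in> U} \<inter> {p \<in> points M. F p = q0}"
      unfolding C_def using M.chart_points[OF m(1)] by blast
    then show ?thesis
      unfolding mtop_K openin_subtopology using openin_chart_preimage[OF M.chart[OF m(1)] s(1)] by blast
  qed
  have CM: "C \<subseteq> points M" "C \<subseteq> fst ?m" using M.chart_points[OF m(1)] unfolding C_def by auto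
  have subC: "subtopology (mtop K) C = subtopology (mtop M) C"
    unfolding mtop_K subtopology_subtopology using CM(1) by (simp add: C_def Int_absorb1 Collect_conj_eq subset_iff cong: conj_cong)
  have hm: "homeomorphic_maps (subtopology (mtop M) (fst ?m)) (top_of_set (snd ?m ` fst ?m)) (snd ?m) (param ?m)"
    using homeomorphic_maps_chart[OF M.chart[OF m(1)]] .
  have "homeomorphic_maps (subtopology (mtop K) C) (top_of_set T) (\<alpha> \<circ> snd ?m) \<omega>"
    unfolding homeomorphic_maps_def subC
  proof (intro conjI ballI)
    have "continuous_map (subtopology (mtop M) (fst ?m)) euclidean (snd ?m)"
      using hm unfolding homeomorphic_maps_def continuous_map_in_subtopology by blast
    then have "continuous_map (subtopology (mtop M) C) (top_of_set U) (snd ?m)"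
      using continuous_map_from_subtopology_mono[OF _ CM(2)] unfolding continuous_map_in_subtopology
      by (auto simp: C_def)
    moreover have "continuous_map (top_of_set U) euclidean \<alpha>" using s(5) by simp
    ultimately have "continuous_map (subtopology (mtop M) C) euclidean (\<alpha> \<circ> snd ?m)"
      using continuous_map_compose by blast
    then show "continuous_map (subtopology (mtop M) C) (top_of_set T) (\<alpha> \<circ> snd ?m)"
      unfolding continuous_map_in_subtopology using \<psi>(1) by auto
    have "continuous_map (top_of_set T) (top_of_set (snd ?m ` fst ?m)) \<beta>"
      unfolding continuous_map_in_subtopology
      using smooth_on_imp_continuous_on[OF s(6)] s(3,7) by auto
    moreover have "continuous_map (top_of_set (snd ?m ` fst ?m)) (mtop M) (param ?m)"
      using hm unfolding homeomorphic_maps_def continuous_map_in_subtopology by blast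
    ultimately have "continuous_map (top_of_set T) (mtop M) \<omega>"
      unfolding \<omega>_def by (rule continuous_map_compose)
    then show "continuous_map (top_of_set T) (subtopology (mtop M) C) \<omega>"
      unfolding continuous_map_in_subtopology using \<omega>(1) by auto
  qed (use \<omega> \<psi> in auto)
  then have isc: "is_chart (mtop K) c"
    unfolding is_chart_def image using openC s(4) homeomorphic_maps_imp_map by (auto simp: c_def)
  have param: "param c t = \<omega> t" if "t \<in> T" for t
  proof -
    have "snd c (\<omega> t) = t" "\<omega> t \<in> fst c" using \<omega>[OF that] by (auto simp: c_def)
    then show ?thesis using param_coord[OF isc] by metis
  qed
  have rep: "smooth_on (snd d \<circ> param c) (snd c ` (fst c \<inter> fst d))" if d: "d \<in> atlas M" for d
  proof -
    let ?T = "snd c ` (fst c \<inter> fst d)"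
    have oT: "open ?T" using open_chart_image_K[OF isc is_chart_facts(1)[OF M.chart[OF d]]] .
    have TT: "?T \<subseteq> T" using image by blast
    have "smooth_on (\<lambda>t. (snd d \<circ> param ?m) (\<beta> t)) ?T"
    proof (rule smooth_on_compose[OF oT M.open_overlap[OF m(1) d] _ M.smooth_transition[OF m(1) d]
          smooth_on_subset[OF s(6) TT]], rule image_subsetI)
      fix t assume t: "t \<in> ?T"
      then have "param c t \<in> fst d" using param_in_image(2)[OF isc t] by blast
      then have "\<omega> t \<in> fst d" "\<omega> t \<in> fst ?m" "snd ?m (\<omega> t) = \<beta> t"
        using t TT param \<omega> CM(2) by (metis subsetD)+
      then show "\<beta> t \<in> snd ?m ` (fst ?m \<inter> fst d)" by (metis IntI imageI)
    qed
    then show ?thesis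
      by (rule smooth_on_cong[OF oT, rotated]) (use TT param in \<open>auto simp: \<omega>_def\<close>)
  qed
  have "inj (fder (snd (chart_at M q) \<circ> param c) (snd c q))" if q: "q \<in> fst c" for q
  proof -
    have qC: "q \<in> C" using q by (simp add: c_def)
    then have qM: "q \<in> points M" "q \<in> fst ?m" using CM by auto
    let ?d = "chart_at M q" and ?t = "snd c q"
    note d = M.chart_at[OF qM(1)]
    have t: "?t \<in> T" using image q by blast
    have \<beta>t: "\<beta> ?t = snd ?m q" using \<omega>(2)[OF t] \<psi>(2)[OF qC] by (simp add: c_def)
    have 1: "(\<beta> has_derivative fder \<beta> ?t) (at ?t)" using smooth_on_has_derivative[OF s(6,4) t] .
    have 2: "((snd ?d \<circ> param ?m) has_derivative change ?m ?d q) (at (\<beta> ?t))"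
      unfolding \<beta>t using M.change_has_derivative[OF m(1) d(1) qM(2) d(2)] .
    have 3: "((snd ?d \<circ> param c) has_derivative (change ?m ?d q \<circ> fder \<beta> ?t)) (at ?t)"
      by (rule has_derivative_transform_within_open[OF diff_chain_at[OF 1 2] s(4) t]) (simp add: param \<omega>_def)
    show ?thesis
      unfolding fder_eq[OF 3] using inj_compose[OF M.inj_change[OF m(1) qM(2) d] s(12)[OF t]] .
  qed
  then have "c \<in> atlas K" unfolding atlas_K using isc rep by blast
  moreover have "p \<in> fst c" using m(2) Fp s(2) by (simp add: c_def C_def)
  ultimately show ?thesis by blast
qed

lemma chart_at_K:
  assumes "p \<in> points K"
  shows "chart_at K p \<in> atlas K" "p \<in> fst (chart_at K p)"
proof -
  have "\<exists>c. c \<in> atlas K \<and> p \<in> fst c" using fiber_chart_exists[OF assms] by blast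
  from someI_ex[OF this] show "chart_at K p \<in> atlas K" "p \<in> fst (chart_at K p)"
    unfolding chart_at_def by auto
qed

abbreviation "incl c m \<equiv> snd m \<circ> param c"

abbreviation "incl_dom c m \<equiv> snd c ` (fst c \<inter> fst m)"

lemma open_incl_dom:
  assumes "c \<in> atlas K" "m \<in> atlas M"
  shows "open (incl_dom c m)"
  using open_chart_image_K[OF chart_K is_chart_facts(1)[OF M.chart]] assms by blast

lemma smooth_incl:
  assumes "c \<in> atlas K" "m \<in> atlas M"
  shows "smooth_on (incl c m) (incl_dom c m)"
  using assms unfolding atlas_K by blast

lemma incl_has_derivative:
  assumes "c \<in> atlas K" "q \<in> fst c" "m \<in> atlas M" "q \<in> fst m"
  shows "(incl c m has_derivative fder (incl c m) (snd c q)) (at (snd c q))"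
  using smooth_on_has_derivative[OF smooth_incl open_incl_dom] assms by blast

lemma fder_incl_change:
  assumes c: "c \<in> atlas K" "q \<in> fst c" and m: "m \<in> atlas M" "q \<in> fst m" and d: "d \<in> atlas M" "q \<in> fst d"
  shows "fder (incl c d) (snd c q) = change m d q \<circ> fder (incl c m) (snd c q)"
proof -
  have q: "param c (snd c q) = q" using param_coord[OF chart_K[OF c(1)] c(2)] .
  have "((snd d \<circ> param m) has_derivative change m d q) (at (incl c m (snd c q)))"
    using M.change_has_derivative[OF m(1) d(1) m(2) d(2)] by (simp add: q)
  from diff_chain_at[OF incl_has_derivative[OF c m] this]
  have 1: "((snd d \<circ> param m) \<circ> incl c m has_derivative change m d q \<circ> fder (incl c m) (snd c q)) (at (snd c q))" .
  show ?thesis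
  proof (rule fder_eq, rule has_derivative_transform_within_open[OF 1 open_incl_dom[OF c(1) m(1)]])
    show "snd c q \<in> incl_dom c m" using c m by blast
    fix x assume x: "x \<in> incl_dom c m"
    show "((snd d \<circ> param m) \<circ> incl c m) x = incl c d x"
      using param_coord[OF M.chart[OF m(1)] param_in_image(2)[OF chart_K[OF c(1)] x]] by simp
  qed
qed

lemma inj_fder_incl:
  assumes c: "c \<in> atlas K" "q \<in> fst c" and m: "m \<in> atlas M" "q \<in> fst m"
  shows "inj (fder (incl c m) (snd c q))"
proof -
  have q: "q \<in> points M" using M.chart_points m by blast
  note d = M.chart_at[OF q]
  have "inj (fder (incl c (chart_at M q)) (snd c q))" using c unfolding atlas_K by blast
  then show ?thesis
    unfolding fder_incl_change[OF c d m] using inj_compose[OF M.inj_change[OF d m]] by blast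
qed

text \<open>
  Charts of the fiber are only related through the ambient manifold. Composed with a left inverse of its derivative at the
  point, the inclusion in the chart \<open>d\<close> becomes a local diffeomorphism; the transition map is its local inverse
  after the inclusion in the chart \<open>c\<close>.
\<close>

lemma fiber_transition_differentiable:
  assumes c: "c \<in> atlas K" "q \<in> fst c" and d: "d \<in> atlas K" "q \<in> fst d"
  shows "(snd d \<circ> param c) differentiable (at (snd c q))"
proof -
  have q: "q \<in> points M" using points_KD chart_points_K c by blast
  let ?m = "chart_at M q"
  note m = M.chart_at[OF q]
  let ?y = "snd d q"
  have y: "?y \<in> incl_dom d ?m" using d m by blast
  note od = open_incl_dom[OF d(1) m(1)] and oc = open_incl_dom[OF c(1) m(1)]
  have lin: "linear (fder (incl d ?m) ?y)"
    using smooth_on_linear_fder[OF smooth_incl[OF d(1) m(1)] od y] .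
  obtain L where L: "linear L" "L \<circ> fder (incl d ?m) ?y = id"
    using linear_injective_left_inverse[OF lin inj_fder_incl[OF d m]] by blast
  have bL: "bounded_linear L" using L(1) linear_conv_bounded_linear by blast
  let ?f = "\<lambda>z. L (incl d ?m z)"
  have f: "smooth_on ?f (incl_dom d ?m)"
    using smooth_on_bounded_linear[OF od bL smooth_incl[OF d(1) m(1)]] .
  have "fder ?f ?y = (\<lambda>h. L (fder (incl d ?m) ?y h))"
    by (rule fder_eq[OF bounded_linear.has_derivative[OF bL incl_has_derivative[OF d m]]])
  then have "inj (fder ?f ?y)" using L(2) by (simp add: o_def id_def inj_on_def fun_eq_iff)
  note inverse = smooth_local_inverse[OF od y f this]
  obtain U V g where UV:
    "open U" "U \<subseteq> incl_dom d ?m" "?y \<in> U" "open V" "?f ?y \<in> V" "homeomorphism U V ?f g" "smooth_on g V"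
    "\<And>x. x \<in> U \<Longrightarrow> inj (fder ?f x)" "\<And>y. y \<in> V \<Longrightarrow> inj (fder g y)" by (rule inverse) (rule that; assumption | blast)
  define T where "T = {a \<in> fst d. snd d a \<in> U} \<inter> (points K \<inter> fst ?m)"
  have T: "openin (mtop K) T"
  proof -
    have "openin (mtop K) (fst ?m \<inter> {p \<in> points M. F p = q0})"
      unfolding mtop_K openin_subtopology using is_chart_facts(1)[OF M.chart[OF m(1)]] by blast
    moreover have "points K \<inter> fst ?m = fst ?m \<inter> {p \<in> points M. F p = q0}" unfolding points_K by blast
    ultimately show ?thesis
      unfolding T_def using openin_chart_preimage[OF chart_K[OF d(1)] UV(1)] by (simp add: openin_Int)
  qed
  let ?S = "snd c ` (fst c \<inter> T)"
  have S: "open ?S" using open_chart_image[OF chart_K[OF c(1)] T] .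
  have x: "snd c q \<in> ?S" using c d m UV(3) chart_points_K[OF c] by (auto simp: T_def)
  have pc: "param c (snd c q) = q" and pd: "param d (snd d q) = q"
    using param_coord[OF chart_K] c d by blast+
  have "incl d ?m ?y = incl c ?m (snd c q)" by (simp add: pc pd)
  then have "(g has_derivative fder g (L (incl c ?m (snd c q)))) (at (L (incl c ?m (snd c q))))"
    using smooth_on_has_derivative[OF UV(7,4,5)] by simp
  from diff_chain_at[OF bounded_linear.has_derivative[OF bL incl_has_derivative[OF c m]] this]
  have 1: "(g \<circ> (\<lambda>x. L (incl c ?m x)) has_derivative
      fder g (L (incl c ?m (snd c q))) \<circ> (\<lambda>h. L (fder (incl c ?m) (snd c q) h))) (at (snd c q))" .
  have "(snd d \<circ> param c has_derivative
      fder g (L (incl c ?m (snd c q))) \<circ> (\<lambda>h. L (fder (incl c ?m) (snd c q) h))) (at (snd c q))"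
  proof (rule has_derivative_transform_within_open[OF 1 S x])
    fix z assume z: "z \<in> ?S"
    have a: "param c z \<in> T" using param_in_image(2)[OF chart_K[OF c(1)] z] .
    then have "snd d (param c z) \<in> U" "param d (snd d (param c z)) = param c z"
      using param_coord[OF chart_K[OF d(1)]] by (auto simp: T_def)
    then show "(g \<circ> (\<lambda>x. L (incl c ?m x))) z = (snd d \<circ> param c) z"
      using UV(6) by (fastforce simp: homeomorphism_def)
  qed
  then show ?thesis by (rule differentiableI)
qed

lemma fder_incl_transition:
  assumes c: "c \<in> atlas K" "q \<in> fst c" and d: "d \<in> atlas K" "q \<in> fst d" and m: "m \<in> atlas M" "q \<in> fst m"
  shows "fder (incl d m) (snd d q) (change c d q u) = fder (incl c m) (snd c q) u"
proof -
  have pc: "param c (snd c q) = q" using param_coord[OF chart_K[OF c(1)] c(2)] .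
  have 1: "((snd d \<circ> param c) has_derivative change c d q) (at (snd c q))"
    unfolding change_def using fiber_transition_differentiable[OF c d] frechet_derivative_works by blast
  have "(incl d m has_derivative fder (incl d m) (snd d q)) (at ((snd d \<circ> param c) (snd c q)))"
    using incl_has_derivative[OF d m] by (simp add: pc)
  from diff_chain_at[OF 1 this]
  have 2: "(incl d m \<circ> (snd d \<circ> param c) has_derivative fder (incl d m) (snd d q) \<circ> change c d q) (at (snd c q))" .
  have oT: "open (snd c ` (fst c \<inter> fst d))"
    using open_chart_image[OF chart_K[OF c(1)] is_chart_facts(1)[OF chart_K[OF d(1)]]] .
  have "(incl c m has_derivative fder (incl d m) (snd d q) \<circ> change c d q) (at (snd c q))"
  proof (rule has_derivative_transform_within_open[OF 2 oT])
    show "snd c q \<in> snd c ` (fst c \<inter> fst d)" using c d by blast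
    fix x assume x: "x \<in> snd c ` (fst c \<inter> fst d)"
    show "(incl d m \<circ> (snd d \<circ> param c)) x = incl c m x"
      using param_coord[OF chart_K[OF d(1)] param_in_image(2)[OF chart_K[OF c(1)] x]] by simp
  qed
  from fder_eq[OF this] show ?thesis by simp
qed

text \<open>
  The metric of the fiber is defined through the distinguished charts, which change from point to point. By the chain rule,
  its representative in a fixed chart is the pullback of the ambient one.
\<close>

lemma metric_rep_K:
  assumes c: "c \<in> atlas K" and m: "m \<in> atlas M" and x: "x \<in> incl_dom c m"
  shows "metric_rep K c x u v = metric_rep M m (incl c m x) (fder (incl c m) x u) (fder (incl c m) x v)"
proof -
  let ?q = "param c x"
  note q = param_in_image[OF chart_K[OF c] x]
  have qK: "?q \<in> points K" using chart_points_K c q by blast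
  let ?d = "chart_at K ?q" and ?m = "chart_at M ?q"
  note d = chart_at_K[OF qK] and m' = M.chart_at[OF points_KD(1)[OF qK]]
  have rep: "metric_rep K c x u v = metric K ?q (change c ?d ?q u) (change c ?d ?q v)" for u v
    unfolding metric_rep_def form_rep_def Let_def ..
  have "fder (incl ?d ?m) (coord_at K ?q) (change c ?d ?q u) = change m ?m ?q (fder (incl c m) x u)" for u
    using fder_incl_transition[OF c q(1) d m', of u] fder_incl_change[OF c q(1) m q(2) m'] q(3)
    by (simp add: coord_at_def)
  then show ?thesis
    unfolding rep metric_K using M.metric_rep_change[OF m q(2)] by simp
qed

end

lemma (in map_into_metric) local_metric_pullback:
  assumes inj: "\<And>y. y \<in> S \<Longrightarrow> inj (fder \<phi> y)"
    and eq: "\<And>y u v. y \<in> S \<Longrightarrow> G' y u v = G (\<phi> y) (fder \<phi> y u) (fder \<phi> y v)"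
  shows "local_metric G' S"
  unfolding local_metric_def
proof (intro conjI ballI allI)
  show "inner_form (G' y)" if y: "y \<in> S" for y
  proof -
    have "G' y = (\<lambda>u v. G (\<phi> y) (fder \<phi> y u) (fder \<phi> y v))" using eq[OF y] by blast
    then show ?thesis
      using inner_form_pullback[OF local_metricD(2)[OF G \<phi>U[OF y]] smooth_on_linear_fder[OF \<phi> S y] inj[OF y]]
      by simp
  qed
  fix u v
  have sm: "smooth_on (\<lambda>y. \<Sum>i\<in>Basis. (fder \<phi> y u \<bullet> i) *\<^sub>R (\<Sum>j\<in>Basis. (fder \<phi> y v \<bullet> j) *\<^sub>R G (\<phi> y) i j)) S"
    by (intro smooth_on_sum smooth_on_scaleR smooth_on_bounded_linear[OF S bounded_linear_inner_left]
        smooth_on_fder \<phi> S smooth_on_compose[OF S local_metricD(1)[OF G] \<phi>S local_metricD(3)[OF G]])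
  show "smooth_on (\<lambda>y. G' y u v) S"
  proof (rule smooth_on_cong[OF S _ sm])
    fix y assume y: "y \<in> S"
    show "(\<Sum>i\<in>Basis. (fder \<phi> y u \<bullet> i) *\<^sub>R (\<Sum>j\<in>Basis. (fder \<phi> y v \<bullet> j) *\<^sub>R G (\<phi> y) i j)) = G' y u v"
      unfolding eq[OF y] by (rule bilinear_sum_Basis[OF local_metricD(4)[OF G \<phi>U[OF y]], symmetric])
  qed
qed (rule S)

section \<open>The Gauss equation of the fibers\<close>

context submersion_fiber
begin

lemma isometric_incl:
  assumes c: "c \<in> atlas K" and m: "m \<in> atlas M"
  shows "isometric_map (metric_rep M m) (snd m ` fst m) (incl c m) (incl_dom c m) (metric_rep K c)"
proof -
  have sub: "incl c m ` incl_dom c m \<subseteq> snd m ` fst m"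
  proof
    fix y assume "y \<in> incl c m ` incl_dom c m"
    then obtain x where x: "x \<in> incl_dom c m" "y = snd m (param c x)" by auto
    show "y \<in> snd m ` fst m" unfolding x(2) using param_in_image(2)[OF chart_K[OF c] x(1)] by blast
  qed
  interpret map_into_metric "metric_rep M m" "snd m ` fst m" "incl c m" "incl_dom c m"
    by unfold_locales (use M.local_metric_rep[OF m] open_incl_dom[OF c m] smooth_incl[OF c m] sub in auto)
  have "local_metric (metric_rep K c) (incl_dom c m)"
  proof (rule local_metric_pullback)
    fix x assume x: "x \<in> incl_dom c m"
    note q = param_in_image[OF chart_K[OF c] x]
    show "inj (fder (incl c m) x)" using inj_fder_incl[OF c q(1) m q(2)] unfolding q(3) .
    show "metric_rep K c x u v = metric_rep M m (incl c m x) (fder (incl c m) x u) (fder (incl c m) x v)" for u v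
      using metric_rep_K[OF c m x] .
  qed
  then show ?thesis by unfold_locales (use metric_rep_K[OF c m] in auto)
qed

lemma fder_incl_kernel:
  assumes c: "c \<in> atlas K" "q \<in> fst c" and m: "m \<in> atlas M" "q \<in> fst m" and d: "d \<in> atlas N" "q0 \<in> fst d"
  shows "fder (F_rep m d) (snd m q) (fder (incl c m) (snd c q) u) = 0"
proof -
  have pc: "param c (snd c q) = q" using param_coord[OF chart_K[OF c(1)] c(2)] .
  have Fq: "F a = q0" if "a \<in> fst c" for a using points_KD(2) chart_points_K[OF c(1) that] by blast
  have "(F_rep m d has_derivative fder (F_rep m d) (snd m q)) (at (incl c m (snd c q)))"
    using F_rep_has_derivative[OF m d(1)] d(2) Fq[OF c(2)] by (simp add: pc)
  from diff_chain_at[OF incl_has_derivative[OF c m] this]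
  have 1: "(F_rep m d \<circ> incl c m has_derivative fder (F_rep m d) (snd m q) \<circ> fder (incl c m) (snd c q)) (at (snd c q))" .
  have "((\<lambda>_. snd d q0) has_derivative fder (F_rep m d) (snd m q) \<circ> fder (incl c m) (snd c q)) (at (snd c q))"
  proof (rule has_derivative_transform_within_open[OF 1 open_incl_dom[OF c(1) m(1)]])
    show "snd c q \<in> incl_dom c m" using c m by blast
    fix x assume x: "x \<in> incl_dom c m"
    note a = param_in_image[OF chart_K[OF c(1)] x]
    show "(F_rep m d \<circ> incl c m) x = snd d q0"
      using param_coord[OF M.chart[OF m(1)] a(2)] Fq[OF a(1)] by simp
  qed
  then have "fder (F_rep m d) (snd m q) \<circ> fder (incl c m) (snd c q) = (\<lambda>_. 0)"
    using has_derivative_const has_derivative_unique by blast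
  then show ?thesis by (metis comp_apply)
qed

abbreviation "incl_at p \<equiv> incl (chart_at K p) (chart_at M p)"

abbreviation "d_incl p \<equiv> fder (incl_at p) (coord_at K p)"

lemma incl_at_coord: "p \<in> points K \<Longrightarrow> incl_at p (coord_at K p) = coord_at M p"
  unfolding coord_at_def using param_coord[OF chart_K[OF chart_at_K(1)] chart_at_K(2)] by simp

lemma coord_in_dom: "p \<in> points K \<Longrightarrow> coord_at K p \<in> incl_dom (chart_at K p) (chart_at M p)"
  unfolding coord_at_def using chart_at_K M.chart_at[OF points_KD(1)] by blast

lemma linear_d_incl: "p \<in> points K \<Longrightarrow> linear (d_incl p)"
  unfolding coord_at_def
  using incl_has_derivative[OF chart_at_K M.chart_at[OF points_KD(1)]] has_derivative_linear by blast

lemma inj_d_incl: "p \<in> points K \<Longrightarrow> inj (d_incl p)"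
  unfolding coord_at_def using inj_fder_incl[OF chart_at_K M.chart_at[OF points_KD(1)]] .

lemma d_incl_vertical:
  assumes p: "p \<in> points K"
  shows "d_incl p u \<in> vertical M N F p"
proof -
  note pM = points_KD(1)[OF p]
  have "q0 \<in> fst (chart_at N (F p))" using N.chart_at(2)[OF F_points[OF pM]] points_KD(2)[OF p] by simp
  then show ?thesis
    using fder_incl_kernel[OF chart_at_K[OF p] M.chart_at[OF pM] N.chart_at(1)[OF F_points[OF pM]]]
    unfolding vertical_def tangent_map_eq coord_at_def by simp
qed

lemma range_d_incl:
  assumes p: "p \<in> points K"
  shows "range (d_incl p) = vertical M N F p"
proof (rule subspace_dim_equal)
  show "subspace (range (d_incl p))" using linear_subspace_image[OF linear_d_incl[OF p] subspace_UNIV] .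
  show "subspace (vertical M N F p)" using subspace_vertical points_KD(1)[OF p] by blast
  show "range (d_incl p) \<subseteq> vertical M N F p" using d_incl_vertical[OF p] by blast
  have "dim (range (d_incl p)) = dim (UNIV :: 'k set)"
    using dim_image_eq[OF linear_d_incl[OF p]] inj_d_incl[OF p] by (simp add: inj_on_subset)
  then show "dim (vertical M N F p) \<le> dim (range (d_incl p))"
    using dim_vertical[OF points_KD(1)[OF p]] by simp
qed

lemma metric_rep_K_at:
  assumes p: "p \<in> points K"
  shows "metric_rep K (chart_at K p) (coord_at K p) u v = metric K p u v"
  unfolding metric_rep_K[OF chart_at_K(1)[OF p] M.chart_at(1)[OF points_KD(1)[OF p]] coord_in_dom[OF p]]
    incl_at_coord[OF p] metric_K M.metric_rep_at[OF points_KD(1)[OF p]] ..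

lemma inner_form_K: "p \<in> points K \<Longrightarrow> inner_form (metric K p)"
  unfolding metric_K[abs_def]
  using inner_form_pullback[OF M.metric_form[OF points_KD(1)] linear_d_incl inj_d_incl] .

text \<open>
  Vectors tangent to the fiber are fixed by the vertical projection: \<open>V (\<iota> y) (d\<iota> y v) = d\<iota> y v\<close> for the inclusion \<open>\<iota>\<close> of the
  fiber. Differentiating this in the direction \<open>u\<close> and taking the component along \<open>a\<close> turns the derivative of the
  projection into the second derivative of \<open>\<iota>\<close>.
\<close>

lemma fiber_form_hessian:
  assumes p: "p \<in> points K" and a: "a \<in> horizontal M N F p"
  shows "fiber_form p a (d_incl p u) (d_incl p v) =
    metric M p (hessian_along (metric_rep M (chart_at M p)) (incl_at p) u v (coord_at K p)) a"
proof -
  let ?c = "chart_at K p" and ?m = "chart_at M p" and ?x = "coord_at K p"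
  let ?X = "\<lambda>x. fder (incl_at p) x v" and ?S = "incl_dom ?c ?m"
  note pM = points_KD(1)[OF p]
  note c = chart_at_K[OF p] and m = M.chart_at[OF pM]
  note S = open_incl_dom[OF c(1) m(1)] and x = coord_in_dom[OF p]
  note b = M.metric_form[OF pM]
  interpret isometric_map "metric_rep M ?m" "snd ?m ` fst ?m" "incl_at p" ?S "metric_rep K ?c"
    using isometric_incl[OF c(1) m(1)] .
  have X: "(?X has_derivative fder ?X ?x) (at ?x)"
    using smooth_on_has_derivative[OF smooth_on_fder[OF \<phi>] S x] .
  have fixed: "1 *\<^sub>R V_rep ?m (incl_at p y) (?X y) = ?X y" if y: "y \<in> ?S" for y
  proof -
    note q = param_in_image[OF chart_K[OF c(1)] y]
    have Fq: "F (param ?c y) = q0" using points_KD(2) chart_points_K[OF c(1) q(1)] by blast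
    have n: "q0 \<in> fst (chart_at N q0)" "chart_at N q0 \<in> atlas N"
      using N.chart_at F_points[OF pM] points_KD(2)[OF p] by auto
    have "fder (F_rep ?m (chart_at N q0)) (snd ?m (param ?c y)) (?X y) = 0"
      using fder_incl_kernel[OF c(1) q(1) m(1) q(2) n(2,1)] unfolding q(3) .
    then show ?thesis using V_rep_fder(3)[OF m(1) q(2) n(2)] n(1) Fq by simp
  qed
  \<comment> \<open>The scalar 1 makes the linear map \<open>V_rep\<close> a bilinear one, so that the product rule applies.\<close>
  have "((\<lambda>y. 1 *\<^sub>R V_rep ?m (incl_at p y) (?X y)) has_derivative
      (\<lambda>h. fder (\<lambda>z. 1 *\<^sub>R V_rep ?m z (?X ?x)) (incl_at p ?x) (fder (incl_at p) ?x h)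
        + 1 *\<^sub>R V_rep ?m (incl_at p ?x) (fder ?X ?x h) + 0 *\<^sub>R V_rep ?m (incl_at p ?x) (?X ?x))) (at ?x)"
  proof (rule has_derivative_bilinear_field[where G="\<lambda>z w (t::real). t *\<^sub>R V_rep ?m z w"
        and Y="\<lambda>_. 1" and Y'="\<lambda>_. 0", OF S x local_metricD(1)[OF G] \<phi>S])
    show "bilinear (\<lambda>w (t::real). t *\<^sub>R V_rep ?m z w)" if "z \<in> snd ?m ` fst ?m" for z
    proof -
      have "linear (V_rep ?m z)" using that linear_V_rep[OF m(1)] by blast
      then show ?thesis
        unfolding bilinear_def
        by (auto intro!: linearI simp: linear_add linear_cmul scaleR_add_left scaleR_add_right)
    qed
    show "(\<lambda>z. t *\<^sub>R V_rep ?m z w) differentiable (at (incl_at p ?x))" for w and t :: real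
      unfolding incl_at_coord[OF p]
      using V_rep_differentiable[OF pM] differentiable_scaleR differentiable_const by blast
  qed (use deriv_\<phi>[OF x] X in auto)
  then have "(?X has_derivative
      (\<lambda>h. fder (\<lambda>z. 1 *\<^sub>R V_rep ?m z (?X ?x)) (incl_at p ?x) (fder (incl_at p) ?x h)
        + 1 *\<^sub>R V_rep ?m (incl_at p ?x) (fder ?X ?x h) + 0 *\<^sub>R V_rep ?m (incl_at p ?x) (?X ?x))) (at ?x)"
    by (rule has_derivative_transform_within_open[OF _ S x fixed])
  from fun_cong[OF fder_eq[OF this, unfolded incl_at_coord[OF p] V_rep_at[OF pM]], of u]
  have "fder ?X ?x u = fder (\<lambda>z. V_rep ?m z (d_incl p v)) (coord_at M p) (d_incl p u)
      + vproj M N F p (fder ?X ?x u)"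
    by simp
  then have "metric M p (fder ?X ?x u) a =
      metric M p (fder (\<lambda>z. V_rep ?m z (d_incl p v)) (coord_at M p) (d_incl p u) + vproj M N F p (fder ?X ?x u)) a"
    by simp
  also have "\<dots> = metric M p (fder (\<lambda>z. V_rep ?m z (d_incl p v)) (coord_at M p) (d_incl p u)) a"
    using vertical_horizontal[OF pM vproj(1)[OF pM] a] by (simp add: inner_form_simps[OF b])
  finally show ?thesis
    unfolding fiber_form_def cov_along_def incl_at_coord[OF p] by (simp add: inner_form_simps[OF b])
qed

lemma orthonormal_basis_d_incl:
  assumes p: "p \<in> points K" and B: "orthonormal_basis (metric K p) UNIV B"
  shows "orthonormal_basis (metric M p) (vertical M N F p) (d_incl p ` B)"
proof -
  have "span (d_incl p ` B) = vertical M N F p"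
    using B linear_span_image[OF linear_d_incl[OF p]] range_d_incl[OF p]
    unfolding orthonormal_basis_def by auto
  moreover have "metric M p (d_incl p u) (d_incl p v) = (if d_incl p u = d_incl p v then 1 else 0)"
    if "u \<in> B" "v \<in> B" for u v
    using B that inj_d_incl[OF p] unfolding orthonormal_basis_def metric_K[symmetric] by (auto dest: injD)
  ultimately show ?thesis using B unfolding orthonormal_basis_def by auto
qed

text \<open>
  The Gauss equation, traced over the fiber. The second fundamental form is horizontal, so its inner products
  expand over the orthonormal basis \<open>A\<close>.
\<close>

lemma fiber_scalar_curvature:
  assumes p: "p \<in> points K" and BK: "orthonormal_basis (metric K p) UNIV BK"
    and A: "orthonormal_basis (metric M p) (horizontal M N F p) A"
  defines "B \<equiv> d_incl p ` BK"
  shows "(\<Sum>s\<in>BK. \<Sum>t\<in>BK. metric K p (curvature K p s t t) s) =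
    (\<Sum>u\<in>B. \<Sum>v\<in>B. metric M p (curvature M p u v v) u)
    + (\<Sum>a\<in>A. (\<Sum>u\<in>B. fiber_form p a u u)\<^sup>2) - (\<Sum>a\<in>A. \<Sum>u\<in>B. \<Sum>v\<in>B. (fiber_form p a u v)\<^sup>2)"
proof -
  let ?c = "chart_at K p" and ?m = "chart_at M p" and ?x = "coord_at K p"
  let ?L = "d_incl p" and ?g = "metric M p"
  note pM = points_KD(1)[OF p]
  note c = chart_at_K[OF p] and m = M.chart_at[OF pM] and x = coord_in_dom[OF p]
  note b = M.metric_form[OF pM]
  interpret isometric_map "metric_rep M ?m" "snd ?m ` fst ?m" "incl_at p" "incl_dom ?c ?m" "metric_rep K ?c"
    using isometric_incl[OF c(1) m(1)] .
  let ?II = "second_form ?x"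
  have gm: "metric_rep M ?m (incl_at p ?x) = ?g"
    unfolding incl_at_coord[OF p] using M.metric_rep_at[OF pM] by blast
  have II_hor: "?II u v \<in> horizontal M N F p" for u v
  proof -
    have "?g (?II u v) w = 0" if "w \<in> vertical M N F p" for w
      using that second_form_normal[OF x, of u v] unfolding gm range_d_incl[OF p, symmetric] by blast
    then show ?thesis unfolding horizontal_def by blast
  qed
  have II_form: "?g (?II u v) a = fiber_form p a (?L u) (?L v)" if a: "a \<in> A" for u v a
  proof -
    have aH: "a \<in> horizontal M N F p" using orthonormal_basis_subset[OF A a] .
    show ?thesis
      unfolding second_form_def fiber_form_hessian[OF p aH]
      using vertical_horizontal[OF pM d_incl_vertical[OF p] aH] by (simp add: inner_form_simps[OF b])
  qed
  have II_II: "?g (?II s t) (?II s' t') =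
      (\<Sum>a\<in>A. fiber_form p a (?L s) (?L t) * fiber_form p a (?L s') (?L t'))" for s t s' t'
  proof -
    have "?g (?II s t) (?II s' t') = (\<Sum>a\<in>A. ?g (?II s t) a * ?g a (?II s' t'))"
      by (rule orthonormal_basis_parseval[OF b A II_hor])
    also have "\<dots> = (\<Sum>a\<in>A. fiber_form p a (?L s) (?L t) * fiber_form p a (?L s') (?L t'))"
    proof (intro sum.cong refl)
      fix a assume a: "a \<in> A"
      have "?g a (?II s' t') = ?g (?II s' t') a" by (rule inner_form_sym[OF b])
      then show "?g (?II s t) a * ?g a (?II s' t') = fiber_form p a (?L s) (?L t) * fiber_form p a (?L s') (?L t')"
        by (simp only: II_form[OF a])
    qed
    finally show ?thesis .
  qed
  have gauss: "metric K p (curvature K p s t t) s = ?g (curvature M p (?L s) (?L t) (?L t)) (?L s)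
      + (\<Sum>a\<in>A. fiber_form p a (?L t) (?L t) * fiber_form p a (?L s) (?L s))
      - (\<Sum>a\<in>A. (fiber_form p a (?L s) (?L t))\<^sup>2)" for s t
    unfolding curvature_def metric_rep_K_at[OF p, symmetric] gauss_equation[OF x] incl_at_coord[OF p]
      M.metric_rep_at[OF pM] second_form_sym[OF x, of t s] II_II power2_eq_square ..
  have reindex: "(\<Sum>u\<in>B. f u) = (\<Sum>s\<in>BK. f (?L s))" for f :: "'e \<Rightarrow> real"
    unfolding B_def using sum.reindex[OF inj_on_subset[OF inj_d_incl[OF p] subset_UNIV]] by simp
  have sq: "(\<Sum>s\<in>BK. \<Sum>t\<in>BK. \<Sum>a\<in>A. fiber_form p a (?L t) (?L t) * fiber_form p a (?L s) (?L s)) =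
      (\<Sum>a\<in>A. (\<Sum>s\<in>BK. fiber_form p a (?L s) (?L s))\<^sup>2)"
  proof -
    have "(\<Sum>s\<in>BK. \<Sum>t\<in>BK. \<Sum>a\<in>A. fiber_form p a (?L t) (?L t) * fiber_form p a (?L s) (?L s)) =
      (\<Sum>s\<in>BK. \<Sum>a\<in>A. \<Sum>t\<in>BK. fiber_form p a (?L t) (?L t) * fiber_form p a (?L s) (?L s))"
      by (intro sum.cong refl sum.swap)
    also have "\<dots> = (\<Sum>a\<in>A. \<Sum>s\<in>BK. \<Sum>t\<in>BK. fiber_form p a (?L t) (?L t) * fiber_form p a (?L s) (?L s))"
      by (rule sum.swap)
    also have "\<dots> = (\<Sum>a\<in>A. (\<Sum>s\<in>BK. fiber_form p a (?L s) (?L s))\<^sup>2)"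
      by (simp add: power2_eq_square sum_product mult.commute)
    finally show ?thesis .
  qed
  have sw: "(\<Sum>s\<in>BK. \<Sum>t\<in>BK. \<Sum>a\<in>A. (fiber_form p a (?L s) (?L t))\<^sup>2) =
      (\<Sum>a\<in>A. \<Sum>s\<in>BK. \<Sum>t\<in>BK. (fiber_form p a (?L s) (?L t))\<^sup>2)"
  proof -
    have "(\<Sum>s\<in>BK. \<Sum>t\<in>BK. \<Sum>a\<in>A. (fiber_form p a (?L s) (?L t))\<^sup>2) =
      (\<Sum>s\<in>BK. \<Sum>a\<in>A. \<Sum>t\<in>BK. (fiber_form p a (?L s) (?L t))\<^sup>2)"
      by (intro sum.cong refl sum.swap)
    also have "\<dots> = (\<Sum>a\<in>A. \<Sum>s\<in>BK. \<Sum>t\<in>BK. (fiber_form p a (?L s) (?L t))\<^sup>2)" by (rule sum.swap)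
    finally show ?thesis .
  qed
  show ?thesis unfolding reindex gauss sum.distrib sum_subtractf sq sw ..
qed

end

section \<open>Casorati curvatures\<close>

context submersion
begin

text \<open>
  On vertical subspaces O'Neill's tensor can be replaced by the bilinear forms \<open>fiber_form\<close>.
\<close>

lemma casorati_eq:
  assumes p: "p \<in> points M" and W: "subspace W" "W \<subseteq> vertical M N F p"
  defines "A \<equiv> some_onb (metric M p) (horizontal M N F p)" and "B \<equiv> some_onb (metric M p) W"
  shows "casorati M N F p W = (\<Sum>a\<in>A. \<Sum>u\<in>B. \<Sum>v\<in>B. (fiber_form p a u v)\<^sup>2) / real (dim W)"
proof -
  note b = M.metric_form[OF p]
  have "metric M p (oneill_T M N F p u v) a = fiber_form p a u v" if "a \<in> A" "u \<in> B" "v \<in> B" for a u v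
    using that orthonormal_basis_subset[OF some_onb[OF b]] W subspace_horizontal[OF p]
    unfolding A_def B_def by (intro oneill_T_fiber_form[OF p]) blast+
  then show ?thesis
    unfolding casorati_def Let_def A_def[symmetric] B_def[symmetric] by simp
qed

text \<open>
  The Casorati curvatures contain an infimum or a supremum over hyperplanes, so it suffices to bound the left-hand side for
  each hyperplane separately. There \<open>trace_squared_le_hyperplane\<close> is summed over the horizontal basis.
\<close>

lemma le_delta_casorati:
  assumes p: "p \<in> points M" and r: "2 \<le> dim (vertical M N F p)"
    and B: "orthonormal_basis (metric M p) (vertical M N F p) B"
  defines "A \<equiv> some_onb (metric M p) (horizontal M N F p)"
    and "r \<equiv> real (dim (vertical M N F p))"
  defines "Q \<equiv> \<Sum>a\<in>A. (\<Sum>u\<in>B. fiber_form p a u u)\<^sup>2"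
    and "NV \<equiv> \<Sum>a\<in>A. \<Sum>u\<in>B. \<Sum>v\<in>B. (fiber_form p a u v)\<^sup>2"
  shows "(Q - NV) / (r * (r - 1)) \<le> delta_C M N F p"
    and "(Q - NV) / (r * (r - 1)) \<le> delta_hat_C M N F p"
proof -
  let ?V = "vertical M N F p" and ?g = "metric M p"
  note b = M.metric_form[OF p]
  note V = subspace_vertical[OF p]
  have r2: "r \<ge> 2" using r unfolding r_def by simp
  then have r0: "0 < r" "0 < r - 1" "0 < r * (r - 1)" by auto
  have CV: "casorati M N F p ?V = NV / r"
    unfolding casorati_eq[OF p V order_refl] NV_def A_def r_def
    using square_norm_orthonormal_basis[OF b bilinear_fiber_form[OF p] some_onb[OF b V] B] by simp
  obtain L0 where "subspace L0" "L0 \<subseteq> ?V" "dim L0 + 1 = dim ?V"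
    using exists_hyperplane[OF V] r by auto
  then have ne: "vertical_hyperplanes M N F p \<noteq> {}" unfolding vertical_hyperplanes_def by blast
  have hyp: "Q - NV \<le> r * (r - 1) * (1 / 2 * (NV / r) + (r + 1) / (2 * r) * casorati M N F p L)"
    "Q - NV \<le> r * (r - 1) * (2 * (NV / r) - (2 * r - 1) / (2 * r) * casorati M N F p L)"
    if L: "L \<in> vertical_hyperplanes M N F p" for L
  proof -
    have L': "subspace L" "L \<subseteq> ?V" "dim L + 1 = dim ?V" using L unfolding vertical_hyperplanes_def by auto
    define BL where "BL = some_onb ?g L"
    define NL where "NL = (\<Sum>a\<in>A. \<Sum>u\<in>BL. \<Sum>v\<in>BL. (fiber_form p a u v)\<^sup>2)"
    have BL: "orthonormal_basis ?g L BL" unfolding BL_def using some_onb[OF b L'(1)] .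
    have dL: "real (dim L) = r - 1" using L'(3) unfolding r_def by linarith
    have CL: "casorati M N F p L = NL / (r - 1)"
      unfolding casorati_eq[OF p L'(1,2)] NL_def BL_def A_def dL ..
    have expand: "r * s * (1 / 2 * (NV / r) + (r + 1) / (2 * r) * (NL / s)) = s / 2 * NV + (r + 1) / 2 * NL"
      "r * s * (2 * (NV / r) - (2 * r - 1) / (2 * r) * (NL / s)) = 2 * s * NV - (2 * r - 1) / 2 * NL"
      if "s \<noteq> 0" for s using that r0(1) by (simp_all add: field_simps)
    have "r - 1 \<noteq> 0" using r0(2) by simp
    note expand1 = expand(1)[OF this] and expand2 = expand(2)[OF this]
    note tr = trace_squared_le_hyperplane[OF b bilinear_fiber_form[OF p] V L' r B BL]
    have "Q \<le> (r + 1) / 2 * (NV + NL)"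
      unfolding Q_def NV_def NL_def r_def sum.distrib[symmetric] sum_distrib_left
      by (intro sum_mono tr(1))
    then show "Q - NV \<le> r * (r - 1) * (1 / 2 * (NV / r) + (r + 1) / (2 * r) * casorati M N F p L)"
      unfolding CL expand1 by (simp add: field_simps)
    have "Q \<le> (\<Sum>a\<in>A. (2 * r - 1) * ((\<Sum>u\<in>B. \<Sum>v\<in>B. (fiber_form p a u v)\<^sup>2)
        - (\<Sum>u\<in>BL. \<Sum>v\<in>BL. (fiber_form p a u v)\<^sup>2) / 2))"
      unfolding Q_def r_def by (intro sum_mono tr(2))
    also have "\<dots> = (2 * r - 1) * (NV - NL / 2)"
      unfolding NV_def NL_def
      by (simp only: sum_distrib_left[symmetric] sum_subtractf sum_divide_distrib[symmetric])
    finally have "Q \<le> (2 * r - 1) * (NV - NL / 2)" .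
    then show "Q - NV \<le> r * (r - 1) * (2 * (NV / r) - (2 * r - 1) / (2 * r) * casorati M N F p L)"
      unfolding CL expand2 by (simp add: field_simps)
  qed
  let ?k = "(Q - NV) / (r * (r - 1))"
  have k: "?k \<le> 1 / 2 * (NV / r) + (r + 1) / (2 * r) * casorati M N F p L"
    "?k \<le> 2 * (NV / r) - (2 * r - 1) / (2 * r) * casorati M N F p L"
    if L: "L \<in> vertical_hyperplanes M N F p" for L
    using hyp[OF L] r0(3) by (simp_all add: pos_divide_le_eq mult.commute)
  have "(?k - 1 / 2 * (NV / r)) / ((r + 1) / (2 * r)) \<le> (INF L \<in> vertical_hyperplanes M N F p. casorati M N F p L)"
  proof (rule cINF_greatest[OF ne])
    fix L assume "L \<in> vertical_hyperplanes M N F p"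
    from k(1)[OF this] have "?k - 1 / 2 * (NV / r) \<le> (r + 1) / (2 * r) * casorati M N F p L" by linarith
    then show "(?k - 1 / 2 * (NV / r)) / ((r + 1) / (2 * r)) \<le> casorati M N F p L"
      using r0 by (subst pos_divide_le_eq) (auto simp: mult.commute)
  qed
  then have "?k - 1 / 2 * (NV / r) \<le> (INF L \<in> vertical_hyperplanes M N F p. casorati M N F p L) * ((r + 1) / (2 * r))"
    using r0 by (subst (asm) pos_divide_le_eq) auto
  then show "?k \<le> delta_C M N F p"
    unfolding delta_C_def Let_def r_def[symmetric] CV by (simp add: mult.commute)
  have "(SUP L \<in> vertical_hyperplanes M N F p. casorati M N F p L) \<le> (2 * (NV / r) - ?k) / ((2 * r - 1) / (2 * r))"
  proof (rule cSUP_least[OF ne])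
    fix L assume "L \<in> vertical_hyperplanes M N F p"
    from k(2)[OF this] have "(2 * r - 1) / (2 * r) * casorati M N F p L \<le> 2 * (NV / r) - ?k" by linarith
    then show "casorati M N F p L \<le> (2 * (NV / r) - ?k) / ((2 * r - 1) / (2 * r))"
      using r2 by (subst pos_le_divide_eq) (auto simp: mult.commute)
  qed
  then have "(SUP L \<in> vertical_hyperplanes M N F p. casorati M N F p L) * ((2 * r - 1) / (2 * r)) \<le> 2 * (NV / r) - ?k"
    using r2 by (subst (asm) pos_le_divide_eq) auto
  then show "?k \<le> delta_hat_C M N F p"
    unfolding delta_hat_C_def Let_def r_def[symmetric] CV by (simp add: mult.commute)
qed

section \<open>The ambient curvature term\<close>

text \<open>
  The sum is the squared length of the vertical part of \<open>J v\<close>. As \<open>J v\<close> is a unit vector, this length is the cosine of the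
  angle between \<open>J v\<close> and the vertical space.
\<close>

lemma slant_sum:
  assumes J: "almost_hermitian M J" and slant: "pointwise_slant M J N F \<theta>"
    and p: "p \<in> points M" and B: "orthonormal_basis (metric M p) (vertical M N F p) B" and v: "v \<in> B"
  shows "(\<Sum>u\<in>B. (metric M p u (J p v))\<^sup>2) = (cos (\<theta> p))\<^sup>2"
proof -
  let ?g = "metric M p" and ?V = "vertical M N F p"
  note b = M.metric_form[OF p] and V = subspace_vertical[OF p]
  define P where "P = orth_proj ?g ?V (J p v)"
  have vV: "v \<in> ?V" using orthonormal_basis_subset[OF B v] .
  have vv: "?g v v = 1" using B v unfolding orthonormal_basis_def by auto
  then have v0: "v \<noteq> 0" by (auto simp: inner_form_simps[OF b])
  have JJ: "?g (J p v) (J p v) = 1" using J p vv unfolding almost_hermitian_def by simp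
  have P: "P \<in> ?V" "\<And>w. w \<in> ?V \<Longrightarrow> ?g (J p v - P) w = 0"
    unfolding P_def using orth_proj(1,2)[OF b V] by blast+
  have Pw: "?g P w = ?g (J p v) w" if "w \<in> ?V" for w using P(2)[OF that] by (simp add: inner_form_simps[OF b])
  have "?g P P = (\<Sum>u\<in>B. ?g P u * ?g u P)" using orthonormal_basis_parseval[OF b B P(1)] .
  also have "\<dots> = (\<Sum>u\<in>B. (?g u (J p v))\<^sup>2)"
  proof (intro sum.cong refl)
    fix u assume "u \<in> B"
    then have "?g P u = ?g u (J p v)" using Pw[OF orthonormal_basis_subset[OF B]] inner_form_sym[OF b] by metis
    then show "?g P u * ?g u P = (?g u (J p v))\<^sup>2" using inner_form_sym[OF b, of u P] by (simp add: power2_eq_square)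
  qed
  finally have sum: "(\<Sum>u\<in>B. (?g u (J p v))\<^sup>2) = ?g P P" ..
  have "?g (J p v - P) (J p v - P) = 1 - ?g P P"
    using Pw[OF P(1)] JJ inner_form_sym[OF b, of P "J p v"] by (simp add: inner_form_simps[OF b])
  then have "?g P P \<le> 1" using inner_form_nonneg[OF b, of "J p v - P"] by linarith
  moreover have PP: "0 \<le> ?g P P" using inner_form_nonneg[OF b] .
  ultimately have le: "sqrt (?g P P) \<le> 1" "-1 \<le> sqrt (?g P P)"
    using real_sqrt_ge_zero[OF PP] by (auto intro: order_trans[of _ 0])
  have "angle_to_subspace ?g (J p v) ?V = \<theta> p"
    using slant p vV v0 unfolding pointwise_slant_def by blast
  then have "arccos (sqrt (?g P P)) = \<theta> p"
    unfolding angle_to_subspace_def norm_wrt_def P_def[symmetric] JJ by simp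
  then have "sqrt (?g P P) = cos (\<theta> p)" using cos_arccos[OF le(2,1)] by simp
  then show ?thesis unfolding sum using PP by (metis real_sqrt_pow2)
qed

lemma ambient_scalar_curvature:
  assumes gcsf: "generalized_complex_space_form M J c1 c2" and slant: "pointwise_slant M J N F \<theta>"
    and p: "p \<in> points M" and B: "orthonormal_basis (metric M p) (vertical M N F p) B"
  defines "r \<equiv> real (dim (vertical M N F p))"
  shows "(\<Sum>u\<in>B. \<Sum>v\<in>B. metric M p (curvature M p u v v) u) =
    c1 p * (r * (r - 1)) + 3 * c2 p * r * (cos (\<theta> p))\<^sup>2"
proof -
  let ?g = "metric M p"
  note b = M.metric_form[OF p]
  have J: "almost_hermitian M J" using gcsf unfolding generalized_complex_space_form_def by blast
  have R: "curvature M p X Y Z = c1 p *\<^sub>R (?g Y Z *\<^sub>R X - ?g X Z *\<^sub>R Y) +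
      c2 p *\<^sub>R (?g X (J p Z) *\<^sub>R J p Y - ?g Y (J p Z) *\<^sub>R J p X + (2 * ?g X (J p Y)) *\<^sub>R J p Z)" for X Y Z
    using gcsf p unfolding generalized_complex_space_form_def Let_def by blast
  have Jv: "?g v (J p v) = 0" for v
  proof -
    have "?g (J p v) (J p (J p v)) = ?g v (J p v)" "J p (J p v) = - v"
      using J p unfolding almost_hermitian_def by blast+
    then have "- ?g (J p v) v = ?g v (J p v)" by (simp add: inner_form_simps[OF b])
    then show ?thesis using inner_form_sym[OF b, of v "J p v"] by linarith
  qed
  have fin: "finite B" and card: "real (card B) = r"
    using B orthonormal_basis_independent(2)[OF b B] unfolding orthonormal_basis_def r_def by auto
  have on: "?g u v = (if u = v then 1 else 0)" if "u \<in> B" "v \<in> B" for u v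
    using B that unfolding orthonormal_basis_def by blast
  have entry: "?g (curvature M p u v v) u = c1 p * (1 - (if u = v then 1 else 0)) + 3 * c2 p * (?g u (J p v))\<^sup>2"
    if "u \<in> B" "v \<in> B" for u v
  proof -
    have "?g (curvature M p u v v) u = c1 p * (?g v v * ?g u u - ?g u v * ?g v u)
        + c2 p * (?g u (J p v) * ?g (J p v) u + 2 * ?g u (J p v) * ?g (J p v) u)"
      unfolding R by (simp add: inner_form_simps[OF b] Jv)
    then show ?thesis
      using that inner_form_sym[OF b, of "J p v" u] by (simp add: on power2_eq_square)
  qed
  have "(\<Sum>u\<in>B. \<Sum>v\<in>B. ?g (curvature M p u v v) u) =
      (\<Sum>u\<in>B. \<Sum>v\<in>B. c1 p * (1 - (if u = v then 1 else 0)) + 3 * c2 p * (?g u (J p v))\<^sup>2)"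
    by (intro sum.cong refl entry)
  also have "\<dots> = (\<Sum>u\<in>B. \<Sum>v\<in>B. c1 p * (1 - (if u = v then 1 else 0))) + 3 * c2 p * (\<Sum>u\<in>B. \<Sum>v\<in>B. (?g u (J p v))\<^sup>2)"
    by (simp add: sum.distrib sum_distrib_left)
  also have "(\<Sum>u\<in>B. \<Sum>v\<in>B. c1 p * (1 - (if u = v then 1 else 0))) = c1 p * (r * (r - 1))"
    using fin card by (simp add: sum_distrib_left[symmetric] sum_subtractf)
  also have "(\<Sum>u\<in>B. \<Sum>v\<in>B. (?g u (J p v))\<^sup>2) = (\<Sum>v\<in>B. \<Sum>u\<in>B. (?g u (J p v))\<^sup>2)" by (rule sum.swap)
  also have "\<dots> = r * (cos (\<theta> p))\<^sup>2"
    using slant_sum[OF J slant p B] card by simp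
  finally show ?thesis by (simp add: mult.assoc)
qed

end

section \<open>The inequalities\<close>

lemma (in submersion_fiber) normalized_scalar_curvature_le:
  assumes gcsf: "generalized_complex_space_form M J c1 c2" and slant: "pointwise_slant M J N F \<theta>"
    and p: "p \<in> points K" and r: "2 \<le> DIM('k)"
  defines "C \<equiv> c1 p + 3 * c2 p / (real DIM('k) - 1) * (cos (\<theta> p))\<^sup>2"
  shows "normalized_scalar_curvature K p \<le> delta_C M N F p + C"
    and "normalized_scalar_curvature K p \<le> delta_hat_C M N F p + C"
proof -
  note pM = points_KD(1)[OF p]
  define BK where "BK = some_onb (metric K p) UNIV"
  have BK: "orthonormal_basis (metric K p) UNIV BK"
    unfolding BK_def using some_onb[OF inner_form_K[OF p] subspace_UNIV] .
  define B where "B = d_incl p ` BK"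
  have B: "orthonormal_basis (metric M p) (vertical M N F p) B"
    unfolding B_def using orthonormal_basis_d_incl[OF p BK] .
  define A where "A = some_onb (metric M p) (horizontal M N F p)"
  have A: "orthonormal_basis (metric M p) (horizontal M N F p) A"
    unfolding A_def using some_onb[OF M.metric_form[OF pM] subspace_horizontal[OF pM]] .
  define D where "D = (\<Sum>a\<in>A. (\<Sum>u\<in>B. fiber_form p a u u)\<^sup>2) - (\<Sum>a\<in>A. \<Sum>u\<in>B. \<Sum>v\<in>B. (fiber_form p a u v)\<^sup>2)"
  let ?r = "real DIM('k)"
  have r': "0 < ?r" "0 < ?r - 1" using r by auto
  have "normalized_scalar_curvature K p =
      (c1 p * (?r * (?r - 1)) + 3 * c2 p * ?r * (cos (\<theta> p))\<^sup>2 + D) / (?r * (?r - 1))"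
    unfolding normalized_scalar_curvature_def Let_def BK_def[symmetric] fiber_scalar_curvature[OF p BK A]
      B_def[symmetric] ambient_scalar_curvature[OF gcsf slant pM B] dim_vertical[OF pM] D_def
    by simp
  also have "\<dots> = C + D / (?r * (?r - 1))"
  proof -
    have "(c1 p * (?r * s) + 3 * c2 p * ?r * t + D) / (?r * s) = c1 p + 3 * c2 p / s * t + D / (?r * s)"
      if "s \<noteq> 0" for s t :: real using that r'(1) by (simp add: field_simps)
    then show ?thesis unfolding C_def using r'(2) by simp
  qed
  finally have eq: "normalized_scalar_curvature K p = C + D / (?r * (?r - 1))" .
  have "2 \<le> dim (vertical M N F p)" using r dim_vertical[OF pM] by simp
  from le_delta_casorati[OF pM this B]
  have "D / (?r * (?r - 1)) \<le> delta_C M N F p" "D / (?r * (?r - 1)) \<le> delta_hat_C M N F p"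
    unfolding D_def A_def dim_vertical[OF pM] .
  then show "normalized_scalar_curvature K p \<le> delta_C M N F p + C"
    "normalized_scalar_curvature K p \<le> delta_hat_C M N F p + C"
    unfolding eq by simp_all
qed

theorem corollary4p1:
  fixes M1 :: "('a, 'e1::euclidean_space) riemannian"
    and M2 :: "('b, 'e2::euclidean_space) riemannian"
    and J1 :: "'a \<Rightarrow> 'e1 \<Rightarrow> 'e1"
    and F :: "'a \<Rightarrow> 'b"
    and \<theta> :: "'a \<Rightarrow> real"
    and r :: nat
    and \<rho> :: "'a \<Rightarrow> real"
  defines "\<rho> \<equiv> (\<lambda>p. normalized_scalar_curvature
                       (fiber M1 F (F p) :: ('a, 'k::euclidean_space) riemannian) p)"
  assumes "almost_hermitian M1 J1"
    and "riemannian_submersion M1 M2 F"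
    and "pointwise_slant M1 J1 M2 F \<theta>"
    and "\<forall>p \<in> points M1. dim (vertical M1 M2 F p) = r"
    and "DIM('k) = r"
    and "3 \<le> r"
  shows "(\<forall>c. real_space_form M1 J1 c \<longrightarrow>
            (\<forall>p \<in> points M1.
               \<rho> p \<le> delta_C M1 M2 F p + c \<and>
               \<rho> p \<le> delta_hat_C M1 M2 F p + c)) \<and>
         (\<forall>c. complex_space_form M1 J1 c \<longrightarrow>
            (\<forall>p \<in> points M1.
               \<rho> p \<le> delta_C M1 M2 F p + c / 4 * (1 + 3 / (real r - 1) * (cos (\<theta> p))\<^sup>2) \<and>
               \<rho> p \<le> delta_hat_C M1 M2 F p + c / 4 * (1 + 3 / (real r - 1) * (cos (\<theta> p))\<^sup>2))) \<and>
         (\<forall>c \<alpha>. real_kaehler_space_form M1 J1 c \<alpha> \<longrightarrow>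
            (\<forall>p \<in> points M1.
               \<rho> p \<le> delta_C M1 M2 F p + (c + 3 * \<alpha>) / 4
                       + 3 * (c - \<alpha>) / (4 * (real r - 1)) * (cos (\<theta> p))\<^sup>2 \<and>
               \<rho> p \<le> delta_hat_C M1 M2 F p + (c + 3 * \<alpha>) / 4
                       + 3 * (c - \<alpha>) / (4 * (real r - 1)) * (cos (\<theta> p))\<^sup>2))"
proof -
  have r: "0 < real r - 1" using assms(7) by simp
  have bound: "\<rho> p \<le> delta_C M1 M2 F p + (c1 + 3 * c2 / (real r - 1) * (cos (\<theta> p))\<^sup>2)"
    "\<rho> p \<le> delta_hat_C M1 M2 F p + (c1 + 3 * c2 / (real r - 1) * (cos (\<theta> p))\<^sup>2)"
    if form: "generalized_complex_space_form M1 J1 (\<lambda>_. c1) (\<lambda>_. c2)" and p: "p \<in> points M1" for c1 c2 p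
  proof -
    interpret submersion_fiber M1 M2 F "fiber M1 F (F p) :: ('a, 'k) riemannian" "F p"
      by unfold_locales (use assms in auto)
    have pK: "p \<in> points (fiber M1 F (F p) :: ('a, 'k) riemannian)" unfolding points_K using p by simp
    show "\<rho> p \<le> delta_C M1 M2 F p + (c1 + 3 * c2 / (real r - 1) * (cos (\<theta> p))\<^sup>2)"
      "\<rho> p \<le> delta_hat_C M1 M2 F p + (c1 + 3 * c2 / (real r - 1) * (cos (\<theta> p))\<^sup>2)"
      using normalized_scalar_curvature_le[OF form assms(4) pK] assms(6,7) unfolding \<rho>_def by auto
  qed
  show ?thesis
  proof (intro conjI allI impI ballI)
    fix c p assume "real_space_form M1 J1 c" and p: "p \<in> points M1"
    then have "generalized_complex_space_form M1 J1 (\<lambda>_. c) (\<lambda>_. 0)" unfolding real_space_form_def by blast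
    from bound[OF this p] show "\<rho> p \<le> delta_C M1 M2 F p + c" "\<rho> p \<le> delta_hat_C M1 M2 F p + c" by simp_all
  next
    fix c p assume "complex_space_form M1 J1 c" and p: "p \<in> points M1"
    then have "generalized_complex_space_form M1 J1 (\<lambda>_. c / 4) (\<lambda>_. c / 4)" unfolding complex_space_form_def by blast
    from bound[OF this p]
    show "\<rho> p \<le> delta_C M1 M2 F p + c / 4 * (1 + 3 / (real r - 1) * (cos (\<theta> p))\<^sup>2)"
      "\<rho> p \<le> delta_hat_C M1 M2 F p + c / 4 * (1 + 3 / (real r - 1) * (cos (\<theta> p))\<^sup>2)"
      by (simp_all add: algebra_simps)
  next
    fix c \<alpha> p assume "real_kaehler_space_form M1 J1 c \<alpha>" and p: "p \<in> points M1"
    then have "generalized_complex_space_form M1 J1 (\<lambda>_. (c + 3 * \<alpha>) / 4) (\<lambda>_. (c - \<alpha>) / 4)"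
      unfolding real_kaehler_space_form_def by blast
    from bound[OF this p]
    show "\<rho> p \<le> delta_C M1 M2 F p + (c + 3 * \<alpha>) / 4 + 3 * (c - \<alpha>) / (4 * (real r - 1)) * (cos (\<theta> p))\<^sup>2"
      "\<rho> p \<le> delta_hat_C M1 M2 F p + (c + 3 * \<alpha>) / 4 + 3 * (c - \<alpha>) / (4 * (real r - 1)) * (cos (\<theta> p))\<^sup>2"
      by (simp_all add: add.assoc)
  qed
qed

end
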